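(* Let $L\ge 1$ and let $|\psi\rangle$ be a pure $L$-qubit state with one unit of nonstabilizerness, encoding one logical qubit, of the form $$\rho=|\psi\rangle\langle\psi|=\frac{1}{2^{L}}\Big(\mathbb 1+\frac{\bar Z-\bar Y}{\sqrt 2}\Big)\prod_{j=2}^{L}(\mathbb 1+g_j),$$ where $\mathcal G=\langle g_2,\dots,g_L\rangle$ is the stabilizer group of a stabilizer code encoding one logical qubit, with independent generators $g_2,\dots,g_L$, and $\bar X,\bar Y,\bar Z$ are logical operators of this code. Let $A\subseteq\{1,\dots,L\}$ be any subset of qubits with complement $B=\{1,\dots,L\}\setminus A$. Then: (1) There exists a bipartite magic gauge, i.e. a choice of logical operators $\bar Z,\bar Y$ (each replaced, if necessary, by another representative of its coset $\bar Z\mathcal G$, $\bar Y\mathcal G$) and of independent generators $a_1,\dots,a_{n_A},b_1,\dots,b_{n_B},h_1,\dots,h_m$ of $\mathcal G$, with $n_A+n_B+m=L-1$, such that $$\rho=\Big(\frac{\mathbb 1}{2}+\frac{\bar Z-\bar Y}{2\sqrt2}\Big)\prod_{i=1}^{n_A}\frac{\mathbb 1+a_i}{2}\prod_{j=1}^{n_B}\frac{\mathbb 1+b_j}{2}\prod_{k=1}^{m}\frac{\mathbb 1+h_k}{2},$$ where the support of each $a_i$ can be reduced to $A$ but not to $B$, the support of each $b_j$ can be reduced to $B$ but not to $A$, and the support of each $h_k$ can be reduced neither to $A$ nor to $B$. (2) Exactly one of the following five cases holds for the reducibility of the logicals $\bar Z$ and $\bar Y$, and in each case the stabilizer 2-Rényi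 entropy $\tilde{\mathcal M}_2(\rho_A)$ and the robustness of magic $\mathcal R(\rho_A)$ of $\rho_A=\mathrm{Tr}_B\,\rho$ are as listed: (i) $\bar Z$ and $\bar Y$ are both reducible to $A$, and neither is reducible to $B$; then $\tilde{\mathcal M}_2(\rho_A)=\log_2(4/3)$ and $\mathcal R(\rho_A)=\sqrt2$. (ii) $\bar Z$ and $\bar Y$ are both reducible to $B$, and neither is reducible to $A$; then $\tilde{\mathcal M}_2(\rho_A)=0$ and $\mathcal R(\rho_A)=1$. (iii) Neither $\bar Z$ nor $\bar Y$ is reducible to $A$, and neither is reducible to $B$; then $\tilde{\mathcal M}_2(\rho_A)=0$ and $\mathcal R(\rho_A)=1$. (iv) $\bar Z$ is reducible to $A$ and also reducible to $B$, while $\bar Y$ is reducible neither to $A$ nor to $B$; then $\tilde{\mathcal M}_2(\rho_A)=\log_2(6/5)$ and $\mathcal R(\rho_A)=1$. (v) $\bar Y$ is reducible to $A$ and also reducible to $B$, while $\bar Z$ is reducible neither to $A$ nor to $B$; then $\tilde{\mathcal M}_2(\rho_A)=\log_2(6/5)$ and $\mathcal R(\rho_A)=1$.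
   Context: Hermitian Pauli operators on $L$ qubits are $\pm$ tensor products of single-qubit operators from $\{\mathbb 1,X,Y,Z\}$; the support of such an operator is the set of qubits on which it acts non-trivially, and it is supported on $A$ if its support is contained in $A$ (it acts as the identity on $B$). Stabilizer code encoding one logical qubit: an abelian group $\mathcal G$ of Hermitian Pauli operators on $L$ qubits with $-\mathbb 1\notin\mathcal G$, generated by $L-1$ independent elements $g_2,\dots,g_L$. Logical operators are Hermitian Pauli operators that commute with every element of $\mathcal G$ and do not lie in $\pm\mathcal G$. $\bar X,\bar Y,\bar Z$ are logical operators that pairwise anticommute, with $\bar Y=i\bar X\bar Z$; up to sign every logical operator lies in exactly one of the cosets $\bar X\mathcal G$, $\bar Y\mathcal G$, $\bar Z\mathcal G$. Reducibility: a logical operator $\bar\sigma$ is reducible to a set of qubits $S$ if there is $g\in\mathcal G$ such that $g\bar\sigma$ is supported on $S$. For a generator $s$ belonging to a fixed independent generating set of $\mathcal G$, its support can be reduced to $S$ if there is an element $g$ of the subgroup generated by the other generators in the set such that $gs$ is supported on $S$. "One unit of nonstabilizerness" means one unitarily-extractable magic state; this is what the displayed form of $\rho$ expresses. Stabilizer 2-Rényi entropy of a (possibly mixed) state $\rho$ on $n$ qubits: $\tilde{\mathcal M}_2(\rho)=-\log_2\dfrac{\sum_P \mathrm{Tr}[P\rho]^4}{\sum_P\mathrm{Tr}[P\rho]^2}$, where $P$ ranges over the $4^n$ Pauli strings with phase $+1$. Robustness of magic of a state $\rho$ on $n$ qubits: $\mathcal R(\rho)=\min\{\sum_i|x_i|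 : \rho=\sum_i x_i\sigma_i,\ x_i\in\mathbb R,\ \sum_i x_i=1\}$, where $\sigma_i$ ranges over (the density matrices of) all pure $n$-qubit stabilizer states. *)

theory Defs
  imports
    Complex_Main
    "HOL-Algebra.Generated_Groups"
    "Jordan_Normal_Form.Schur_Decomposition"
begin

text \<open>
  Conventions. The qubits of an \<open>n\<close>-qubit system are \<open>0, \<dots>, n - 1\<close>. Operators are complex
  \<open>2 ^ n \<times> 2 ^ n\<close> matrices, and the computational basis state in which qubit \<open>q\<close> is in state
  \<open>b\<^sub>q\<close> has index \<open>\<Sum>q<n. b\<^sub>q * 2 ^ q\<close>, so that the state of qubit \<open>q\<close> is bit \<open>q\<close> of the index.
\<close>

definition mat_trace :: "complex mat \<Rightarrow> complex" where
  "mat_trace M = sum_list (diag_mat M)"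

definition pure_density :: "complex vec \<Rightarrow> complex mat" where
  "pure_density v = mat (dim_vec v) (dim_vec v) (\<lambda>(i, j). v $ i * cnj (v $ j))"

definition mat_prod_list :: "nat \<Rightarrow> complex mat list \<Rightarrow> complex mat" where
  "mat_prod_list n Ms = foldr (*) Ms (1\<^sub>m (2 ^ n))"


subsection \<open>Pauli operators\<close>

datatype pauli = PI | PX | PY | PZ

fun pauli_mat :: "pauli \<Rightarrow> complex mat" where
  "pauli_mat PI = mat_of_rows_list 2 [[1, 0], [0, 1]]"
| "pauli_mat PX = mat_of_rows_list 2 [[0, 1], [1, 0]]"
| "pauli_mat PY = mat_of_rows_list 2 [[0, - \<i>], [\<i>, 0]]"
| "pauli_mat PZ = mat_of_rows_list 2 [[1, 0], [0, - 1]]"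

text \<open>
  The entries of the tensor product of the single-qubit operators in the list: an entry of a tensor
  product is the product of the corresponding entries of the factors.
\<close>

definition pauli_string :: "pauli list \<Rightarrow> complex mat" where
  "pauli_string ps = mat (2 ^ length ps) (2 ^ length ps)
     (\<lambda>(i, j). \<Prod>q<length ps. pauli_mat (ps ! q) $$ (of_bool (bit i q), of_bool (bit j q)))"

definition pauli_support :: "pauli list \<Rightarrow> nat set" where
  "pauli_support ps = {q. q < length ps \<and> ps ! q \<noteq> PI}"

definition hermitian_pauli :: "nat \<Rightarrow> complex mat \<Rightarrow> bool" where
  "hermitian_pauli n M \<longleftrightarrow>
     (\<exists>ps. length ps = n \<and> (M = pauli_string ps \<or> M = - pauli_string ps))"

definition supported_on :: "nat \<Rightarrow> complex mat \<Rightarrow> nat set \<Rightarrow> bool" where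
  "supported_on n M S \<longleftrightarrow>
     (\<exists>ps. length ps = n \<and> (M = pauli_string ps \<or> M = - pauli_string ps) \<and> pauli_support ps \<subseteq> S)"


subsection \<open>Stabilizer groups and logical operators\<close>

definition GL :: "nat \<Rightarrow> complex mat monoid" where
  "GL n = units_of (ring_mat TYPE(complex) (2 ^ n) ())"

definition stabilizer_group :: "nat \<Rightarrow> complex mat set \<Rightarrow> bool" where
  "stabilizer_group n G \<longleftrightarrow>
     subgroup G (GL n) \<and>
     (\<forall>g\<in>G. hermitian_pauli n g) \<and>
     (\<forall>g\<in>G. \<forall>h\<in>G. g * h = h * g) \<and>
     - 1\<^sub>m (2 ^ n) \<notin> G"

definition independent_generators :: "nat \<Rightarrow> complex mat set \<Rightarrow> complex mat list \<Rightarrow> bool" where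
  "independent_generators n G gs \<longleftrightarrow>
     distinct gs \<and> set gs \<subseteq> G \<and> generate (GL n) (set gs) = G \<and>
     (\<forall>g\<in>set gs. g \<notin> generate (GL n) (set gs - {g}))"

definition logical_operator :: "nat \<Rightarrow> complex mat set \<Rightarrow> complex mat \<Rightarrow> bool" where
  "logical_operator n G s \<longleftrightarrow>
     hermitian_pauli n s \<and> (\<forall>g\<in>G. s * g = g * s) \<and> s \<notin> G \<and> - s \<notin> G"

definition logical_xyz ::
    "nat \<Rightarrow> complex mat set \<Rightarrow> complex mat \<Rightarrow> complex mat \<Rightarrow> complex mat \<Rightarrow> bool" where
  "logical_xyz n G X Y Z \<longleftrightarrow>
     logical_operator n G X \<and> logical_operator n G Y \<and> logical_operator n G Z \<and>
     X * Y = - (Y * X) \<and> Y * Z = - (Z * Y) \<and> Z * X = - (X * Z) \<and>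
     Y = \<i> \<cdot>\<^sub>m (X * Z)"

definition reducible :: "nat \<Rightarrow> complex mat set \<Rightarrow> complex mat \<Rightarrow> nat set \<Rightarrow> bool" where
  "reducible n G s S \<longleftrightarrow> (\<exists>g\<in>G. supported_on n (g * s) S)"

definition generator_reducible :: "nat \<Rightarrow> complex mat list \<Rightarrow> complex mat \<Rightarrow> nat set \<Rightarrow> bool" where
  "generator_reducible n gs s S \<longleftrightarrow> reducible n (generate (GL n) (set gs - {s})) s S"

text \<open>The five cases for the reducibility of the logical operators \<open>Z\<close> and \<open>Y\<close> to \<open>A\<close> and \<open>B\<close>.\<close>

datatype magic_case = Case_i | Case_ii | Case_iii | Case_iv | Case_v

fun in_magic_case ::
    "nat \<Rightarrow> complex mat set \<Rightarrow> complex mat \<Rightarrow> complex mat \<Rightarrow> nat set \<Rightarrow> nat set \<Rightarrow> magic_case \<Rightarrow> bool"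
where
  "in_magic_case n G Z Y A B Case_i \<longleftrightarrow>
     reducible n G Z A \<and> reducible n G Y A \<and> \<not> reducible n G Z B \<and> \<not> reducible n G Y B"
| "in_magic_case n G Z Y A B Case_ii \<longleftrightarrow>
     reducible n G Z B \<and> reducible n G Y B \<and> \<not> reducible n G Z A \<and> \<not> reducible n G Y A"
| "in_magic_case n G Z Y A B Case_iii \<longleftrightarrow>
     \<not> reducible n G Z A \<and> \<not> reducible n G Y A \<and> \<not> reducible n G Z B \<and> \<not> reducible n G Y B"
| "in_magic_case n G Z Y A B Case_iv \<longleftrightarrow>
     reducible n G Z A \<and> reducible n G Z B \<and> \<not> reducible n G Y A \<and> \<not> reducible n G Y B"
| "in_magic_case n G Z Y A B Case_v \<longleftrightarrow>
     reducible n G Y A \<and> reducible n G Y B \<and> \<not> reducible n G Z A \<and> \<not> reducible n G Z B"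


subsection \<open>Partial trace\<close>

text \<open>
  For disjoint finite \<open>A\<close> and \<open>B\<close>, the index of the basis state of the qubits \<open>A \<union> B\<close> that restricts
  to the basis state \<open>i\<close> of \<open>A\<close> and to the basis state \<open>k\<close> of \<open>B\<close>. As states of their own, the
  subsystems have their qubits renumbered in increasing order: \<open>q \<in> A\<close> becomes qubit
  \<open>card {a \<in> A. a < q}\<close>.
\<close>

definition join_index :: "nat set \<Rightarrow> nat set \<Rightarrow> nat \<Rightarrow> nat \<Rightarrow> nat" where
  "join_index A B i k =
     (\<Sum>q\<in>A. of_bool (bit i (card {a \<in> A. a < q})) * 2 ^ q) +
     (\<Sum>q\<in>B. of_bool (bit k (card {b \<in> B. b < q})) * 2 ^ q)"

text \<open>The state of the \<open>card A\<close> qubits in \<open>A\<close>, obtained by tracing out those in \<open>B\<close>.\<close>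

definition reduced_state :: "nat set \<Rightarrow> nat set \<Rightarrow> complex mat \<Rightarrow> complex mat" where
  "reduced_state A B M = mat (2 ^ card A) (2 ^ card A)
     (\<lambda>(i, j). \<Sum>k<2 ^ card B. M $$ (join_index A B i k, join_index A B j k))"


subsection \<open>Measures of nonstabilizerness\<close>

text \<open>\<open>Re\<close> only changes the type here: \<open>Tr[P\<rho>]\<close> is real for Hermitian \<open>\<rho>\<close>.\<close>

definition stabilizer_renyi_entropy_2 :: "nat \<Rightarrow> complex mat \<Rightarrow> real" where
  "stabilizer_renyi_entropy_2 n \<rho> =
     - log 2 ((\<Sum>ps | length ps = n. Re (mat_trace (pauli_string ps * \<rho>)) ^ 4) /
              (\<Sum>ps | length ps = n. Re (mat_trace (pauli_string ps * \<rho>)) ^ 2))"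

text \<open>Pure states fixed by a stabilizer group with the maximal number \<open>n\<close> of independent generators.\<close>

definition stabilizer_state :: "nat \<Rightarrow> complex vec \<Rightarrow> bool" where
  "stabilizer_state n v \<longleftrightarrow>
     v \<in> carrier_vec (2 ^ n) \<and> v \<bullet>c v = 1 \<and>
     (\<exists>S gs. stabilizer_group n S \<and> independent_generators n S gs \<and> length gs = n \<and>
        (\<forall>g\<in>S. g *\<^sub>v v = v))"

text \<open>
  A decomposition over all stabilizer states is given by its coefficients on a finite set \<open>T\<close> of them,
  the other coefficients being zero. \<open>LEAST\<close> expresses that the minimum is attained.
\<close>

definition robustness :: "nat \<Rightarrow> complex mat \<Rightarrow> real" where
  "robustness n \<rho> = (LEAST r. \<exists>T x.
     finite T \<and> T \<subseteq> {pure_density v |v. stabilizer_state n v} \<and>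
     (\<Sum>\<sigma>\<in>T. x \<sigma>) = 1 \<and>
     \<rho> = mat (2 ^ n) (2 ^ n) (\<lambda>(i, j). \<Sum>\<sigma>\<in>T. complex_of_real (x \<sigma>) * \<sigma> $$ (i, j)) \<and>
     r = (\<Sum>\<sigma>\<in>T. \<bar>x \<sigma>\<bar>))"

end

theory Submission
  imports Defs
begin

text \<open>
  Dropping signs turns Pauli operators into vectors over the field with two elements and commutation
  into a nondegenerate symplectic form; a character sum gives \<open>|W| |W\<^sup>\<bottom>| = 4\<^sup>n\<close> and hence
  \<open>W\<^sup>\<bottom>\<^sup>\<bottom> = W\<close>. Applied to \<open>G P\<^sub>A\<close>, where \<open>P\<^sub>A\<close> are the operators supported on \<open>A\<close>, this yields the
  cleaning lemma: a logical operator that is not reducible to \<open>A\<close> anticommutes with a logical operator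
  supported on \<open>B\<close>. Since logical operators supported on \<open>A\<close> and on \<open>B\<close> commute, only the five cases
  remain. The magic gauge extends a basis of \<open>G\<^sub>A \<times> G\<^sub>B\<close> to one of \<open>G\<close>, where \<open>G\<^sub>A\<close> and \<open>G\<^sub>B\<close> are the
  elements of \<open>G\<close> supported on \<open>A\<close> and on \<open>B\<close>.

  The reduced state is \<open>2\<close> to the power \<open>-|A|\<close> times the sum of \<open>G\<^sub>A\<close>, of \<open>Z G\<^sub>A / \<surd>2\<close> if \<open>Z\<close> is
  reducible to \<open>A\<close>, and of \<open>- Y G\<^sub>A / \<surd>2\<close> if \<open>Y\<close> is; the entropy follows by counting. Every
  stabilizer group sum is a convex combination of pure stabilizer states, as adjoining \<open>\<plusminus>P\<close> to the
  group splits it into two halves. With \<open>\<sigma>(\<plusminus>P)\<close> the normalised sum of the group generated by \<open>G\<^sub>A\<close> and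
  \<open>\<plusminus>P\<close>, the robustness \<open>\<surd>2\<close> is attained by
  \<open>\<sigma>(Z) / 2 + (1 - \<surd>2) \<sigma>(-Z) / 2 + \<sigma>(-Y) / \<surd>2\<close>, and it is optimal because
  \<open>|Tr[(Z - Y) \<sigma>]| \<le> 1\<close> for every stabilizer state \<open>\<sigma>\<close>: of two anticommuting Pauli operators at
  most one has a nonzero expectation.
\<close>


section \<open>Single-qubit Pauli operators\<close>

text \<open>A state is handled only through the function \<open>e\<close> of
  \<open>pauli_op n e\<close>, where \<open>e ps\<close> is the trace of
  \<open>pauli_string ps\<close> times the state. The partial trace restricts \<open>e\<close> to
  strings supported on \<open>A\<close>, the entropy sums powers of \<open>e\<close>, and a
  decomposition into stabilizer states is a linear identity between such functions. The obstacle is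
  the phase \<i> in products of anticommuting strings. Support, counting and commutation are
  therefore settled for unsigned strings, and signed operators \<open>spauli c ps\<close> appear
  only where a sign survives in \<open>e\<close>. The third logical operator \<open>X\<close> occurs
  neither in the state nor in the five cases, yet it links them: if \<open>Z\<close> is not
  reducible to \<open>A\<close>, the operator on \<open>B\<close> that anticommutes with
  \<open>Z\<close> may lie in the class of \<open>X\<close> instead of that of \<open>Y\<close>. For
  the constant \<open>sqrt 2\<close>: stabilizer states have expectations of \<open>Z\<close> and
  \<open>-Y\<close> whose absolute values sum to at most 1, while the magic state has
  \<open>1 / sqrt 2\<close> for both. Weight \<open>1 / sqrt 2\<close> on the state of
  \<open>-Y\<close> settles one of them; the weights on \<open>Z\<close> and \<open>-Z\<close> must
  then sum to \<open>1 - 1 / sqrt 2\<close> and differ by \<open>1 / sqrt 2\<close>.\<close>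

fun pauli_mult :: "pauli \<Rightarrow> pauli \<Rightarrow> pauli" where
  "pauli_mult PI q = q"
| "pauli_mult p PI = p"
| "pauli_mult PX PX = PI" | "pauli_mult PX PY = PZ" | "pauli_mult PX PZ = PY"
| "pauli_mult PY PX = PZ" | "pauli_mult PY PY = PI" | "pauli_mult PY PZ = PX"
| "pauli_mult PZ PX = PY" | "pauli_mult PZ PY = PX" | "pauli_mult PZ PZ = PI"

fun pauli_phase :: "pauli \<Rightarrow> pauli \<Rightarrow> complex" where
  "pauli_phase PX PY = \<i>" | "pauli_phase PY PX = - \<i>"
| "pauli_phase PY PZ = \<i>" | "pauli_phase PZ PY = - \<i>"
| "pauli_phase PZ PX = \<i>" | "pauli_phase PX PZ = - \<i>"
| "pauli_phase _ _ = 1"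

text \<open>The symplectic form of one qubit in multiplicative notation: 1 for commuting and -1 for
  anticommuting operators.\<close>

definition pauli_sign :: "pauli \<Rightarrow> pauli \<Rightarrow> real" where
  "pauli_sign p q = (if p = PI \<or> q = PI \<or> p = q then 1 else -1)"

text \<open>Indices are Booleans because an entry of a tensor product is a product over the bits of
  its indices; \<open>sum_prod_bits\<close> reduces matrix products to this sum.\<close>

lemma pauli_entry_mult:
  "(\<Sum>b\<in>{False, True}. pauli_mat p $$ (of_bool a, of_bool b) * pauli_mat q $$ (of_bool b, of_bool c))
     = pauli_phase p q * pauli_mat (pauli_mult p q) $$ (of_bool a, of_bool c)"
  by (cases p; cases q; cases a; cases c) (simp_all add: mat_of_rows_list_def)

lemma pauli_entry_trace:
  "(\<Sum>b\<in>{False, True}. pauli_mat p $$ (of_bool b, of_bool b)) = (if p = PI then 2 else 0)"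
  by (cases p) (simp_all add: mat_of_rows_list_def)

lemma pauli_entry_cnj:
  "cnj (pauli_mat p $$ (of_bool b, of_bool a)) = pauli_mat p $$ (of_bool a, of_bool b)"
  by (cases p; cases a; cases b) (simp_all add: mat_of_rows_list_def)

lemma pauli_entry_PI: "pauli_mat PI $$ (of_bool a, of_bool b) = of_bool (a = b)"
  by (cases a; cases b) (simp_all add: mat_of_rows_list_def)

lemma pauli_mult_self [simp]: "pauli_mult p p = PI" by (cases p) simp_all
lemma pauli_mult_PI [simp]: "pauli_mult p PI = p" by (cases p) simp_all
lemma pauli_mult_commute: "pauli_mult p q = pauli_mult q p" by (cases p; cases q) simp_all
lemma pauli_mult_assoc: "pauli_mult (pauli_mult p q) r = pauli_mult p (pauli_mult q r)"
  by (cases p; cases q; cases r) simp_all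
lemma pauli_phase_swap: "pauli_phase p q = complex_of_real (pauli_sign p q) * pauli_phase q p"
  by (cases p; cases q) (simp_all add: pauli_sign_def)
lemma pauli_phase_nonzero: "pauli_phase p q \<noteq> 0"
  by (cases p; cases q) simp_all
lemma pauli_phase_self: "pauli_phase p p = 1"
  by (cases p) simp_all
lemma pauli_sign_mult: "pauli_sign p (pauli_mult q r) = pauli_sign p q * pauli_sign p r"
  by (cases p; cases q; cases r) (simp_all add: pauli_sign_def)
lemma pauli_sign_commute: "pauli_sign p q = pauli_sign q p"
  by (auto simp add: pauli_sign_def)
lemma pauli_sign_nondegenerate: "p \<noteq> PI \<Longrightarrow> \<exists>q. pauli_sign q p = -1"
  by (cases p) (auto simp add: pauli_sign_def intro: exI[of _ PX] exI[of _ PZ])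
lemma pauli_sign_PI [simp]: "pauli_sign p PI = 1" "pauli_sign PI p = 1"
  by (simp_all add: pauli_sign_def)

text \<open>Distributivity: the numbers below \<open>2 ^ n\<close> run through all choices of one
  summand per factor. This turns products and traces of tensor products into computations qubit by
  qubit.\<close>

lemma sum_prod_bits:
  fixes f :: "nat \<Rightarrow> bool \<Rightarrow> 'a :: comm_semiring_1"
  shows "(\<Sum>k<2 ^ n. \<Prod>q<n. f q (bit (k :: nat) q)) = (\<Prod>q<n. \<Sum>b\<in>{False, True}. f q b)"
proof (induction n)
  case (Suc n)
  have split: "{..<2 ^ Suc n} = {..<2 ^ n} \<union> ((+) (2 ^ n)) ` {..<(2::nat) ^ n}"
    by (auto simp: image_iff) (metis add_diff_inverse_nat add_less_cancel_left lessThan_iff mult_2)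
  have low: "\<not> bit k n" if "k < 2 ^ n" for k :: nat
    using that by (simp add: bit_iff_odd)
  have high: "bit (2 ^ n + k) n" if "k < 2 ^ n" for k :: nat
    using that by (simp add: bit_iff_odd)
  have rest: "bit (2 ^ n + k) q = bit k q" if "q < n" for k q :: nat
  proof -
    \<comment> \<open>\<open>2 ^ n\<close> is an even multiple of \<open>2 ^ q\<close>, so adding it
      keeps the parity of the quotient by \<open>2 ^ q\<close>, which is bit
      \<open>q\<close>.\<close>
    obtain d where "n = Suc (q + d)"
      using \<open>q < n\<close> less_iff_Suc_add by auto
    then have "(2::nat) ^ n = 2 ^ q * (2 * 2 ^ d)"
      by (simp add: power_add)
    then show ?thesis by (simp add: bit_iff_odd)
  qed
  have "(\<Sum>k<2 ^ Suc n. \<Prod>q<Suc n. f q (bit (k :: nat) q))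
      = (\<Sum>k<2 ^ n. (\<Prod>q<n. f q (bit (k :: nat) q)) * f n False)
        + (\<Sum>k<2 ^ n. (\<Prod>q<n. f q (bit (k :: nat) q)) * f n True)"
    unfolding split
    by (subst sum.union_disjoint) (auto simp: sum.reindex low high rest)
  also have "\<dots> = (\<Sum>k<2 ^ n. \<Prod>q<n. f q (bit (k :: nat) q)) * (f n False + f n True)"
    by (simp add: sum_distrib_right distrib_left)
  finally show ?case using Suc.IH by simp
qed simp


section \<open>Pauli strings\<close>

definition paulis :: "nat \<Rightarrow> pauli list set" where
  "paulis n = {ps. length ps = n}"

definition pmul :: "pauli list \<Rightarrow> pauli list \<Rightarrow> pauli list" where
  "pmul ps qs = map2 pauli_mult ps qs"

definition phase :: "pauli list \<Rightarrow> pauli list \<Rightarrow> complex" where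
  "phase ps qs = (\<Prod>q<length ps. pauli_phase (ps ! q) (qs ! q))"

text \<open>Minus one to the power of the symplectic form. Values are real so that they can be
  summed as characters.\<close>

definition comm_sign :: "pauli list \<Rightarrow> pauli list \<Rightarrow> real" where
  "comm_sign ps qs = (\<Prod>q<length ps. pauli_sign (ps ! q) (qs ! q))"

abbreviation op_carrier :: "nat \<Rightarrow> complex mat set" where
  "op_carrier n \<equiv> carrier_mat (2 ^ n) (2 ^ n)"

abbreviation pid :: "nat \<Rightarrow> pauli list" where
  "pid n \<equiv> replicate n PI"

lemma UNIV_pauli: "(UNIV :: pauli set) = {PI, PX, PY, PZ}"
  using pauli.exhaust by auto

lemma finite_UNIV_pauli: "finite (UNIV :: pauli set)"
  by (simp add: UNIV_pauli)

lemma finite_paulis [simp]: "finite (paulis n)"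
  using finite_lists_length_eq[OF finite_UNIV_pauli, of n] by (simp add: paulis_def)

lemma card_paulis: "card (paulis n) = 4 ^ n"
proof -
  have "card (UNIV :: pauli set) = 4" by (simp add: UNIV_pauli)
  then show ?thesis
    using card_lists_length_eq[OF finite_UNIV_pauli, of n] by (simp add: paulis_def)
qed

lemma paulis_length: "ps \<in> paulis n \<longleftrightarrow> length ps = n" by (simp add: paulis_def)

lemma length_pmul [simp]: "length (pmul ps qs) = min (length ps) (length qs)"
  by (simp add: pmul_def)

lemma pid_paulis [simp]: "pid n \<in> paulis n" by (simp add: paulis_def)
lemma pmul_paulis [simp]: "ps \<in> paulis n \<Longrightarrow> qs \<in> paulis n \<Longrightarrow> pmul ps qs \<in> paulis n"
  by (simp add: paulis_def)

lemma nth_pmul [simp]: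
  "q < length ps \<Longrightarrow> q < length qs \<Longrightarrow> pmul ps qs ! q = pauli_mult (ps ! q) (qs ! q)"
  by (simp add: pmul_def)

lemma pmul_self: "pmul ps ps = pid (length ps)"
  by (rule nth_equalityI) simp_all
lemma pmul_pid [simp]: "ps \<in> paulis n \<Longrightarrow> pmul ps (pid n) = ps" "ps \<in> paulis n \<Longrightarrow> pmul (pid n) ps = ps"
  by (rule nth_equalityI; simp add: paulis_def)+
lemma pmul_commute: "pmul ps qs = pmul qs ps"
  by (rule nth_equalityI) (auto simp: pauli_mult_commute)
lemma pmul_assoc: "pmul (pmul ps qs) rs = pmul ps (pmul qs rs)"
  by (rule nth_equalityI) (auto simp: pauli_mult_assoc)
lemma pmul_cancel:
  assumes "ps \<in> paulis n" "qs \<in> paulis n"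
  shows "pmul ps (pmul ps qs) = qs"
  using assms by (simp flip: pmul_assoc add: pmul_self paulis_def)
lemma pmul_eq_pid: "ps \<in> paulis n \<Longrightarrow> qs \<in> paulis n \<Longrightarrow> pmul ps qs = pid n \<longleftrightarrow> ps = qs"
  by (metis pmul_cancel pmul_pid(1) pmul_self paulis_length)

lemma phase_swap:
  "length ps = length qs \<Longrightarrow> phase ps qs = complex_of_real (comm_sign ps qs) * phase qs ps"
  unfolding phase_def comm_sign_def of_real_prod
  by (simp add: prod.distrib[symmetric] pauli_phase_swap[symmetric])
lemma phase_nonzero: "phase ps qs \<noteq> 0"
  by (simp add: phase_def pauli_phase_nonzero)
lemma phase_self [simp]: "phase ps ps = 1"
  by (simp add: phase_def pauli_phase_self)

lemma comm_sign_pmul: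
  assumes "ps \<in> paulis n" "qs \<in> paulis n" "rs \<in> paulis n"
  shows "comm_sign ps (pmul qs rs) = comm_sign ps qs * comm_sign ps rs"
  unfolding comm_sign_def prod.distrib[symmetric]
  using assms by (auto simp: paulis_def pauli_sign_mult intro!: prod.cong)
lemma comm_sign_commute:
  "length ps = length qs \<Longrightarrow> comm_sign ps qs = comm_sign qs ps"
  unfolding comm_sign_def by (auto simp: pauli_sign_commute intro!: prod.cong)
lemma comm_sign_pmul_left:
  assumes "ps \<in> paulis n" "qs \<in> paulis n" "rs \<in> paulis n"
  shows "comm_sign (pmul qs rs) ps = comm_sign qs ps * comm_sign rs ps"
  using comm_sign_pmul[OF assms] assms comm_sign_commute by (simp add: paulis_def)
lemma comm_sign_cases: "comm_sign ps qs = 1 \<or> comm_sign ps qs = -1"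
proof -
  have "(\<Prod>q<n. pauli_sign (ps ! q) (qs ! q)) \<in> {1, -1}" for n
    by (induction n) (auto simp: pauli_sign_def)
  then show ?thesis by (simp add: comm_sign_def)
qed
lemma comm_sign_pid [simp]: "comm_sign (pid n) ps = 1" "length ps = n \<Longrightarrow> comm_sign ps (pid n) = 1"
  by (simp_all add: comm_sign_def)
lemma comm_sign_single:
  assumes "ps \<in> paulis n" "q < n"
  shows "comm_sign ((pid n)[q := p]) ps = pauli_sign p (ps ! q)"
proof -
  have "pauli_sign ((pid n)[q := p] ! r) (ps ! r) = (if r = q then pauli_sign p (ps ! q) else 1)"
    if "r < n" for r
    using assms that by (auto simp: nth_list_update)
  then have "comm_sign ((pid n)[q := p]) ps = (\<Prod>r<n. if r = q then pauli_sign p (ps ! q) else 1)"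
    unfolding comm_sign_def by (intro prod.cong) auto
  then show ?thesis using assms by simp
qed
text \<open>The witness acts on the single qubit \<open>q\<close>. Beyond nondegeneracy, this
  locality is what confines the support in \<open>not_red_witness\<close>.\<close>

lemma comm_sign_nondegenerate:
  assumes "ps \<in> paulis n" "q < n" "ps ! q \<noteq> PI"
  shows "\<exists>p. comm_sign ((pid n)[q := p]) ps = -1"
  using comm_sign_single[OF assms(1,2)] pauli_sign_nondegenerate[OF assms(3)] by simp

lemma comm_sign_disjoint:
  assumes "\<And>q. q < length ps \<Longrightarrow> ps ! q = PI \<or> qs ! q = PI"
  shows "comm_sign ps qs = 1"
  unfolding comm_sign_def by (rule prod.neutral) (use assms in \<open>auto simp: pauli_sign_def\<close>)

section \<open>Matrices of Pauli strings\<close>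

lemma pauli_string_carrier [simp]:
  "length ps = n \<Longrightarrow> pauli_string ps \<in> op_carrier n"
  "ps \<in> paulis n \<Longrightarrow> pauli_string ps \<in> op_carrier n"
  by (auto simp: pauli_string_def paulis_def)
lemma pauli_string_dim [simp]:
  "dim_row (pauli_string ps) = 2 ^ length ps" "dim_col (pauli_string ps) = 2 ^ length ps"
  by (simp_all add: pauli_string_def)

lemma pauli_string_entry:
  "length ps = n \<Longrightarrow> i < 2 ^ n \<Longrightarrow> j < 2 ^ n \<Longrightarrow>
    pauli_string ps $$ (i, j) = (\<Prod>q<n. pauli_mat (ps ! q) $$ (of_bool (bit i q), of_bool (bit j q)))"
  by (simp add: pauli_string_def)

lemma pauli_string_mult:
  assumes "ps \<in> paulis n" "qs \<in> paulis n"
  shows "pauli_string ps * pauli_string qs = phase ps qs \<cdot>\<^sub>m pauli_string (pmul ps qs)" (is "?L = ?R")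
proof (rule eq_matI)
  fix i j assume "i < dim_row ?R"
    "j < dim_col ?R"
  then have ij: "i < 2 ^ n" "j < 2 ^ n" and l: "length ps = n" "length qs = n"
    using assms by (simp_all add: paulis_def)
  have "?L $$ (i, j) =
      (\<Sum>k<2 ^ n. pauli_string ps $$ (i, k) * pauli_string qs $$ (k, j))"
    using ij l by (simp add: scalar_prod_def lessThan_atLeast0)
  also have "\<dots> = (\<Sum>k<2 ^ n. \<Prod>q<n. pauli_mat (ps ! q) $$ (of_bool (bit i q), of_bool (bit (k :: nat) q))
      * pauli_mat (qs ! q) $$ (of_bool (bit k q), of_bool (bit j q)))"
    using ij l by (intro sum.cong) (auto simp: pauli_string_entry prod.distrib)
  also have "\<dots> = (\<Prod>q<n. \<Sum>b\<in>{False, True}. pauli_mat (ps ! q) $$ (of_bool (bit i q), of_bool b)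
      * pauli_mat (qs ! q) $$ (of_bool b, of_bool (bit j q)))"
    by (rule sum_prod_bits)
  also have "\<dots> = (\<Prod>q<n. pauli_phase (ps ! q) (qs ! q) *
      pauli_mat (pmul ps qs ! q) $$ (of_bool (bit i q), of_bool (bit j q)))"
    using l by (intro prod.cong) (simp_all only: pauli_entry_mult nth_pmul lessThan_iff)
  also have "\<dots> = ?R $$ (i, j)"
    using ij l by (simp add: prod.distrib phase_def pauli_string_entry)
  finally show "?L $$ (i, j) =
    ?R $$ (i, j)" .
qed (use assms in \<open>auto simp: paulis_def\<close>)

lemma nat_eq_iff_bits:
  assumes "i < 2 ^ n" "j < 2 ^ n"
  shows "i = j \<longleftrightarrow> (\<forall>q<n. bit i q = bit (j :: nat) q)"
proof -
  have "take_bit n i = i" "take_bit n j = j"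
    using assms by (simp_all add: take_bit_nat_eq_self)
  then have "i = j \<longleftrightarrow> take_bit n i = take_bit n j" by simp
  also have "\<dots> \<longleftrightarrow> (\<forall>q<n. bit i q = bit j q)"
    by (auto simp: bit_eq_iff bit_take_bit_iff)
  finally show ?thesis .
qed

lemma pauli_string_pid: "pauli_string (pid n) = 1\<^sub>m (2 ^ n)"
proof (rule eq_matI)
  fix i j assume "i < dim_row (1\<^sub>m (2 ^ n) :: complex mat)" "j < dim_col (1\<^sub>m (2 ^ n) :: complex mat)"
  then have ij: "i < 2 ^ n" "j < 2 ^ n" by simp_all
  have "pauli_string (pid n) $$ (i, j) = (\<Prod>q<n. of_bool (bit i q = bit j q))"
    using ij by (subst pauli_string_entry[where n = n])
      (auto intro!: prod.cong simp only: pauli_entry_PI nth_replicate length_replicate lessThan_iff)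
  also have "\<dots> = of_bool (i = j)"
    using nat_eq_iff_bits[OF ij] by auto
  finally show "pauli_string (pid n) $$ (i, j) = 1\<^sub>m (2 ^ n) $$ (i, j)"
    using ij by simp
qed simp_all

lemma mat_trace_eq: "mat_trace M = (\<Sum>i<dim_row M. M $$ (i, i))"
  by (simp add: mat_trace_def diag_mat_def interv_sum_list_conv_sum_set_nat lessThan_atLeast0)

lemma mat_trace_pauli_string:
  assumes "ps \<in> paulis n"
  shows "mat_trace (pauli_string ps) = (if ps = pid n then 2 ^ n else 0)"
proof -
  have l: "length ps = n" using assms by (simp add: paulis_def)
  have "mat_trace (pauli_string ps) =
      (\<Sum>k<2 ^ n. \<Prod>q<n. pauli_mat (ps ! q) $$ (of_bool (bit (k :: nat) q), of_bool (bit k q)))"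
    using l by (simp add: mat_trace_eq pauli_string_entry)
  also have "\<dots> = (\<Prod>q<n. if ps ! q = PI then 2 else 0)"
    by (simp only: pauli_entry_trace
        sum_prod_bits[where f = "\<lambda>q b. pauli_mat (ps ! q) $$ (of_bool b, of_bool b)"])
  also have "\<dots> = (if ps = pid n then 2 ^ n else 0)"
  proof (cases "ps = pid n")
    case False
    then obtain q where "q < n" "ps ! q \<noteq> PI"
      using l by (metis length_replicate nth_equalityI nth_replicate)
    then show ?thesis using False by (auto intro!: prod_zero)
  qed simp
  finally show ?thesis .
qed

lemma pauli_string_hermitian:
  "length ps = n \<Longrightarrow> i < 2 ^ n \<Longrightarrow> j < 2 ^ n \<Longrightarrow>
    cnj (pauli_string ps $$ (j, i)) = pauli_string ps $$ (i, j)"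
  by (simp add: pauli_string_entry pauli_entry_cnj)


section \<open>Symplectic complements\<close>

text \<open>These are the linear subspaces over the field with two elements; every string is its own
  inverse.\<close>

definition pauli_subgroup :: "nat \<Rightarrow> pauli list set \<Rightarrow> bool" where
  "pauli_subgroup n W \<longleftrightarrow> W \<subseteq> paulis n \<and> pid n \<in> W \<and> (\<forall>a\<in>W. \<forall>b\<in>W. pmul a b \<in> W)"

definition perp :: "nat \<Rightarrow> pauli list set \<Rightarrow> pauli list set" where
  "perp n W = {p \<in> paulis n. \<forall>w\<in>W. comm_sign p w = 1}"

lemma pauli_subgroup_finite: "pauli_subgroup n W \<Longrightarrow> finite W"
  using finite_subset[OF _ finite_paulis] unfolding pauli_subgroup_def by auto

lemma pauli_subgroup_mult_iff:
  assumes "pauli_subgroup n W" "w \<in> W" "p \<in> paulis n"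
  shows "pmul w p \<in> W \<longleftrightarrow> p \<in> W"
proof
  have w: "w \<in> paulis n" using assms by (auto simp: pauli_subgroup_def)
  assume "pmul w p \<in> W"
  then have "pmul w (pmul w p) \<in> W" using assms by (simp add: pauli_subgroup_def)
  then show "p \<in> W" by (simp add: pmul_cancel[OF w assms(3)])
qed (use assms in \<open>simp add: pauli_subgroup_def\<close>)

lemma pauli_subgroup_perp: "W \<subseteq> paulis n \<Longrightarrow> pauli_subgroup n (perp n W)"
  by (auto simp: pauli_subgroup_def perp_def comm_sign_pmul_left[where n = n] subset_iff paulis_length)

lemma pauli_subgroup_paulis: "pauli_subgroup n (paulis n)"
  by (auto simp: pauli_subgroup_def)

lemma perp_paulis: "perp n (paulis n) = {pid n}"
proof -
  have "p = pid n" if "p \<in> perp n (paulis n)" for p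
  proof (rule ccontr)
    assume "p \<noteq> pid n"
    have p: "p \<in> paulis n" using that by (simp add: perp_def)
    then have "length p = n" by (simp add: paulis_def)
    with \<open>p \<noteq> pid n\<close> have "\<exists>q<n. p ! q \<noteq> PI"
      using nth_equalityI[of p "pid n"] by auto
    then obtain q where "q < n" "p ! q \<noteq> PI" by auto
    then obtain r where "comm_sign ((pid n)[q := r]) p = -1"
      using comm_sign_nondegenerate[OF p] by blast
    moreover have "comm_sign p ((pid n)[q := r]) = 1"
      using that by (simp add: perp_def paulis_def)
    moreover have "comm_sign p ((pid n)[q := r]) = comm_sign ((pid n)[q := r]) p"
      using p by (intro comm_sign_commute) (simp add: paulis_def)
    ultimately show False by simp
  qed
  then show ?thesis by (auto simp: perp_def)
qed

text \<open>Orthogonality of characters: multiplication by some \<open>v\<close> in \<open>W\<close>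
  with \<open>comm_sign p v = -1\<close> permutes \<open>W\<close> and negates every term of the
  sum.\<close>

lemma character_sum:
  assumes W: "pauli_subgroup n W" and p: "p \<in> paulis n"
  shows "(\<Sum>w\<in>W. comm_sign p w) = (if p \<in> perp n W then real (card W) else 0)"
proof (cases "p \<in> perp n W")
  case True
  then show ?thesis by (simp add: perp_def)
next
  case False
  then obtain v where v: "v \<in> W" "comm_sign p v = -1"
    using comm_sign_cases p by (auto simp: perp_def)
  have sub: "W \<subseteq> paulis n" using W by (simp add: pauli_subgroup_def)
  have cancel: "pmul v (pmul v w) = w" if "w \<in> W" for w
    using pmul_cancel[of v n w] sub v(1) that by auto
  have closed: "pmul v w \<in> W" if "w \<in> W" for w
    using W v(1) that by (auto simp: pauli_subgroup_def)
  have "bij_betw (pmul v) W W"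
    by (rule bij_betwI[of _ _ _ "pmul v"]) (auto simp: cancel closed)
  then have "(\<Sum>w\<in>W. comm_sign p w) = (\<Sum>w\<in>W. comm_sign p (pmul v w))"
    by (rule sum.reindex_bij_betw[symmetric])
  also have "\<dots> = (\<Sum>w\<in>W. - comm_sign p w)"
    using sub p v by (intro sum.cong) (auto simp: comm_sign_pmul[where n = n] subset_iff)
  finally show ?thesis using False by (simp add: sum_negf)
qed

text \<open>Both sides evaluate the sum of \<open>comm_sign p w\<close> over all \<open>p\<close>
  and all \<open>w\<close> in \<open>W\<close>. Summing over \<open>w\<close> first counts
  \<open>perp n W\<close> with weight \<open>card W\<close>; summing over \<open>p\<close> first
  leaves only \<open>w = pid n\<close>, by nondegeneracy.\<close>

lemma card_perp:
  assumes W: "pauli_subgroup n W"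
  shows "card W * card (perp n W) = 4 ^ n"
proof -
  have sub: "W \<subseteq> paulis n" "pid n \<in> W" using W by (simp_all add: pauli_subgroup_def)
  have "real (card W * card (perp n W)) = (\<Sum>p\<in>paulis n. if p \<in> perp n W then real (card W) else 0)"
    by (subst sum.inter_filter[symmetric]) (auto simp: perp_def)
  also have "\<dots> = (\<Sum>p\<in>paulis n. \<Sum>w\<in>W. comm_sign p w)"
    using character_sum[OF W] by simp
  also have "\<dots> = (\<Sum>w\<in>W. \<Sum>p\<in>paulis n. comm_sign p w)"
    by (rule sum.swap)
  also have "\<dots> = (\<Sum>w\<in>W. \<Sum>p\<in>paulis n. comm_sign w p)"
    using sub by (intro sum.cong refl comm_sign_commute) (auto simp: paulis_def)
  also have "\<dots> = (\<Sum>w\<in>W. if w = pid n then 4 ^ n else 0)"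
    using sub by (intro sum.cong refl)
      (simp add: character_sum[OF pauli_subgroup_paulis] perp_paulis subset_iff card_paulis)
  also have "\<dots> = real (4 ^ n)"
    using sub pauli_subgroup_finite[OF W] by simp
  finally show ?thesis using of_nat_eq_iff by blast
qed

lemma perp_perp:
  assumes W: "pauli_subgroup n W"
  shows "perp n (perp n W) = W"
proof -
  have sub: "W \<subseteq> paulis n" using W by (simp add: pauli_subgroup_def)
  have P: "pauli_subgroup n (perp n W)" using pauli_subgroup_perp[OF sub] .
  have "card W * card (perp n W) = card (perp n W) * card (perp n (perp n W))"
    using card_perp[OF W] card_perp[OF P] by simp
  moreover have "card (perp n W) \<noteq> 0"
    using card_perp[OF W] by (metis mult_0_right power_not_zero zero_neq_numeral)
  ultimately have "card W = card (perp n (perp n W))" by simp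
  moreover have "W \<subseteq> perp n (perp n W)"
  proof
    fix w assume w: "w \<in> W"
    have "comm_sign w p = 1" if p: "p \<in> perp n W" for p
    proof -
      have "comm_sign w p = comm_sign p w"
        using p w sub by (intro comm_sign_commute) (auto simp: perp_def paulis_def)
      then show ?thesis using p w by (simp add: perp_def)
    qed
    then show "w \<in> perp n (perp n W)" using w sub by (auto simp: perp_def)
  qed
  moreover have "finite (perp n (perp n W))"
    by (auto simp: perp_def)
  ultimately show ?thesis by (metis card_subset_eq)
qed

section \<open>Enlarging a group by one string\<close>

lemma pmul_left_commute: "pmul p (pmul q r) = pmul q (pmul p r)"
  using pmul_assoc[of p q r] pmul_assoc[of q p r] pmul_commute[of p q] by simp

lemma pauli_subgroup_extend:
  assumes W: "pauli_subgroup n W" and x: "x \<in> paulis n"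
  shows "pauli_subgroup n (W \<union> pmul x ` W)"
proof -
  have sub: "W \<subseteq> paulis n" using W by (simp add: pauli_subgroup_def)
  have "pmul (pmul x v) (pmul x w) = pmul v w" if "v \<in> W" "w \<in> W" for v w
  proof -
    have "pmul (pmul x v) (pmul x w) = pmul v (pmul x (pmul x w))"
      by (simp add: pmul_assoc pmul_left_commute)
    moreover have "w \<in> paulis n" using sub that by auto
    ultimately show ?thesis using pmul_cancel[OF x] by simp
  qed
  note both = this
  have closed: "pmul v w \<in> W" if "v \<in> W" "w \<in> W" for v w
    using W that by (simp add: pauli_subgroup_def)
  have "pmul a b \<in> W \<union> pmul x ` W" if "a \<in> W \<union> pmul x ` W" "b \<in> W \<union> pmul x ` W" for a b
    using that
  proof (elim UnE imageE)
    fix v assume v: "b = pmul x v" "v \<in> W" and a: "a \<in> W"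
    have "pmul a b = pmul x (pmul a v)" by (simp only: v pmul_left_commute)
    then show ?thesis using closed[OF a v(2)] by simp
  next
    fix v assume v: "a = pmul x v" "v \<in> W" and b: "b \<in> W"
    have "pmul a b = pmul x (pmul v b)" by (simp only: v pmul_assoc)
    then show ?thesis using closed[OF v(2) b] by simp
  next
    fix v w assume "a = pmul x v" "v \<in> W" "b = pmul x w" "w \<in> W"
    then show ?thesis using closed[of v w] both[of v w] by simp
  qed (simp add: closed)
  moreover have "W \<union> pmul x ` W \<subseteq> paulis n" using sub x by auto
  moreover have "pid n \<in> W" using W by (simp add: pauli_subgroup_def)
  ultimately show ?thesis by (simp add: pauli_subgroup_def)
qed

lemma card_extend:
  assumes W: "pauli_subgroup n W" and x: "x \<in> paulis n" "x \<notin> W"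
  shows "card (W \<union> pmul x ` W) = 2 * card W"
proof -
  have sub: "W \<subseteq> paulis n" using W by (simp add: pauli_subgroup_def)
  have "inj_on (pmul x) W"
    by (rule inj_on_inverseI[of _ "pmul x"]) (use pmul_cancel[OF x(1)] sub in auto)
  moreover have "W \<inter> pmul x ` W = {}"
    using pauli_subgroup_mult_iff[OF W _ x(1)] x(2) by (auto simp: pmul_commute[of x])
  ultimately show ?thesis
    using pauli_subgroup_finite[OF W] by (simp add: card_Un_disjoint card_image)
qed


section \<open>Signed Pauli strings and stabilizer groups\<close>

text \<open>The scalar is not restricted to signs, since the product of two anticommuting Hermitian
  strings carries a factor \<i> or \<open>- \<i>\<close>.\<close>

definition spauli :: "complex \<Rightarrow> pauli list \<Rightarrow> complex mat" where
  "spauli c ps = c \<cdot>\<^sub>m pauli_string ps"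

lemma spauli_carrier [simp]: "ps \<in> paulis n \<Longrightarrow> spauli c ps \<in> op_carrier n"
  by (simp add: spauli_def)

lemma uminus_spauli: "- spauli c ps = spauli (- c) ps"
  by (rule eq_matI) (simp_all add: spauli_def)

lemma spauli_one [simp]: "spauli 1 ps = pauli_string ps"
  by (rule eq_matI) (simp_all add: spauli_def)

lemma smult_spauli: "a \<cdot>\<^sub>m spauli c ps = spauli (a * c) ps"
  by (rule eq_matI) (simp_all add: spauli_def)

lemma spauli_pid: "spauli 1 (pid n) = 1\<^sub>m (2 ^ n)"
  by (simp add: pauli_string_pid)

lemma spauli_minus_pid: "spauli (-1) (pid n) = - 1\<^sub>m (2 ^ n)"
  by (simp flip: spauli_pid uminus_spauli)

lemma hermitian_pauli_iff:
  "hermitian_pauli n M \<longleftrightarrow> (\<exists>ps\<in>paulis n. \<exists>s\<in>{1, -1}. M = spauli s ps)"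
  by (auto simp: hermitian_pauli_def paulis_def simp flip: uminus_spauli)

lemma spauli_mult:
  assumes "ps \<in> paulis n" "qs \<in> paulis n"
  shows "spauli c ps * spauli d qs = spauli (c * d * phase ps qs) (pmul ps qs)"
proof -
  have c: "pauli_string ps \<in> op_carrier n" "pauli_string qs \<in> op_carrier n"
    using assms by simp_all
  then have "spauli c ps * spauli d qs = c \<cdot>\<^sub>m (d \<cdot>\<^sub>m (pauli_string ps * pauli_string qs))"
    unfolding spauli_def
    by (subst mult_smult_assoc_mat[of _ "2 ^ n" "2 ^ n" _ "2 ^ n"], simp, simp,
        subst mult_smult_distrib[of _ "2 ^ n" "2 ^ n" _ "2 ^ n"], simp_all)
  also have "\<dots> = spauli (c * d * phase ps qs) (pmul ps qs)"
    unfolding pauli_string_mult[OF assms] spauli_def by (rule eq_matI) simp_all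
  finally show ?thesis .
qed

lemma mat_trace_smult: "dim_row A = dim_col A \<Longrightarrow> mat_trace (c \<cdot>\<^sub>m A) = c * mat_trace A"
  by (simp add: mat_trace_eq sum_distrib_left)

lemma mat_trace_spauli:
  "ps \<in> paulis n \<Longrightarrow> mat_trace (spauli c ps) = (if ps = pid n then c * 2 ^ n else 0)"
  by (simp add: spauli_def mat_trace_smult mat_trace_pauli_string)

text \<open>Distinct strings are trace orthogonal: multiplying by \<open>pauli_string ps\<close> and
  taking the trace recovers the scalar if the strings agree and gives 0 otherwise.\<close>

lemma spauli_inj:
  assumes "ps \<in> paulis n" "qs \<in> paulis n" "c \<noteq> 0"
  shows "spauli c ps = spauli d qs \<longleftrightarrow> ps = qs \<and> c = d"
proof
  assume eq: "spauli c ps = spauli d qs"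
  have "mat_trace (spauli 1 ps * spauli c ps) = c * 2 ^ n"
    unfolding spauli_mult[OF assms(1,1)]
    using assms by (simp add: mat_trace_spauli[where n = n] pmul_self paulis_def del: spauli_one)
  moreover have "mat_trace (spauli 1 ps * spauli d qs) = (if ps = qs then d * phase ps qs * 2 ^ n else 0)"
    unfolding spauli_mult[OF assms(1,2)]
    using assms by (simp add: mat_trace_spauli[where n = n] pmul_eq_pid del: spauli_one)
  ultimately show "ps = qs \<and> c = d"
    unfolding eq using assms(3) by (auto split: if_splits)
qed simp

lemma phase_mult_swap: "length ps = length qs \<Longrightarrow> phase ps qs * phase qs ps = 1"
proof -
  have "pauli_phase p q * pauli_phase q p = 1" for p q by (cases p; cases q) simp_all
  then show "length ps = length qs \<Longrightarrow> phase ps qs * phase qs ps = 1"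
    by (simp add: phase_def prod.distrib[symmetric])
qed

text \<open>The phase is thus 1 or -1 for commuting strings and \<i> or \<open>- \<i>\<close> for
  anticommuting ones. This links Hermiticity of a product to commutation.\<close>

lemma phase_square:
  assumes "length ps = length qs"
  shows "phase ps qs * phase ps qs = complex_of_real (comm_sign ps qs)"
  using phase_swap[OF assms] phase_mult_swap[OF assms]
  by (metis mult.assoc mult.commute mult.right_neutral)

lemma spauli_swap:
  assumes "ps \<in> paulis n" "qs \<in> paulis n"
  shows "spauli c ps * spauli d qs = complex_of_real (comm_sign ps qs) \<cdot>\<^sub>m (spauli d qs * spauli c ps)"
proof -
  have "phase ps qs = complex_of_real (comm_sign ps qs) * phase qs ps"
    using assms by (intro phase_swap) (simp add: paulis_def)
  then show ?thesis
    unfolding spauli_mult[OF assms] spauli_mult[OF assms(2,1)] smult_spauli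
    by (simp add: pmul_commute mult_ac)
qed

lemma spauli_commute_iff:
  assumes "ps \<in> paulis n" "qs \<in> paulis n" "c \<noteq> 0" "d \<noteq> 0"
  shows "spauli c ps * spauli d qs = spauli d qs * spauli c ps \<longleftrightarrow> comm_sign ps qs = 1"
proof -
  have "spauli c ps * spauli d qs = spauli d qs * spauli c ps
      \<longleftrightarrow> spauli (d * c * phase qs ps) (pmul qs ps)
        = spauli (complex_of_real (comm_sign ps qs) * (d * c * phase qs ps)) (pmul qs ps)"
    unfolding spauli_swap[OF assms(1,2), of c d] unfolding spauli_mult[OF assms(2,1)] smult_spauli by auto
  also have "\<dots> \<longleftrightarrow> comm_sign ps qs = 1"
    using assms comm_sign_cases[of ps qs] by (subst spauli_inj[where n = n]) (auto simp: phase_nonzero)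
  finally show ?thesis .
qed

lemma hermitian_pauli_mult_iff:
  assumes "ps \<in> paulis n" "qs \<in> paulis n" "s \<in> {1, -1}" "t \<in> {1, -1}"
  shows "hermitian_pauli n (spauli s ps * spauli t qs) \<longleftrightarrow> comm_sign ps qs = 1"
proof -
  define u where "u = s * t * phase ps qs"
  have l: "length ps = length qs" using assms by (simp add: paulis_def)
  have u: "u * u = complex_of_real (comm_sign ps qs)"
    using phase_square[OF l] assms(3,4) by (auto simp: u_def)
  have "u \<noteq> 0" using assms(3,4) by (auto simp: u_def phase_nonzero)
  then have "hermitian_pauli n (spauli s ps * spauli t qs) \<longleftrightarrow> u \<in> {1, -1}"
    unfolding spauli_mult[OF assms(1,2)] u_def[symmetric] hermitian_pauli_iff
    using assms by (auto simp: spauli_inj[where n = n] simp del: spauli_one)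
  also have "\<dots> \<longleftrightarrow> u * u = 1" by (simp add: square_eq_1_iff)
  also have "\<dots> \<longleftrightarrow> comm_sign ps qs = 1" unfolding u by simp
  finally show ?thesis .
qed

text \<open>A form of \<open>stabilizer_group\<close> that is easy to verify: Hermiticity of all
  products enforces commutation (\<open>stab_commute\<close>), and every element is its own inverse
  (\<open>stab_square\<close>). The equivalence is \<open>stabilizer_group_iff\<close>.\<close>

definition stab :: "nat \<Rightarrow> complex mat set \<Rightarrow> bool" where
  "stab n H \<longleftrightarrow> 1\<^sub>m (2 ^ n) \<in> H \<and> (\<forall>g\<in>H. \<forall>h\<in>H. g * h \<in> H) \<and>
     (\<forall>g\<in>H. hermitian_pauli n g) \<and> - 1\<^sub>m (2 ^ n) \<notin> H"

abbreviation coset :: "complex \<Rightarrow> pauli list \<Rightarrow> complex mat set \<Rightarrow> complex mat set" where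
  "coset s p H \<equiv> (*) (spauli s p) ` H"

definition labels :: "nat \<Rightarrow> complex mat set \<Rightarrow> pauli list set" where
  "labels n H = {ps \<in> paulis n. spauli 1 ps \<in> H \<or> spauli (-1) ps \<in> H}"

lemma labels_paulis: "labels n H \<subseteq> paulis n" by (auto simp: labels_def)

lemma stabE:
  assumes "stab n H" "g \<in> H"
  obtains s ps where "s \<in> {1, -1}" "ps \<in> labels n H" "ps \<in> paulis n" "g = spauli s ps"
proof -
  obtain s ps where sp: "s \<in> {1, -1}" "ps \<in> paulis n" "g = spauli s ps"
    using assms unfolding stab_def hermitian_pauli_iff by blast
  then have "ps \<in> labels n H" using assms(2) by (auto simp: labels_def simp del: spauli_one)
  then show ?thesis using that sp by blast
qed

lemma labelsE:
  assumes "ps \<in> labels n H"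
  obtains s where "s \<in> {1, -1}" "spauli s ps \<in> H" "ps \<in> paulis n"
  using assms by (auto simp: labels_def simp del: spauli_one)

lemma labelsI: "ps \<in> paulis n \<Longrightarrow> s \<in> {1, -1} \<Longrightarrow> spauli s ps \<in> H \<Longrightarrow> ps \<in> labels n H"
  by (auto simp: labels_def)

lemma stab_carrier: "stab n H \<Longrightarrow> g \<in> H \<Longrightarrow> g \<in> op_carrier n"
  by (elim stabE) auto

lemma spauli_square: "ps \<in> paulis n \<Longrightarrow> s \<in> {1, -1} \<Longrightarrow> spauli s ps * spauli s ps = 1\<^sub>m (2 ^ n)"
  unfolding spauli_mult[of ps n ps]
  by (auto simp: pmul_self paulis_def spauli_pid simp del: spauli_one)

lemma stab_square: "stab n H \<Longrightarrow> g \<in> H \<Longrightarrow> g * g = 1\<^sub>m (2 ^ n)"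
  by (elim stabE) (auto simp: spauli_square simp del: spauli_one)

lemma stab_not_both:
  assumes "stab n H" "spauli s ps \<in> H" "spauli t ps \<in> H" "ps \<in> paulis n" "s \<in> {1, -1}" "t \<in> {1, -1}"
  shows "s = t"
proof (rule ccontr)
  assume "s \<noteq> t"
  with assms(5,6) have "s * t = -1" by auto
  then have "spauli s ps * spauli t ps = - 1\<^sub>m (2 ^ n)"
    unfolding spauli_mult[OF assms(4,4)]
    using assms(4) by (simp add: pmul_self paulis_def spauli_minus_pid)
  then show False using assms(1-3) unfolding stab_def by metis
qed

lemma stab_comm_sign:
  assumes "stab n H" "ps \<in> labels n H" "qs \<in> labels n H"
  shows "comm_sign ps qs = 1"
proof -
  obtain s where s: "s \<in> {1, -1}" "spauli s ps \<in> H" "ps \<in> paulis n" by (rule labelsE[OF assms(2)])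
  obtain t where t: "t \<in> {1, -1}" "spauli t qs \<in> H" "qs \<in> paulis n" by (rule labelsE[OF assms(3)])
  have "hermitian_pauli n (spauli s ps * spauli t qs)"
    using assms(1) s t by (simp add: stab_def)
  then show ?thesis using hermitian_pauli_mult_iff[OF s(3) t(3) s(1) t(1)] by simp
qed

lemma stab_commute:
  assumes H: "stab n H" and g: "g \<in> H" and h: "h \<in> H"
  shows "g * h = h * g"
proof -
  obtain s ps where s: "s \<in> {1, -1}" "ps \<in> labels n H" "ps \<in> paulis n" "g = spauli s ps"
    by (rule stabE[OF H g])
  obtain t qs where t: "t \<in> {1, -1}" "qs \<in> labels n H" "qs \<in> paulis n" "h = spauli t qs"
    by (rule stabE[OF H h])
  have "s \<noteq> 0" "t \<noteq> 0" using s t by auto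
  then show ?thesis
    using spauli_commute_iff[OF s(3) t(3)] stab_comm_sign[OF H s(2) t(2)] s(4) t(4) by simp
qed

lemma labels_subgroup:
  assumes H: "stab n H"
  shows "pauli_subgroup n (labels n H)"
proof -
  have "pmul ps qs \<in> labels n H" if p: "ps \<in> labels n H" and q: "qs \<in> labels n H" for ps qs
  proof -
    obtain s where s: "s \<in> {1, -1}" "spauli s ps \<in> H" "ps \<in> paulis n" by (rule labelsE[OF p])
    obtain t where t: "t \<in> {1, -1}" "spauli t qs \<in> H" "qs \<in> paulis n" by (rule labelsE[OF q])
    have m: "spauli (s * t * phase ps qs) (pmul ps qs) \<in> H"
      using H s t unfolding spauli_mult[OF s(3) t(3), symmetric] by (simp add: stab_def)
    have nz: "s * t * phase ps qs \<noteq> 0" using s t by (auto simp: phase_nonzero)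
    obtain u rs where u: "u \<in> {1, -1}" "rs \<in> labels n H" "rs \<in> paulis n"
        "spauli (s * t * phase ps qs) (pmul ps qs) = spauli u rs"
      by (rule stabE[OF H m])
    then have "pmul ps qs = rs" using spauli_inj[OF _ u(3) nz] s t by simp
    then show ?thesis using u by simp
  qed
  moreover have "pid n \<in> labels n H"
    using H labelsI[of "pid n" n 1 H] by (simp add: stab_def pauli_string_pid)
  ultimately show ?thesis by (simp add: pauli_subgroup_def labels_paulis)
qed

lemma labels_perp:
  assumes H: "stab n H"
  shows "labels n H \<subseteq> perp n (labels n H)"
  using stab_comm_sign[OF H] labels_paulis[of n H] by (auto simp: perp_def)

text \<open>As minus the identity is excluded, each label occurs with exactly one sign. Forgetting
  signs therefore preserves cardinalities.\<close>

lemma stab_bij: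
  assumes H: "stab n H"
  shows "bij_betw (\<lambda>ps. if spauli 1 ps \<in> H then spauli 1 ps else spauli (-1) ps) (labels n H) H"
    (is "bij_betw ?f _ _")
proof (rule bij_betw_imageI)
  show "inj_on ?f (labels n H)"
    by (rule inj_onI) (auto split: if_splits simp: spauli_inj[where n = n] labels_def simp del: spauli_one)
  show "?f ` labels n H = H"
  proof (intro equalityI subsetI)
    fix g assume g: "g \<in> H"
    obtain s ps where s: "s \<in> {1, -1}" "ps \<in> labels n H" "ps \<in> paulis n" "g = spauli s ps"
      by (rule stabE[OF H g])
    then have "g = ?f ps" using stab_not_both[OF H, of 1 ps "-1"] g by (auto simp del: spauli_one)
    then show "g \<in> ?f ` labels n H" using s(2) by blast
  qed (auto simp: labels_def)
qed

lemma card_labels: "stab n H \<Longrightarrow> card (labels n H) = card H"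
  by (rule bij_betw_same_card[OF stab_bij])

lemma stab_finite: "stab n H \<Longrightarrow> finite H"
  using bij_betw_finite[OF stab_bij] pauli_subgroup_finite[OF labels_subgroup] by blast

text \<open>Commuting with \<open>H\<close> keeps the products Hermitian, and \<open>P * h\<close>
  could equal minus the identity only if \<open>p\<close> were a label of \<open>H\<close>. Both
  values of \<open>s\<close> are admissible, which later lets a group sum be split into two
  halves.\<close>

lemma stab_extend:
  assumes H: "stab n H" and p: "p \<in> perp n (labels n H)" "p \<notin> labels n H" and s: "s \<in> {1, -1}"
  shows "stab n (H \<union> coset s p H)"
proof -
  define P where "P = spauli s p"
  have pp: "p \<in> paulis n" using p(1) by (simp add: perp_def)
  then have P: "P \<in> op_carrier n" "P * P = 1\<^sub>m (2 ^ n)"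
    using s by (simp_all add: P_def spauli_square)
  note c = stab_carrier[OF H]
  have H1: "1\<^sub>m (2 ^ n) \<in> H" "\<And>g h. g \<in> H \<Longrightarrow> h \<in> H \<Longrightarrow> g * h \<in> H"
      "\<And>g. g \<in> H \<Longrightarrow> hermitian_pauli n g" "- 1\<^sub>m (2 ^ n) \<notin> H"
    using H by (auto simp: stab_def)
  have comm: "h * P = P * h" and herm: "hermitian_pauli n (P * h)" and not_one: "P * h \<noteq> - 1\<^sub>m (2 ^ n)"
    if h: "h \<in> H" for h
  proof -
    obtain t qs where t: "t \<in> {1, -1}" "qs \<in> labels n H" "qs \<in> paulis n" "h = spauli t qs"
      by (rule stabE[OF H h])
    have one: "comm_sign p qs = 1" using p(1) t(2) by (simp add: perp_def)
    have nz: "s \<noteq> 0" "t \<noteq> 0" using s t by auto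
    show "h * P = P * h"
      using spauli_commute_iff[OF pp t(3) nz] one t(4) by (simp add: P_def)
    show "hermitian_pauli n (P * h)"
      using hermitian_pauli_mult_iff[OF pp t(3) s t(1)] one by (simp add: P_def t(4))
    show "P * h \<noteq> - 1\<^sub>m (2 ^ n)"
    proof
      assume "P * h = - 1\<^sub>m (2 ^ n)"
      then have "spauli (-1) (pid n) = spauli (s * t * phase p qs) (pmul p qs)"
        by (simp add: P_def t(4) spauli_mult[OF pp t(3)] spauli_minus_pid)
      then have "pid n = pmul p qs"
        using spauli_inj[OF pid_paulis pmul_paulis[OF pp t(3)], of "-1"] by simp
      then have "p = qs" using pmul_eq_pid[OF pp t(3)] by simp
      then show False using p(2) t(2) by simp
    qed
  qed
  have Ph: "g * (P * h) = P * (g * h)" "(P * g) * h = P * (g * h)" if "g \<in> H" "h \<in> H" for g h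
    using c[OF that(1)] c[OF that(2)] P(1) comm[OF that(1)]
    by (metis assoc_mult_mat)+
  have PP: "(P * g) * (P * h) = g * h" if "g \<in> H" "h \<in> H" for g h
  proof -
    have "(P * g) * (P * h) = P * (g * (P * h))"
      using c[OF that(1)] c[OF that(2)] P(1) by (intro assoc_mult_mat) auto
    also have "\<dots> = P * (P * (g * h))" by (simp add: Ph that)
    also have "\<dots> = (P * P) * (g * h)"
      using c[OF that(1)] c[OF that(2)] P(1) by (intro assoc_mult_mat[symmetric]) auto
    also have "\<dots> = g * h"
      using c[OF that(1)] c[OF that(2)] by (simp add: P(2))
    finally show ?thesis .
  qed
  have "a * b \<in> H \<union> (*) P ` H" if "a \<in> H \<union> (*) P ` H" "b \<in> H \<union> (*) P ` H" for a b
    using that by (elim UnE imageE) (auto simp: Ph PP H1)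
  then show ?thesis
    unfolding P_def[symmetric] stab_def using H1 herm not_one
    by (auto dest: not_one[symmetric])
qed

section \<open>Stabilizer groups as groups of matrices\<close>

lemma GL_simps [simp]: "monoid.mult (GL n) = (*)" "\<one>\<^bsub>GL n\<^esub> = 1\<^sub>m (2 ^ n)"
  by (simp_all add: GL_def units_of_mult units_of_one ring_mat_simps)

lemma GL_group: "group (GL n)"
  unfolding GL_def by (rule monoid.units_group) (rule ring.is_monoid, rule ring_mat)

lemma GL_carrierI:
  assumes "M \<in> op_carrier n" "M * M = 1\<^sub>m (2 ^ n)"
  shows "M \<in> carrier (GL n)"
  unfolding GL_def units_of_carrier Units_def using assms by (auto simp: ring_mat_simps)

lemma stabilizer_group_iff: "stabilizer_group n G \<longleftrightarrow> stab n G"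
proof
  assume "stabilizer_group n G"
  then show "stab n G"
    using subgroup.m_closed[of G "GL n"] subgroup.one_closed[of G "GL n"]
    by (auto simp: stabilizer_group_def stab_def)
next
  assume G: "stab n G"
  interpret group "GL n" by (rule GL_group)
  have sub: "g \<in> carrier (GL n)" if "g \<in> G" for g
    using stab_carrier[OF G that] stab_square[OF G that] by (rule GL_carrierI)
  have "inv\<^bsub>GL n\<^esub> g = g" if "g \<in> G" for g
    using stab_square[OF G that] sub[OF that] by (intro inv_equality) simp_all
  then have "subgroup G (GL n)"
    using G sub by (intro subgroup.intro) (auto simp: stab_def)
  then show "stabilizer_group n G"
    using G stab_commute[OF G] by (simp add: stabilizer_group_def stab_def)
qed


section \<open>Elementary abelian 2-groups\<close>

text \<open>A vector space over the field with two elements in multiplicative notation: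
  \<open>generate\<close> is the span, and \<open>indep\<close> below is linear
  independence.\<close>

locale boolean_group = comm_group G for G (structure) +
  assumes square: "x \<in> carrier G \<Longrightarrow> x \<otimes> x = \<one>"
begin

lemma inv_self: "x \<in> carrier G \<Longrightarrow> inv x = x"
  using square by (intro inv_equality) auto

lemma generate_insert:
  assumes S: "S \<subseteq> carrier G" and g: "g \<in> carrier G"
  shows "generate G (insert g S) = generate G S \<union> (\<otimes>) g ` generate G S"
proof (intro equalityI subsetI)
  have c: "\<And>x. x \<in> generate G S \<Longrightarrow> x \<in> carrier G" using generate_in_carrier[OF S] by auto
  have closed: "x \<otimes> y \<in> generate G S" if "x \<in> generate G S" "y \<in> generate G S" for x y
    using that by (rule generate.eng)
  have gmem: "g \<otimes> x \<in> (\<otimes>) g ` generate G S" if "x \<in> generate G S" for x using that by blast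
  have m: "x \<otimes> (g \<otimes> y) = g \<otimes> (x \<otimes> y)" "(g \<otimes> x) \<otimes> y = g \<otimes> (x \<otimes> y)"
      "(g \<otimes> x) \<otimes> (g \<otimes> y) = x \<otimes> y" if "x \<in> generate G S" "y \<in> generate G S" for x y
  proof -
    show 1: "x \<otimes> (g \<otimes> y) = g \<otimes> (x \<otimes> y)" "(g \<otimes> x) \<otimes> y = g \<otimes> (x \<otimes> y)"
      using c[OF that(1)] c[OF that(2)] g by (simp_all add: m_ac)
    have "(g \<otimes> x) \<otimes> (g \<otimes> y) = (g \<otimes> g) \<otimes> (x \<otimes> y)"
      using c[OF that(1)] c[OF that(2)] g by (simp add: m_ac)
    then show "(g \<otimes> x) \<otimes> (g \<otimes> y) = x \<otimes> y"
      using c[OF that(1)] c[OF that(2)] g by (simp add: square)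
  qed
  fix x assume "x \<in> generate G (insert g S)"
  then show "x \<in> generate G S \<union> (\<otimes>) g ` generate G S"
  proof (induction rule: generate.induct)
    case one
    show ?case by (simp add: generate.one)
  next
    case (incl h)
    moreover have "g = g \<otimes> \<one>" using g by simp
    ultimately show ?case using generate.incl[of _ S G] gmem[OF generate.one] by auto
  next
    case (inv h)
    then have "h \<in> carrier G" using S g by auto
    moreover have "g = g \<otimes> \<one>" using g by simp
    ultimately show ?case using inv inv_self generate.incl[of _ S G] gmem[OF generate.one] by auto
  next
    case (eng h1 h2)
    then show ?case by (elim UnE imageE) (simp_all add: m closed gmem)
  qed
next
  fix x assume "x \<in> generate G S \<union> (\<otimes>) g ` generate G S"
  moreover have "generate G S \<subseteq> generate G (insert g S)" by (rule mono_generate) auto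
  moreover have "g \<in> generate G (insert g S)" by (simp add: generate.incl)
  ultimately show "x \<in> generate G (insert g S)" by (auto intro: generate.eng)
qed

lemma generate_Un:
  assumes "S \<subseteq> carrier G" "T \<subseteq> carrier G" "x \<in> generate G (S \<union> T)"
  shows "\<exists>s\<in>generate G S. \<exists>t\<in>generate G T. x = s \<otimes> t"
  using assms(3)
proof (induction rule: generate.induct)
  case one
  show ?case using generate.one[of G S] generate.one[of G T] by force
next
  case (incl h)
  then have h: "h = h \<otimes> \<one>" "h = \<one> \<otimes> h" using assms by auto
  show ?case using incl h generate.incl[of h _ G] generate.one[of G] by blast
next
  case (inv h)
  then have i: "inv h = h" using assms inv_self by auto
  from inv have h: "h = h \<otimes> \<one>" "h = \<one> \<otimes> h" using assms by auto
  show ?case unfolding i using inv h generate.incl[of h _ G] generate.one[of G] by blast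
next
  case (eng h1 h2)
  then obtain s1 t1 s2 t2 where st: "s1 \<in> generate G S" "t1 \<in> generate G T" "h1 = s1 \<otimes> t1"
      "s2 \<in> generate G S" "t2 \<in> generate G T" "h2 = s2 \<otimes> t2" by blast
  then have "s1 \<in> carrier G" "t1 \<in> carrier G" "s2 \<in> carrier G" "t2 \<in> carrier G"
    using generate_in_carrier assms by auto
  then have "h1 \<otimes> h2 = (s1 \<otimes> s2) \<otimes> (t1 \<otimes> t2)" using st by (simp add: m_ac)
  then show ?case using st generate.eng by metis
qed

definition indep :: "'a set \<Rightarrow> bool" where
  "indep S \<longleftrightarrow> finite S \<and> S \<subseteq> carrier G \<and> (\<forall>g\<in>S. g \<notin> generate G (S - {g}))"

lemma indep_subset: "indep S \<Longrightarrow> T \<subseteq> S \<Longrightarrow> indep T"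
  unfolding indep_def using mono_generate[of "T - {_}" "S - {_}"]
  by (meson Diff_mono finite_subset order_refl subset_iff)

text \<open>The exchange argument: if \<open>g\<close> lies in the span of \<open>x\<close> and the
  other elements of \<open>S\<close>, but not in the span of the latter, then
  \<open>g = x \<otimes> h\<close>, and so \<open>x = g \<otimes> h\<close> would already be in the
  span of \<open>S\<close>.\<close>

lemma indep_insert:
  assumes S: "indep S" and x: "x \<in> carrier G" "x \<notin> generate G S"
  shows "indep (insert x S)"
proof -
  have fin: "finite S" "S \<subseteq> carrier G" using S by (auto simp: indep_def)
  have xS: "x \<notin> S" using x(2) generate.incl[of x S G] by auto
  have "g \<notin> generate G (insert x S - {g})" if g: "g \<in> S" for g
  proof
    let ?H = "generate G (S - {g})"
    assume "g \<in> generate G (insert x S - {g})"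
    moreover have "insert x S - {g} = insert x (S - {g})" using g xS by auto
    ultimately have "g \<in> ?H \<union> (\<otimes>) x ` ?H"
      using generate_insert[of "S - {g}" x] fin x by auto
    moreover have "g \<notin> ?H" using S g by (auto simp: indep_def)
    ultimately obtain h where h: "h \<in> ?H" "g = x \<otimes> h" by auto
    have hS: "h \<in> generate G S" using h(1) mono_generate[of "S - {g}" S] by auto
    then have hc: "h \<in> carrier G" using generate_in_carrier fin by auto
    have "g \<otimes> h = x \<otimes> (h \<otimes> h)" using h(2) hc x by (simp add: m_assoc)
    then have "x = g \<otimes> h" using hc x by (simp add: square)
    then have "x \<in> generate G S" using generate.eng[OF generate.incl[OF g] hS] by simp
    then show False using x(2) by simp
  qed
  moreover have "insert x S - {x} = S" using xS by auto
  ultimately show ?thesis using fin x by (auto simp: indep_def)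
qed

lemma generate_coset_disjoint:
  assumes F: "F \<subseteq> carrier G" and x: "x \<in> carrier G" "x \<notin> generate G F"
  shows "generate G F \<inter> (\<otimes>) x ` generate G F = {}"
proof (rule ccontr)
  assume "\<not> ?thesis"
  then obtain h where h: "h \<in> generate G F" "x \<otimes> h \<in> generate G F" by auto
  then have "(x \<otimes> h) \<otimes> h \<in> generate G F" using generate.eng[OF h(2,1)] by simp
  moreover have "(x \<otimes> h) \<otimes> h = x"
    using generate_in_carrier[OF F h(1)] x by (simp add: m_assoc square)
  ultimately show False using x by simp
qed

lemma indep_insertD:
  assumes "indep (insert x F)" "x \<notin> F"
  shows "indep F" "x \<in> carrier G" "x \<notin> generate G F" "F \<subseteq> carrier G"
proof -
  show "indep F" using indep_subset[OF assms(1)] by auto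
  have "insert x F - {x} = F" using assms(2) by auto
  then show "x \<in> carrier G" "x \<notin> generate G F" "F \<subseteq> carrier G"
    using assms(1) by (auto simp: indep_def)
qed

lemma card_generate_indep:
  assumes "indep S"
  shows "card (generate G S) = 2 ^ card S \<and> finite (generate G S)"
proof -
  have "finite S" using assms by (simp add: indep_def)
  then show ?thesis using assms
  proof (induction S rule: finite_induct)
    case empty
    then show ?case by (simp add: generate_empty)
  next
    case (insert x F)
    note F = indep_insertD(1)[OF insert.prems insert.hyps(2)]
    note x = indep_insertD(2-4)[OF insert.prems insert.hyps(2)]
    let ?H = "generate G F"
    have c: "\<And>h. h \<in> ?H \<Longrightarrow> h \<in> carrier G" using generate_in_carrier x by auto
    have "inj_on ((\<otimes>) x) ?H" using c x by (intro inj_onI) auto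
    moreover note generate_coset_disjoint[OF x(3,1,2)]
    ultimately have "card (?H \<union> (\<otimes>) x ` ?H) = 2 * card ?H"
      using insert.IH[OF F] by (subst card_Un_disjoint) (auto simp: card_image)
    then show ?case using insert.IH[OF F] generate_insert[of F x] x insert.hyps by simp
  qed
qed

text \<open>Basis extension with the new elements taken from \<open>T\<close> itself. If
  \<open>T\<close> consists of operators supported on a set of qubits, so do the new
  generators.\<close>

lemma indep_extend:
  assumes S: "indep S" and T: "finite T" "T \<subseteq> carrier G"
  shows "\<exists>U\<subseteq>T. U \<inter> S = {} \<and> indep (S \<union> U) \<and> T \<subseteq> generate G (S \<union> U)"
  using T
proof (induction T rule: finite_induct)
  case empty
  then show ?case using S by auto
next
  case (insert t T)
  then obtain U where U: "U \<subseteq> T" "U \<inter> S = {}" "indep (S \<union> U)" "T \<subseteq> generate G (S \<union> U)" by auto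
  show ?case
  proof (cases "t \<in> generate G (S \<union> U)")
    case True
    then show ?thesis using U by (intro exI[of _ U]) auto
  next
    case False
    then have "t \<notin> S" using generate.incl[of t "S \<union> U" G] by auto
    moreover have "indep (S \<union> insert t U)"
      using indep_insert[OF U(3) _ False] insert.prems by simp
    moreover have "generate G (S \<union> U) \<subseteq> generate G (S \<union> insert t U)"
      by (rule mono_generate) auto
    moreover have "t \<in> generate G (S \<union> insert t U)" by (simp add: generate.incl)
    ultimately show ?thesis using U by (intro exI[of _ "insert t U"]) auto
  qed
qed

end


section \<open>Operators in the Pauli basis\<close>

text \<open>The factor \<open>1 / 2 ^ n\<close> makes \<open>e ps\<close> the expectation of
  \<open>pauli_string ps\<close> (\<open>mat_trace_pauli_op\<close>).\<close>

definition pauli_op :: "nat \<Rightarrow> (pauli list \<Rightarrow> real) \<Rightarrow> complex mat" where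
  "pauli_op n e = mat (2 ^ n) (2 ^ n)
     (\<lambda>(i, j). (\<Sum>ps\<in>paulis n. of_real (e ps) * pauli_string ps $$ (i, j)) / 2 ^ n)"

text \<open>A string that occurs with both signs gets 0, just as it cancels in the sum of
  \<open>S\<close>.\<close>

definition coeff :: "complex mat set \<Rightarrow> pauli list \<Rightarrow> real" where
  "coeff S ps = of_bool (spauli 1 ps \<in> S) - of_bool (spauli (-1) ps \<in> S)"

definition mat_sum :: "nat \<Rightarrow> complex mat set \<Rightarrow> complex mat" where
  "mat_sum n S = mat (2 ^ n) (2 ^ n) (\<lambda>(i, j). \<Sum>s\<in>S. s $$ (i, j))"

lemma mat_sum_carrier [simp]: "mat_sum n S \<in> op_carrier n"
  by (simp add: mat_sum_def)
lemma pauli_op_carrier [simp]: "pauli_op n e \<in> op_carrier n"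
  by (simp add: pauli_op_def)
lemma pauli_op_dim [simp]: "dim_row (pauli_op n e) = 2 ^ n" "dim_col (pauli_op n e) = 2 ^ n"
  by (simp_all add: pauli_op_def)

lemma pauli_op_entry:
  "i < 2 ^ n \<Longrightarrow> j < 2 ^ n \<Longrightarrow>
    pauli_op n e $$ (i, j) = (\<Sum>ps\<in>paulis n. of_real (e ps) * pauli_string ps $$ (i, j)) / 2 ^ n"
  by (simp add: pauli_op_def)

lemma pauli_op_cong: "(\<And>ps. ps \<in> paulis n \<Longrightarrow> e ps = f ps) \<Longrightarrow> pauli_op n e = pauli_op n f"
  by (simp add: pauli_op_def)

lemma mat_sum_entry: "i < 2 ^ n \<Longrightarrow> j < 2 ^ n \<Longrightarrow> mat_sum n S $$ (i, j) = (\<Sum>s\<in>S. s $$ (i, j))"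
  by (simp add: mat_sum_def)

lemma mat_sum_eq_pauli_op:
  assumes "\<And>s. s \<in> S \<Longrightarrow> hermitian_pauli n s"
  shows "mat_sum n S = 2 ^ n \<cdot>\<^sub>m pauli_op n (coeff S)"
proof (rule eq_matI)
  fix i j assume "i < dim_row (2 ^ n \<cdot>\<^sub>m pauli_op n (coeff S))" "j < dim_col (2 ^ n \<cdot>\<^sub>m pauli_op n (coeff S))"
  then have ij: "i < 2 ^ n" "j < 2 ^ n" by simp_all
  define T where "T c = {ps \<in> paulis n. spauli c ps \<in> S}" for c
  have S: "S = spauli 1 ` T 1 \<union> spauli (-1) ` T (-1)"
    using assms by (auto simp: T_def hermitian_pauli_iff simp del: spauli_one)
  have inj: "inj_on (spauli c) (T c)" if "c \<noteq> 0" for c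
    using that by (auto intro!: inj_onI simp: spauli_inj[where n = n] T_def)
  have disj: "spauli 1 ` T 1 \<inter> spauli (-1) ` T (-1) = {}"
    by (auto simp: spauli_inj[where n = n] T_def simp del: spauli_one)
  have fin: "finite (T c)" for c by (simp add: T_def)
  have entry: "spauli c ps $$ (i, j) = c * pauli_string ps $$ (i, j)" if "ps \<in> paulis n" for c ps
    using that ij by (simp add: spauli_def paulis_def)
  have part: "(\<Sum>s\<in>spauli c ` T c. s $$ (i, j)) =
      (\<Sum>ps\<in>paulis n. of_bool (spauli c ps \<in> S) * c * pauli_string ps $$ (i, j))" if "c \<noteq> 0" for c
  proof -
    have "(\<Sum>s\<in>spauli c ` T c. s $$ (i, j)) = (\<Sum>ps\<in>T c. c * pauli_string ps $$ (i, j))"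
      by (simp add: sum.reindex[OF inj[OF that]]) (auto simp: T_def entry intro!: sum.cong)
    also have "\<dots> = (\<Sum>ps\<in>paulis n. if spauli c ps \<in> S then c * pauli_string ps $$ (i, j) else 0)"
      unfolding T_def by (rule sum.inter_filter) simp
    also have "\<dots> = (\<Sum>ps\<in>paulis n. of_bool (spauli c ps \<in> S) * c * pauli_string ps $$ (i, j))"
      by (intro sum.cong) auto
    finally show ?thesis .
  qed
  have "(\<Sum>s\<in>S. s $$ (i, j)) = (\<Sum>s\<in>spauli 1 ` T 1. s $$ (i, j)) + (\<Sum>s\<in>spauli (-1) ` T (-1). s $$ (i, j))"
    by (subst S, rule sum.union_disjoint) (use fin disj in auto)
  also have "\<dots> = (\<Sum>ps\<in>paulis n. complex_of_real (coeff S ps) * pauli_string ps $$ (i, j))"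
    unfolding part[OF one_neq_zero] part[OF neg_one_neq_zero] sum.distrib[symmetric]
    by (intro sum.cong) (auto simp: coeff_def algebra_simps)
  finally show "mat_sum n S $$ (i, j) = (2 ^ n \<cdot>\<^sub>m pauli_op n (coeff S)) $$ (i, j)"
    using ij by (simp add: mat_sum_entry pauli_op_entry)
qed (simp_all add: mat_sum_def)

lemma mat_trace_mult:
  assumes "M \<in> carrier_mat N N" "K \<in> carrier_mat N N"
  shows "mat_trace (M * K) = (\<Sum>i<N. \<Sum>k<N. M $$ (i, k) * K $$ (k, i))"
  using assms by (auto simp: mat_trace_eq scalar_prod_def lessThan_atLeast0 intro!: sum.cong)

lemma mat_trace_mult_sum:
  assumes M: "M \<in> carrier_mat N N" and F: "\<And>s. s \<in> S \<Longrightarrow> F s \<in> carrier_mat N N"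
  shows "mat_trace (M * mat N N (\<lambda>(i, j). \<Sum>s\<in>S. c s * F s $$ (i, j))) = (\<Sum>s\<in>S. c s * mat_trace (M * F s))"
proof -
  have "mat_trace (M * mat N N (\<lambda>(i, j). \<Sum>s\<in>S. c s * F s $$ (i, j))) =
      (\<Sum>i<N. \<Sum>k<N. \<Sum>s\<in>S. c s * (M $$ (i, k) * F s $$ (k, i)))"
    by (subst mat_trace_mult[OF M], simp, intro sum.cong refl) (simp add: sum_distrib_left mult_ac)
  also have "\<dots> = (\<Sum>i<N. \<Sum>s\<in>S. \<Sum>k<N. c s * (M $$ (i, k) * F s $$ (k, i)))"
    by (intro sum.cong refl sum.swap)
  also have "\<dots> = (\<Sum>s\<in>S. \<Sum>i<N. \<Sum>k<N. c s * (M $$ (i, k) * F s $$ (k, i)))"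
    by (rule sum.swap)
  also have "\<dots> = (\<Sum>s\<in>S. c s * mat_trace (M * F s))"
    by (intro sum.cong refl) (simp only: mat_trace_mult[OF M F] sum_distrib_left)
  finally show ?thesis .
qed

lemma mat_trace_pauli_mult:
  assumes "ps \<in> paulis n" "qs \<in> paulis n"
  shows "mat_trace (pauli_string ps * pauli_string qs) = (if ps = qs then 2 ^ n else 0)"
  using assms spauli_mult[OF assms, of 1 1]
  by (simp add: mat_trace_spauli[where n = n] pmul_eq_pid)

lemma mat_trace_pauli_op:
  assumes ps: "ps \<in> paulis n"
  shows "mat_trace (pauli_string ps * pauli_op n e) = of_real (e ps)"
proof -
  have "pauli_op n e = mat (2 ^ n) (2 ^ n)
      (\<lambda>(i, j). \<Sum>qs\<in>paulis n. of_real (e qs) / 2 ^ n * pauli_string qs $$ (i, j))"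
    by (simp add: pauli_op_def sum_divide_distrib)
  also have "mat_trace (pauli_string ps * \<dots>) =
      (\<Sum>qs\<in>paulis n. of_real (e qs) / 2 ^ n * mat_trace (pauli_string ps * pauli_string qs))"
    using ps by (intro mat_trace_mult_sum) simp_all
  also have "\<dots> = (\<Sum>qs\<in>paulis n. if ps = qs then of_real (e ps) else 0)"
    using ps by (intro sum.cong refl) (auto simp: mat_trace_pauli_mult[where n = n])
  also have "\<dots> = of_real (e ps)" using ps by simp
  finally show ?thesis .
qed

lemma mat_sum_union:
  "finite S \<Longrightarrow> finite T \<Longrightarrow> S \<inter> T = {} \<Longrightarrow> mat_sum n (S \<union> T) = mat_sum n S + mat_sum n T"
  by (rule eq_matI) (simp_all add: mat_sum_def sum.union_disjoint)

lemma mult_mat_sum: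
  assumes M: "M \<in> op_carrier n" and S: "S \<subseteq> op_carrier n"
    and inj: "inj_on ((*) M) S"
  shows "M * mat_sum n S = mat_sum n ((*) M ` S)"
proof (rule eq_matI)
  fix i j assume "i < dim_row (mat_sum n ((*) M ` S))" "j < dim_col (mat_sum n ((*) M ` S))"
  then have ij: "i < 2 ^ n" "j < 2 ^ n" by (simp_all add: mat_sum_def)
  have "(M * mat_sum n S) $$ (i, j) = (\<Sum>k<2 ^ n. M $$ (i, k) * (\<Sum>s\<in>S. s $$ (k, j)))"
    using ij M by (simp add: scalar_prod_def lessThan_atLeast0 mat_sum_def)
  also have "\<dots> = (\<Sum>k<2 ^ n. \<Sum>s\<in>S. M $$ (i, k) * s $$ (k, j))"
    by (simp add: sum_distrib_left)
  also have "\<dots> = (\<Sum>s\<in>S. \<Sum>k<2 ^ n. M $$ (i, k) * s $$ (k, j))"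
    by (rule sum.swap)
  also have "\<dots> = (\<Sum>s\<in>S. (M * s) $$ (i, j))"
  proof (rule sum.cong[OF refl])
    fix s assume "s \<in> S"
    then have "s \<in> op_carrier n" using S by auto
    then show "(\<Sum>k<2 ^ n. M $$ (i, k) * s $$ (k, j)) = (M * s) $$ (i, j)"
      using ij M by (simp add: scalar_prod_def lessThan_atLeast0)
  qed
  also have "\<dots> = mat_sum n ((*) M ` S) $$ (i, j)"
    using ij by (simp add: mat_sum_entry sum.reindex[OF inj])
  finally show "(M * mat_sum n S) $$ (i, j) = mat_sum n ((*) M ` S) $$ (i, j)" .
qed (use M in \<open>auto simp: mat_sum_def\<close>)

lemma involution_mult_inj:
  fixes M :: "complex mat"
  assumes "M \<in> carrier_mat N N" "M * M = 1\<^sub>m N" "S \<subseteq> carrier_mat N N"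
  shows "inj_on ((*) M) S"
proof (rule inj_onI)
  fix x y assume xy: "x \<in> S" "y \<in> S" "M * x = M * y"
  then have "(M * M) * x = (M * M) * y"
    using assms by (subst (1 2) assoc_mult_mat[where ?n\<^sub>1 = N and ?n\<^sub>2 = N and ?n\<^sub>3 = N and ?n\<^sub>4 = N]) auto
  moreover have "x \<in> carrier_mat N N" "y \<in> carrier_mat N N" using xy assms by auto
  then have "1\<^sub>m N * x = x" "1\<^sub>m N * y = y" by simp_all
  ultimately show "x = y" by (simp only: assms(2))
qed

text \<open>With the carrier cut down to \<open>G\<close>, all elements commute and are involutions,
  as \<open>boolean_group\<close> demands. Spans are the same as in \<open>GL n\<close>
  (\<open>generate_stab_monoid\<close>).\<close>

definition stab_monoid :: "nat \<Rightarrow> complex mat set \<Rightarrow> complex mat monoid" where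
  "stab_monoid n G = GL n \<lparr>carrier := G\<rparr>"

lemma stab_monoid_simps [simp]:
  "carrier (stab_monoid n G) = G" "monoid.mult (stab_monoid n G) = (*)"
  "\<one>\<^bsub>stab_monoid n G\<^esub> = 1\<^sub>m (2 ^ n)"
  by (simp_all add: stab_monoid_def)

lemma stab_subgroup: "stab n G \<Longrightarrow> subgroup G (GL n)"
  using stabilizer_group_iff by (auto simp: stabilizer_group_def)

lemma stab_boolean_group:
  assumes G: "stab n G"
  shows "boolean_group (stab_monoid n G)"
proof -
  interpret GL: group "GL n" by (rule GL_group)
  have "group (stab_monoid n G)"
    unfolding stab_monoid_def using GL.subgroup_imp_group stab_subgroup[OF G] by auto
  then have "comm_group (stab_monoid n G)"
    by (rule group.group_comm_groupI) (simp add: stab_commute[OF G])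
  then show ?thesis
    by (intro boolean_group.intro boolean_group_axioms.intro) (simp_all add: stab_square[OF G])
qed

lemma generate_stab_monoid:
  "stab n G \<Longrightarrow> S \<subseteq> G \<Longrightarrow> generate (stab_monoid n G) S = generate (GL n) S"
  unfolding stab_monoid_def by (rule group.generate_consistent[OF GL_group _ stab_subgroup])

lemma independent_generators_iff:
  assumes G: "stab n G"
  shows "independent_generators n G gs \<longleftrightarrow>
    distinct gs \<and> boolean_group.indep (stab_monoid n G) (set gs) \<and> generate (stab_monoid n G) (set gs) = G"
proof -
  interpret boolean_group "stab_monoid n G" by (rule stab_boolean_group[OF G])
  show ?thesis
  proof (cases "set gs \<subseteq> G")
    case True
    then have "generate (stab_monoid n G) (set gs - {g}) = generate (GL n) (set gs - {g})" for g
      by (intro generate_stab_monoid[OF G]) auto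
    then show ?thesis using True
      by (auto simp: independent_generators_def indep_def generate_stab_monoid[OF G])
  qed (auto simp: independent_generators_def indep_def)
qed

lemma card_stab:
  assumes G: "stab n G" and gs: "independent_generators n G gs"
  shows "card G = 2 ^ length gs"
proof -
  interpret boolean_group "stab_monoid n G" by (rule stab_boolean_group[OF G])
  show ?thesis
    using card_generate_indep[of "set gs"] gs
    by (simp add: independent_generators_iff[OF G] distinct_card)
qed

lemma independent_generators_exist:
  assumes G: "stab n G"
  shows "\<exists>gs. independent_generators n G gs"
proof -
  interpret boolean_group "stab_monoid n G" by (rule stab_boolean_group[OF G])
  have "indep {}" by (simp add: indep_def)
  then obtain U where U: "U \<subseteq> G" "indep U" "G \<subseteq> generate (stab_monoid n G) U"
    using indep_extend[of "{}" G] stab_finite[OF G] by auto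
  moreover have "generate (stab_monoid n G) U \<subseteq> G" using generate_incl[of U] U by simp
  moreover obtain gs where "distinct gs" "set gs = U"
    using U(2) finite_distinct_list[of U] unfolding indep_def by blast
  ultimately show ?thesis by (auto simp: independent_generators_iff[OF G])
qed

section \<open>Products of generators and group sums\<close>

lemma mat_prod_list_Cons: "mat_prod_list n (M # Ms) = M * mat_prod_list n Ms"
  by (simp add: mat_prod_list_def)
lemma mat_prod_list_Nil: "mat_prod_list n [] = 1\<^sub>m (2 ^ n)"
  by (simp add: mat_prod_list_def)

lemma mat_prod_list_carrier:
  "set Ms \<subseteq> op_carrier n \<Longrightarrow> mat_prod_list n Ms \<in> op_carrier n"
  by (induction Ms) (auto simp: mat_prod_list_Cons mat_prod_list_Nil)

lemma mat_prod_list_append: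
  assumes "set Ms \<subseteq> op_carrier n" "set Ks \<subseteq> op_carrier n"
  shows "mat_prod_list n (Ms @ Ks) = mat_prod_list n Ms * mat_prod_list n Ks"
  using assms(1)
proof (induction Ms)
  case (Cons M Ms)
  have "mat_prod_list n Ms \<in> op_carrier n" "mat_prod_list n Ks \<in> op_carrier n"
    using mat_prod_list_carrier Cons.prems assms(2) by auto
  then show ?case using Cons by (simp add: mat_prod_list_Cons assoc_mult_mat[of _ "2 ^ n" "2 ^ n" _ "2 ^ n" _ "2 ^ n"])
qed (use mat_prod_list_carrier[OF assms(2)] in \<open>simp add: mat_prod_list_Nil\<close>)

lemma mat_prod_list_smult:
  assumes "set Ms \<subseteq> op_carrier n"
  shows "mat_prod_list n (map (\<lambda>M. c \<cdot>\<^sub>m M) Ms) = c ^ length Ms \<cdot>\<^sub>m mat_prod_list n Ms"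
  using assms
proof (induction Ms)
  case Nil
  show ?case by (rule eq_matI) (auto simp: mat_prod_list_Nil)
next
  case (Cons M Ms)
  have c: "mat_prod_list n Ms \<in> op_carrier n" "M \<in> op_carrier n"
    using mat_prod_list_carrier Cons.prems by auto
  have "mat_prod_list n (map (\<lambda>M. c \<cdot>\<^sub>m M) (M # Ms)) = (c \<cdot>\<^sub>m M) * (c ^ length Ms \<cdot>\<^sub>m mat_prod_list n Ms)"
    using Cons by (simp add: mat_prod_list_Cons)
  also have "\<dots> = c \<cdot>\<^sub>m (c ^ length Ms \<cdot>\<^sub>m (M * mat_prod_list n Ms))"
    unfolding mult_smult_assoc_mat[OF c(2) smult_carrier_mat[OF c(1)]] mult_smult_distrib[OF c(2,1)] ..
  also have "\<dots> = c ^ length (M # Ms) \<cdot>\<^sub>m mat_prod_list n (M # Ms)"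
    unfolding mat_prod_list_Cons by (rule eq_matI) (use c in auto)
  finally show ?case .
qed

text \<open>Each factor \<open>1 + g\<close> adds to the sum of the group generated so far the sum
  of its coset by \<open>g\<close>. Independence makes this coset disjoint, so every element is
  counted once.\<close>

lemma mat_prod_list_one_plus:
  assumes G: "stab n G"
  shows "distinct gs \<Longrightarrow> boolean_group.indep (stab_monoid n G) (set gs) \<Longrightarrow>
    mat_prod_list n (map (\<lambda>g. 1\<^sub>m (2 ^ n) + g) gs) = mat_sum n (generate (stab_monoid n G) (set gs))"
proof (induction gs)
  case Nil
  interpret boolean_group "stab_monoid n G" by (rule stab_boolean_group[OF G])
  show ?case by (rule eq_matI) (auto simp: generate_empty mat_prod_list_Nil mat_sum_def)
next
  case (Cons g gs)
  interpret boolean_group "stab_monoid n G" by (rule stab_boolean_group[OF G])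
  let ?H = "generate (stab_monoid n G) (set gs)"
  have i: "indep (set gs)" "g \<in> G" "g \<notin> ?H" "set gs \<subseteq> G"
    using indep_insertD[of g "set gs"] Cons.prems by auto
  have HG: "?H \<subseteq> G" using generate_incl[of "set gs"] i by simp
  have Hc: "?H \<subseteq> op_carrier n" using HG stab_carrier[OF G] by auto
  have gc: "g \<in> op_carrier n" using stab_carrier[OF G i(2)] .
  have fin: "finite ?H" using finite_subset[OF HG stab_finite[OF G]] .
  have "mat_prod_list n (map (\<lambda>g. 1\<^sub>m (2 ^ n) + g) (g # gs)) = (1\<^sub>m (2 ^ n) + g) * mat_sum n ?H"
    using Cons i by (simp add: mat_prod_list_Cons)
  also have "\<dots> = mat_sum n ?H + g * mat_sum n ?H"
    unfolding add_mult_distrib_mat[OF one_carrier_mat gc mat_sum_carrier]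
    by (simp add: left_mult_one_mat[OF mat_sum_carrier])
  also have "\<dots> = mat_sum n ?H + mat_sum n ((*) g ` ?H)"
    using mult_mat_sum[OF gc Hc involution_mult_inj[OF gc stab_square[OF G i(2)] Hc]] by simp
  also have "\<dots> = mat_sum n (?H \<union> (*) g ` ?H)"
    using generate_coset_disjoint[of "set gs" g] i fin by (intro mat_sum_union[symmetric]) auto
  also have "?H \<union> (*) g ` ?H = generate (stab_monoid n G) (set (g # gs))"
    using generate_insert[of "set gs" g] i by simp
  finally show ?case .
qed


section \<open>Reducibility of logical operators\<close>

definition red :: "pauli list set \<Rightarrow> pauli list \<Rightarrow> nat set \<Rightarrow> bool" where
  "red W p S \<longleftrightarrow> (\<exists>w\<in>W. pauli_support (pmul w p) \<subseteq> S)"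

lemma supported_on_iff:
  "supported_on n M S \<longleftrightarrow> (\<exists>ps\<in>paulis n. \<exists>s\<in>{1, -1}. M = spauli s ps \<and> pauli_support ps \<subseteq> S)"
  by (auto simp: supported_on_def paulis_def simp flip: uminus_spauli)

lemma supported_on_spauli:
  assumes "ps \<in> paulis n" "c \<noteq> 0"
  shows "supported_on n (spauli c ps) S \<longleftrightarrow> c \<in> {1, -1} \<and> pauli_support ps \<subseteq> S"
  unfolding supported_on_iff using assms by (auto simp: spauli_inj[OF assms(1) _ assms(2)] simp del: spauli_one)

lemma pauli_support_pmul:
  "pauli_support (pmul p q) \<subseteq> pauli_support p \<union> pauli_support q"
  by (auto simp: pauli_support_def)

text \<open>Supports do not see signs. That \<open>p\<close> commutes with \<open>G\<close> keeps
  \<open>g * spauli s p\<close> Hermitian, as \<open>supported_on\<close> requires.\<close>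

lemma reducible_iff:
  assumes G: "stab n G" and p: "p \<in> perp n (labels n G)" and s: "s \<in> {1, -1}"
  shows "reducible n G (spauli s p) S \<longleftrightarrow> red (labels n G) p S"
proof
  have pp: "p \<in> paulis n" using p by (simp add: perp_def)
  show "red (labels n G) p S" if "reducible n G (spauli s p) S"
  proof -
    obtain g where g: "g \<in> G" "supported_on n (g * spauli s p) S"
      using \<open>reducible n G (spauli s p) S\<close> by (auto simp: reducible_def)
    obtain u w where u: "u \<in> {1, -1}" "w \<in> labels n G" "w \<in> paulis n" "g = spauli u w"
      by (rule stabE[OF G g(1)])
    have "u * s * phase w p \<noteq> 0" using u(1) s by (auto simp: phase_nonzero)
    then have "pauli_support (pmul w p) \<subseteq> S"
      using g(2) supported_on_spauli[OF pmul_paulis[OF u(3) pp]] u(4) spauli_mult[OF u(3) pp] by simp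
    then show ?thesis using u(2) by (auto simp: red_def)
  qed
  show "reducible n G (spauli s p) S" if "red (labels n G) p S"
  proof -
    obtain w where w: "w \<in> labels n G" "pauli_support (pmul w p) \<subseteq> S"
      using \<open>red (labels n G) p S\<close> by (auto simp: red_def)
    obtain u where u: "u \<in> {1, -1}" "spauli u w \<in> G" "w \<in> paulis n" by (rule labelsE[OF w(1)])
    have "comm_sign w p = comm_sign p w"
      using u(3) pp by (intro comm_sign_commute) (simp add: paulis_def)
    then have "hermitian_pauli n (spauli u w * spauli s p)"
      using hermitian_pauli_mult_iff[OF u(3) pp u(1) s] p w(1) by (simp add: perp_def)
    then obtain t r where t: "t \<in> {1, -1}" "r \<in> paulis n" "spauli u w * spauli s p = spauli t r"
      unfolding hermitian_pauli_iff by blast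
    have "u * s * phase w p \<noteq> 0" using u(1) s by (auto simp: phase_nonzero)
    then have "r = pmul w p"
      using t spauli_inj[OF pmul_paulis[OF u(3) pp] t(2)] unfolding spauli_mult[OF u(3) pp] by simp
    then have "supported_on n (spauli u w * spauli s p) S"
      using t w(2) by (subst t(3), subst supported_on_spauli[where n = n]) auto
    then show ?thesis using u(2) by (auto simp: reducible_def)
  qed
qed

lemma not_red_witness:
  assumes W: "pauli_subgroup n W" and p: "p \<in> paulis n" and B: "B = {..<n} - A"
    and not_red: "\<not> red W p A"
  shows "\<exists>q\<in>perp n W. pauli_support q \<subseteq> B \<and> comm_sign q p = -1"
proof -
  have sub: "W \<subseteq> paulis n" "pid n \<in> W" using W by (auto simp: pauli_subgroup_def)
  \<comment> \<open>The double complement of the group generated by \<open>W\<close> and the strings supported on \<open>A\<close> is that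
    group itself, so some string in its complement anticommutes with \<open>p\<close>.\<close>
  define PA where "PA = {a \<in> paulis n. pauli_support a \<subseteq> A}"
  define U where "U = {pmul w a |w a. w \<in> W \<and> a \<in> PA}"
  have PA: "a \<in> paulis n" "pauli_support a \<subseteq> A" if "a \<in> PA" for a using that by (simp_all add: PA_def)
  have closed: "pmul a b \<in> PA" if "a \<in> PA" "b \<in> PA" for a b
    using PA[OF that(1)] PA[OF that(2)] pauli_support_pmul[of a b] by (auto simp: PA_def)
  have UI: "pmul w a \<in> U" if "w \<in> W" "a \<in> PA" for w a
    using that by (auto simp: U_def)
  have pid_PA: "pid n \<in> PA" by (auto simp: PA_def pauli_support_def)
  have "pmul u v \<in> U" if "u \<in> U" "v \<in> U" for u v
  proof -
    from that obtain v1 a v2 b where v: "u = pmul v1 a" "v = pmul v2 b" "v1 \<in> W" "v2 \<in> W" "a \<in> PA" "b \<in> PA"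
      unfolding U_def by blast
    have "pmul u v = pmul (pmul v1 v2) (pmul a b)"
      by (simp only: v pmul_assoc pmul_left_commute[of a v2 b])
    then show ?thesis using UI closed v W by (simp add: pauli_subgroup_def)
  qed
  moreover have "U \<subseteq> paulis n" using sub PA(1) unfolding U_def by (auto simp: subset_iff)
  moreover have "pid n \<in> U" using UI[OF sub(2) pid_PA] by (simp add: pmul_pid(1)[OF pid_paulis])
  ultimately have U: "pauli_subgroup n U" by (simp add: pauli_subgroup_def)
  have "p \<notin> U"
  proof
    assume "p \<in> U"
    then obtain w a where wa: "w \<in> W" "a \<in> PA" "p = pmul w a" by (auto simp: U_def)
    then have "pmul w p = a" using pmul_cancel[of w n a] sub PA by auto
    then have "red W p A" using wa(1) PA(2)[OF wa(2)] unfolding red_def by (intro bexI[of _ w]) simp_all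
    then show False using not_red by simp
  qed
  then have "p \<notin> perp n (perp n U)" using perp_perp[OF U] by simp
  then obtain q where q: "q \<in> perp n U" "comm_sign p q \<noteq> 1"
    using p by (auto simp: perp_def)
  have qn: "q \<in> paulis n" using q(1) by (simp add: perp_def)
  have qU: "comm_sign q (pmul w a) = 1" if "w \<in> W" "a \<in> PA" for w a
    using q(1) UI[OF that] by (simp add: perp_def)
  have "comm_sign q w = 1" if "w \<in> W" for w
  proof -
    have "w \<in> paulis n" using sub that by auto
    then show ?thesis using qU[OF that pid_PA] by simp
  qed
  then have "q \<in> perp n W" using qn by (simp add: perp_def)
  moreover have "pauli_support q \<subseteq> B"
  proof
    fix r assume r: "r \<in> pauli_support q"
    then have rn: "r < n" "q ! r \<noteq> PI" using qn by (auto simp: pauli_support_def paulis_def)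
    \<comment> \<open>A nontrivial action of \<open>q\<close> on a qubit of \<open>A\<close> would
      be detected by a one-qubit string in \<open>PA\<close>, but \<open>q\<close> commutes with all
      of \<open>PA\<close>.\<close>
    have "r \<notin> A"
    proof
      assume "r \<in> A"
      obtain a where a: "comm_sign ((pid n)[r := a]) q = -1"
        using comm_sign_nondegenerate[OF qn rn] by auto
      have m: "(pid n)[r := a] \<in> PA"
        using \<open>r \<in> A\<close> rn by (auto simp: PA_def paulis_def pauli_support_def nth_list_update split: if_splits)
      have "comm_sign q ((pid n)[r := a]) = 1"
        using qU[OF sub(2) m] PA(1)[OF m] by simp
      moreover have "comm_sign q ((pid n)[r := a]) = comm_sign ((pid n)[r := a]) q"
        using qn by (intro comm_sign_commute) (simp add: paulis_def)
      ultimately show False using a by simp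
    qed
    then show "r \<in> B" using rn B by simp
  qed
  moreover have "comm_sign q p = -1"
    using q(2) comm_sign_cases[of p q] comm_sign_commute[of p q] p qn by (simp add: paulis_def)
  ultimately show ?thesis by blast
qed

lemma comm_sign_self [simp]: "comm_sign p p = 1"
  by (simp add: comm_sign_def pauli_sign_def)

text \<open>Modulo \<open>W\<close>, the complement of \<open>W\<close> is a symplectic plane with
  basis \<open>a\<close>, \<open>b\<close>, because it has \<open>4 * card W\<close> elements. Only
  the zero class of a symplectic plane commutes with both basis vectors.\<close>

lemma perp_pair_eq:
  assumes W: "pauli_subgroup n W" "W \<subseteq> perp n W" "card W = 2 ^ (n - 1)" "n \<ge> 1"
    and a: "a \<in> perp n W" and b: "b \<in> perp n W" and ab: "comm_sign a b = -1"
    and q: "q \<in> perp n W" "comm_sign q a = 1" "comm_sign q b = 1"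
  shows "q \<in> W"
proof -
  have sub: "W \<subseteq> paulis n" using W by (auto simp: pauli_subgroup_def)
  have an: "a \<in> paulis n" and bn: "b \<in> paulis n" and qn: "q \<in> paulis n"
    using a b q by (simp_all add: perp_def)
  have ba: "comm_sign b a = -1" using ab comm_sign_commute[of a b] an bn by (simp add: paulis_def)
  define W1 where "W1 = W \<union> pmul a ` W"
  define V where "V = W1 \<union> pmul b ` W1"
  have W1: "pauli_subgroup n W1" unfolding W1_def by (rule pauli_subgroup_extend[OF W(1) an])
  have V: "pauli_subgroup n V" unfolding V_def by (rule pauli_subgroup_extend[OF W1 bn])
  have com: "comm_sign c v = 1"
    if c: "c \<in> perp n W" "comm_sign c a = 1" and v: "v \<in> W1" for c v
  proof -
    have cn: "c \<in> paulis n" using c by (simp add: perp_def)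
    have "comm_sign c (pmul a w) = 1" if "w \<in> W" for w
      using comm_sign_pmul[OF cn an, of w] that c sub by (auto simp: perp_def)
    then show ?thesis using v c by (auto simp: W1_def perp_def)
  qed
  have comV: "comm_sign c v = 1"
    if c: "c \<in> perp n W" "comm_sign c a = 1" "comm_sign c b = 1" and v: "v \<in> V" for c v
  proof -
    have cn: "c \<in> paulis n" using c by (simp add: perp_def)
    have "comm_sign c (pmul b w) = 1" if "w \<in> W1" for w
      using comm_sign_pmul[OF cn bn, of w] that c com[OF c(1,2) that] W1
      by (auto simp: pauli_subgroup_def)
    then show ?thesis using v com[OF c(1,2)] by (auto simp: V_def)
  qed
  have "a \<notin> W"
  proof
    assume "a \<in> W"
    then have "comm_sign b a = 1" using b by (simp add: perp_def)
    then show False using ba by simp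
  qed
  then have cW1: "card W1 = 2 * card W" unfolding W1_def by (rule card_extend[OF W(1) an])
  have "b \<notin> W1" using com[OF a] ab by auto
  then have cV: "card V = 4 * card W" unfolding V_def using card_extend[OF W1 bn] cW1 by simp
  \<comment> \<open>So \<open>card (perp n V)\<close> is
    \<open>4 ^ n / (4 * 2 ^ (n - 1)) = 2 ^ (n - 1)\<close>. For \<open>n = 0\<close> the truncated
    subtraction would falsify this.\<close>
  have "4 ^ n = (4::nat) * (2 ^ (n - 1) * 2 ^ (n - 1))"
    using W(4) by (cases n) (simp_all flip: power_mult_distrib)
  then have "card (perp n V) = card W"
    using card_perp[OF V] cV W(3) by simp
  moreover have "W \<subseteq> perp n V"
  proof
    fix w assume w: "w \<in> W"
    have "comm_sign w a = comm_sign a w" "comm_sign w b = comm_sign b w"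
      using w sub an bn by (auto intro!: comm_sign_commute simp: paulis_def)
    then have "comm_sign w a = 1" "comm_sign w b = 1" using a b w by (simp_all add: perp_def)
    then show "w \<in> perp n V" using comV[of w] w W(2) sub by (auto simp: perp_def)
  qed
  moreover have "finite (perp n V)" by (auto simp: perp_def)
  ultimately have "perp n V = W" by (metis card_subset_eq)
  moreover have "q \<in> perp n V" using comV[OF q] qn by (simp add: perp_def)
  ultimately show ?thesis by simp
qed

text \<open>Cleaning gives some \<open>q\<close> supported on \<open>B\<close> that anticommutes
  with \<open>a\<close>. Just two classes modulo \<open>W\<close> anticommute with \<open>a\<close>,
  those of \<open>b\<close> and \<open>pmul a b\<close>, and the sign of \<open>q\<close> against
  \<open>b\<close> tells which one contains \<open>q\<close>.\<close>

lemma not_red_complement: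
  assumes W: "pauli_subgroup n W" "W \<subseteq> perp n W" "card W = 2 ^ (n - 1)" "n \<ge> 1"
    and a: "a \<in> perp n W" and b: "b \<in> perp n W" and ab: "comm_sign a b = -1"
    and B: "B = {..<n} - A" and not_red: "\<not> red W a A"
  shows "red W b B \<or> red W (pmul a b) B"
proof -
  have an: "a \<in> paulis n" and bn: "b \<in> paulis n" using a b by (simp_all add: perp_def)
  have ba: "comm_sign b a = -1" using ab comm_sign_commute[of a b] an bn by (simp add: paulis_def)
  have grp: "pauli_subgroup n (perp n W)"
    using W(1) by (intro pauli_subgroup_perp) (simp add: pauli_subgroup_def)
  obtain q where q: "q \<in> perp n W" "pauli_support q \<subseteq> B" "comm_sign q a = -1"
    using not_red_witness[OF W(1) an B not_red] by auto
  have qn: "q \<in> paulis n" using q(1) by (simp add: perp_def)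
  have red: "red W c B"
    if c: "c \<in> perp n W" "comm_sign c a = -1" "comm_sign c b = comm_sign q b" for c
  proof -
    have cn: "c \<in> paulis n" using c(1) by (simp add: perp_def)
    have "pmul q c \<in> perp n W" using grp q(1) c(1) by (simp add: pauli_subgroup_def)
    moreover have "comm_sign (pmul q c) a = 1"
      using comm_sign_pmul_left[OF an qn cn] q(3) c(2) by simp
    moreover have "comm_sign (pmul q c) b = 1"
      using comm_sign_pmul_left[OF bn qn cn] c(3) comm_sign_cases[of q b] by auto
    ultimately have "pmul q c \<in> W" by (rule perp_pair_eq[OF W a b ab])
    moreover have "pmul (pmul q c) c = q"
      using pmul_cancel[OF cn qn] by (simp add: pmul_commute)
    ultimately show ?thesis using q(2) unfolding red_def by (intro bexI[of _ "pmul q c"]) simp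
  qed
  show ?thesis
  proof (cases "comm_sign q b = 1")
    case True
    then show ?thesis using red[OF b ba] by simp
  next
    case False
    then have "comm_sign q b = -1" using comm_sign_cases[of q b] by auto
    moreover have "pmul a b \<in> perp n W" using grp a b by (simp add: pauli_subgroup_def)
    ultimately show ?thesis
      using red[of "pmul a b"] comm_sign_pmul_left[OF an an bn] comm_sign_pmul_left[OF bn an bn] ab ba by simp
  qed
qed

text \<open>The commutation sign depends only on the classes modulo \<open>W\<close>, so it can be
  computed on representatives with disjoint supports.\<close>

lemma red_disjoint:
  assumes W: "W \<subseteq> paulis n" "W \<subseteq> perp n W" and a: "a \<in> perp n W" and b: "b \<in> perp n W"
    and ab: "comm_sign a b = -1" and disj: "A \<inter> B = {}"
  shows "\<not> (red W a A \<and> red W b B)"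
proof
  assume "red W a A \<and> red W b B"
  then obtain v w where v: "v \<in> W" "pauli_support (pmul v a) \<subseteq> A"
    and w: "w \<in> W" "pauli_support (pmul w b) \<subseteq> B" by (auto simp: red_def)
  have n: "a \<in> paulis n" "b \<in> paulis n" "v \<in> paulis n" "w \<in> paulis n"
    using a b v w W by (auto simp: perp_def)
  have one: "comm_sign v w = 1" "comm_sign a w = 1" "comm_sign b v = 1"
    using a b v w W by (auto simp: perp_def)
  have "comm_sign v b = comm_sign b v"
    using n by (intro comm_sign_commute) (simp add: paulis_def)
  then have "comm_sign (pmul v a) (pmul w b) = -1"
    using one ab n by (simp add: comm_sign_pmul[where n = n] comm_sign_pmul_left[where n = n])
  moreover have "comm_sign (pmul v a) (pmul w b) = 1"
  proof (rule comm_sign_disjoint)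
    fix q assume q: "q < length (pmul v a)"
    then have "q < length (pmul w b)" using n by (simp add: paulis_def)
    with q show "pmul v a ! q = PI \<or> pmul w b ! q = PI"
      using v(2) w(2) disj unfolding pauli_support_def by blast
  qed
  ultimately show False by simp
qed

lemma red_pmul:
  assumes W: "pauli_subgroup n W" and ab: "red W a S" "red W b S"
  shows "red W (pmul a b) S"
proof -
  obtain v w where v: "v \<in> W" "pauli_support (pmul v a) \<subseteq> S"
    and w: "w \<in> W" "pauli_support (pmul w b) \<subseteq> S" using ab by (auto simp: red_def)
  have "pmul (pmul v w) (pmul a b) = pmul (pmul v a) (pmul w b)"
    by (simp only: pmul_assoc pmul_left_commute[of w a b])
  then have "pauli_support (pmul (pmul v w) (pmul a b)) \<subseteq> S"
    using pauli_support_pmul[of "pmul v a" "pmul w b"] v w by auto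
  moreover have "pmul v w \<in> W" using W v w by (simp add: pauli_subgroup_def)
  ultimately show ?thesis by (auto simp: red_def)
qed

text \<open>The relations between the three classes are \<open>F1\<close> (operators on disjoint
  supports commute), \<open>F2\<close> (cleaning) and \<open>F3\<close> (products). The class of
  \<open>x\<close> matters most when neither \<open>z\<close> nor \<open>y\<close> reduces to
  \<open>A\<close>: if \<open>x\<close> reduces to \<open>B\<close>, then \<open>z\<close> and
  \<open>y\<close> reduce to \<open>B\<close> together or not at all; if it does not,
  \<open>F2\<close> makes both reduce.\<close>

lemma red_cases:
  assumes W: "pauli_subgroup n W" "W \<subseteq> perp n W" "card W = 2 ^ (n - 1)" "n \<ge> 1"
    and x: "x \<in> perp n W" and z: "z \<in> perp n W" and xz: "comm_sign x z = -1"
    and y: "y = pmul x z" and A: "A \<subseteq> {..<n}" and B: "B = {..<n} - A"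
  shows "red W z A \<and> red W y A \<and> \<not> red W z B \<and> \<not> red W y B \<or>
    red W z B \<and> red W y B \<and> \<not> red W z A \<and> \<not> red W y A \<or>
    \<not> red W z A \<and> \<not> red W y A \<and> \<not> red W z B \<and> \<not> red W y B \<or>
    red W z A \<and> red W z B \<and> \<not> red W y A \<and> \<not> red W y B \<or>
    red W y A \<and> red W y B \<and> \<not> red W z A \<and> \<not> red W z B"
proof -
  have xn: "x \<in> paulis n" and zn: "z \<in> paulis n" using x z by (simp_all add: perp_def)
  have sub: "W \<subseteq> paulis n" using W by (simp add: pauli_subgroup_def)
  have yn: "y \<in> paulis n" using xn zn y by simp
  have yp: "y \<in> perp n W"
    using pauli_subgroup_perp[OF sub] x z y by (simp add: pauli_subgroup_def)
  have zx: "comm_sign z x = -1" using xz comm_sign_commute[of x z] xn zn by (simp add: paulis_def)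
  have yz: "comm_sign y z = -1" and yx: "comm_sign y x = -1"
    using comm_sign_pmul_left[OF zn xn zn] comm_sign_pmul_left[OF xn xn zn] xz zx y by simp_all
  have zy: "comm_sign z y = -1" and xy: "comm_sign x y = -1"
    using comm_sign_commute[of z y] comm_sign_commute[of x y] yz yx xn yn zn by (simp_all add: paulis_def)
  have mult: "pmul z x = y" "pmul x z = y" "pmul x y = z" "pmul y x = z"
    using pmul_cancel[OF xn zn] by (simp_all add: y pmul_commute)
  have disj: "A \<inter> B = {}" using B by auto
  note d = red_disjoint[OF sub W(2) _ _ _ disj]
  have F1: "\<not> (red W z A \<and> red W y B)" "\<not> (red W y A \<and> red W z B)"
      "\<not> (red W z A \<and> red W x B)" "\<not> (red W y A \<and> red W x B)"
    using d[OF z yp zy] d[OF yp z yz] d[OF z x zx] d[OF yp x yx] by auto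
  have F2: "red W z A \<or> red W x B \<or> red W y B" "red W y A \<or> red W x B \<or> red W z B"
    using not_red_complement[OF W z x zx B] not_red_complement[OF W yp x yx B] by (auto simp: mult)
  have F3: "red W x B \<and> red W y B \<longrightarrow> red W z B" "red W x B \<and> red W z B \<longrightarrow> red W y B"
    using red_pmul[OF W(1), of x B y] red_pmul[OF W(1), of x B z] by (auto simp: mult)
  show ?thesis using F1 F2 F3 by blast
qed


section \<open>The bipartite magic gauge\<close>

definition supported_part :: "nat \<Rightarrow> complex mat set \<Rightarrow> nat set \<Rightarrow> complex mat set" where
  "supported_part n G S = {g \<in> G. supported_on n g S}"

lemma supported_partE:
  assumes "stab n G" "g \<in> supported_part n G S"
  obtains s ps where "s \<in> {1, -1}" "ps \<in> paulis n" "g = spauli s ps" "pauli_support ps \<subseteq> S"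
  using assms(2) unfolding supported_part_def supported_on_iff by blast

lemma stab_supported_part:
  assumes G: "stab n G"
  shows "stab n (supported_part n G S)"
proof -
  have "1\<^sub>m (2 ^ n) \<in> supported_part n G S"
    using G supported_on_spauli[of "pid n" n 1 S]
    by (auto simp: supported_part_def stab_def pauli_string_pid pauli_support_def)
  moreover have "g * h \<in> supported_part n G S"
    if g: "g \<in> supported_part n G S" and h: "h \<in> supported_part n G S" for g h
  proof -
    obtain s ps where s: "s \<in> {1, -1}" "ps \<in> paulis n" "g = spauli s ps" "pauli_support ps \<subseteq> S"
      by (rule supported_partE[OF G g])
    obtain t qs where t: "t \<in> {1, -1}" "qs \<in> paulis n" "h = spauli t qs" "pauli_support qs \<subseteq> S"
      by (rule supported_partE[OF G h])
    have gh: "g * h \<in> G" using G g h by (simp add: stab_def supported_part_def)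
    obtain u rs where u: "u \<in> {1, -1}" "rs \<in> labels n G" "rs \<in> paulis n" "g * h = spauli u rs"
      by (rule stabE[OF G gh])
    have "u \<noteq> 0" using u(1) by auto
    moreover have "spauli u rs = spauli (s * t * phase ps qs) (pmul ps qs)"
      using u(4) spauli_mult[OF s(2) t(2)] s(3) t(3) by simp
    ultimately have "rs = pmul ps qs"
      using spauli_inj[OF u(3) pmul_paulis[OF s(2) t(2)]] by blast
    then have "pauli_support rs \<subseteq> S" using pauli_support_pmul[of ps qs] s(4) t(4) by auto
    then have "supported_on n (g * h) S"
      using u(1,4) supported_on_spauli[OF u(3), of u] by auto
    then show ?thesis using gh by (simp add: supported_part_def)
  qed
  ultimately show ?thesis using G by (auto simp: stab_def supported_part_def)
qed

lemma supported_part_disjoint: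
  assumes G: "stab n G" and disj: "A \<inter> B = {}" and g: "g \<in> supported_part n G A" "g \<in> supported_part n G B"
  shows "g = 1\<^sub>m (2 ^ n)"
proof -
  obtain s ps where s: "s \<in> {1, -1}" "ps \<in> paulis n" "g = spauli s ps" "pauli_support ps \<subseteq> A"
    by (rule supported_partE[OF G g(1)])
  obtain t qs where t: "t \<in> {1, -1}" "qs \<in> paulis n" "g = spauli t qs" "pauli_support qs \<subseteq> B"
    by (rule supported_partE[OF G g(2)])
  have "s \<noteq> 0" using s(1) by auto
  then have "ps = qs" using s(3) t(3) spauli_inj[OF s(2) t(2)] by blast
  then have "pauli_support ps = {}" using s t disj by auto
  then have "ps = pid n" using s(2) by (intro nth_equalityI) (auto simp: paulis_def pauli_support_def)
  moreover have "g \<noteq> - 1\<^sub>m (2 ^ n)" using G g by (auto simp: supported_part_def stab_def)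
  ultimately show ?thesis using s by (auto simp: spauli_minus_pid spauli_pid simp del: spauli_one)
qed

lemma bipartite_generators:
  assumes G: "stab n G" and disj: "A \<inter> B = {}"
  shows "\<exists>as bs hs. independent_generators n G (as @ bs @ hs) \<and>
    (\<forall>a\<in>set as. generator_reducible n (as @ bs @ hs) a A \<and> \<not> generator_reducible n (as @ bs @ hs) a B) \<and>
    (\<forall>b\<in>set bs. generator_reducible n (as @ bs @ hs) b B \<and> \<not> generator_reducible n (as @ bs @ hs) b A) \<and>
    (\<forall>h\<in>set hs. \<not> generator_reducible n (as @ bs @ hs) h A \<and> \<not> generator_reducible n (as @ bs @ hs) h B)"
proof -
  let ?K = "stab_monoid n G"
  let ?A = "supported_part n G A" and ?B = "supported_part n G B"
  interpret boolean_group ?K by (rule stab_boolean_group[OF G])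
  have AG: "?A \<subseteq> G" and BG: "?B \<subseteq> G" by (auto simp: supported_part_def)
  have fin: "finite G" by (rule stab_finite[OF G])
  have finA: "finite ?A" and finB: "finite ?B" using finite_subset[OF _ fin] AG BG by auto
  have "indep {}" by (simp add: indep_def)
  then obtain Sa where Sa: "Sa \<subseteq> ?A" "indep Sa" "?A \<subseteq> generate ?K Sa"
    using indep_extend[of "{}" ?A] finA AG by auto
  obtain Sb where Sb: "Sb \<subseteq> ?B" "Sb \<inter> Sa = {}" "indep (Sa \<union> Sb)" "?B \<subseteq> generate ?K (Sa \<union> Sb)"
    using indep_extend[OF Sa(2), of ?B] finB BG by auto
  obtain Sh where Sh: "Sh \<subseteq> G" "Sh \<inter> (Sa \<union> Sb) = {}" "indep (Sa \<union> Sb \<union> Sh)" "G \<subseteq> generate ?K (Sa \<union> Sb \<union> Sh)"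
    using indep_extend[OF Sb(3), of G] fin by auto
  let ?S = "Sa \<union> Sb \<union> Sh"
  have SG: "?S \<subseteq> G" using Sa Sb Sh AG BG by auto
  obtain as where as: "set as = Sa" "distinct as" using finite_distinct_list finite_subset[OF Sa(1) finA] by blast
  obtain bs where bs: "set bs = Sb" "distinct bs" using finite_distinct_list finite_subset[OF Sb(1) finB] by blast
  obtain hs where hs: "set hs = Sh" "distinct hs" using finite_distinct_list finite_subset[OF Sh(1) fin] by blast
  have set: "set (as @ bs @ hs) = ?S" using as bs hs by auto
  have gen_le: "generate ?K T \<subseteq> supported_part n G R" if "T \<subseteq> supported_part n G R" for T R
  proof -
    have "generate ?K T = generate (GL n) T"
      using that by (intro generate_stab_monoid[OF G]) (auto simp: supported_part_def)
    also have "\<dots> \<subseteq> supported_part n G R"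
      by (rule group.generate_subgroup_incl[OF GL_group that stab_subgroup[OF stab_supported_part[OF G]]])
    finally show ?thesis .
  qed
  \<comment> \<open>\<open>Sb\<close> was chosen only so that \<open>Sa \<union> Sb\<close> spans
    \<open>?B\<close>. The factor from the span of \<open>Sa\<close> is supported on both
    \<open>A\<close> and \<open>B\<close>, hence trivial, so \<open>Sb\<close> suffices.\<close>
  have genB: "?B \<subseteq> generate ?K Sb"
  proof
    fix k assume k: "k \<in> ?B"
    have "Sa \<subseteq> G" "Sb \<subseteq> G" using Sa(1) Sb(1) AG BG by auto
    moreover have "k \<in> generate ?K (Sa \<union> Sb)" using k Sb(4) by blast
    ultimately obtain u t where u: "u \<in> generate ?K Sa" "t \<in> generate ?K Sb" "k = u * t"
      using generate_Un[of Sa Sb k] by auto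
    have "t \<in> ?B" "u \<in> ?A" using u gen_le[OF Sa(1)] gen_le[OF Sb(1)] by auto
    then have G3: "t \<in> G" "u \<in> G" "k \<in> G" using k AG BG by auto
    have "k * t = u * (t * t)"
      using G3 m_assoc[of u t t] u(3) by simp
    then have "k * t = u"
      by (simp only: stab_square[OF G G3(1)] right_mult_one_mat[OF stab_carrier[OF G G3(2)]])
    moreover have "k * t \<in> ?B" using stab_supported_part[OF G] k \<open>t \<in> ?B\<close> by (simp add: stab_def)
    ultimately have "u = 1\<^sub>m (2 ^ n)" using supported_part_disjoint[OF G disj \<open>u \<in> ?A\<close>] by simp
    then show "k \<in> generate ?K Sb" using u left_mult_one_mat[OF stab_carrier[OF G G3(1)]] by simp
  qed
  let ?gr = "generator_reducible n (as @ bs @ hs)"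
  have gr: "?gr s R \<longleftrightarrow>
      (\<exists>g\<in>generate ?K (?S - {s}). supported_on n (g * s) R)" for s R
    unfolding generator_reducible_def reducible_def set
    using generate_stab_monoid[OF G, of "?S - {s}"] SG by auto
  have yes: "?gr s R" if "s \<in> supported_part n G R" for s R
    unfolding gr
  proof (rule bexI[of _ "1\<^sub>m (2 ^ n)"])
    show "supported_on n (1\<^sub>m (2 ^ n) * s) R"
      using that left_mult_one_mat[OF stab_carrier[OF G, of s]] by (simp add: supported_part_def)
    show "1\<^sub>m (2 ^ n) \<in> generate ?K (?S - {s})" using generate.one[of ?K] by simp
  qed
  \<comment> \<open>Once the other generators span everything supported on \<open>R\<close>,
    reducing \<open>s\<close> to \<open>R\<close> would put \<open>s\<close> into their span,
    against independence.\<close>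
  have no: "\<not> ?gr s R"
    if s: "s \<in> ?S" and T: "T \<subseteq> ?S - {s}" "supported_part n G R \<subseteq> generate ?K T" for s T R
  proof
    let ?H = "generate ?K (?S - {s})"
    assume "?gr s R"
    then obtain g where g: "g \<in> ?H" "supported_on n (g * s) R" unfolding gr by auto
    have G2: "g \<in> G" "s \<in> G" using generate_in_carrier[of "?S - {s}" g] g SG s by auto
    then have "g * s \<in> supported_part n G R" using g(2) G by (simp add: supported_part_def stab_def)
    then have "g * s \<in> ?H" using T mono_generate[OF T(1)] by auto
    then have "g * (g * s) \<in> ?H" using generate.eng[OF g(1)] by simp
    moreover have "g * (g * s) = s"
      using m_assoc[of g g s, symmetric] G2 stab_square[OF G G2(1)] left_mult_one_mat[OF stab_carrier[OF G G2(2)]]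
      by simp
    ultimately show False using Sh(3) s by (simp add: indep_def)
  qed
  have "generate ?K ?S = G" using Sh(4) generate_incl[of ?S] SG by auto
  moreover have "distinct (as @ bs @ hs)" using as bs hs Sb(2) Sh(2) by auto
  ultimately have "independent_generators n G (as @ bs @ hs)"
    unfolding independent_generators_iff[OF G] set using Sh(3) by simp
  moreover have "\<not> ?gr s A" if "s \<in> Sb \<union> Sh" for s
    using that Sb(2) Sh(2) by (intro no[of s Sa] Sa(3)) auto
  moreover have "\<not> ?gr s B" if "s \<in> Sa \<union> Sh" for s
    using that Sb(2) Sh(2) by (intro no[of s Sb] genB) auto
  ultimately show ?thesis using yes Sa(1) Sb(1) as(1) bs(1) hs(1)
    by (intro exI[of _ as] exI[of _ bs] exI[of _ hs]) auto
qed

section \<open>The product formula for the code state\<close>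

lemma mat_prod_list_generators:
  assumes G: "stab n G" and gs: "independent_generators n G gs"
  shows "mat_prod_list n (map (\<lambda>g. 1\<^sub>m (2 ^ n) + g) gs) = mat_sum n G"
  using mat_prod_list_one_plus[OF G, of gs] gs unfolding independent_generators_iff[OF G] by simp

lemma mat_prod_list_half:
  assumes "set gs \<subseteq> op_carrier n"
  shows "mat_prod_list n (map (\<lambda>g. (1 / 2) \<cdot>\<^sub>m (1\<^sub>m (2 ^ n) + g)) gs) =
    (1 / 2) ^ length gs \<cdot>\<^sub>m mat_prod_list n (map (\<lambda>g. 1\<^sub>m (2 ^ n) + g) gs)"
proof -
  have "set (map (\<lambda>g. 1\<^sub>m (2 ^ n) + g) gs) \<subseteq> op_carrier n" using assms by auto
  from mat_prod_list_smult[OF this, of "1 / 2"] show ?thesis by (simp add: comp_def)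
qed

text \<open>Every independent generating set multiplies out to the same sum of \<open>G\<close>, so
  a change of generators leaves the state alone. The halves of the \<open>n - 1\<close> generators
  and the half of the logical factor combine to \<open>1 / 2 ^ n\<close>.\<close>

lemma bipartite_product:
  assumes G: "stab n G" and n: "n \<ge> 1" and gs: "independent_generators n G (as @ bs @ hs)"
    and len: "length as + length bs + length hs = n - 1"
    and D: "D \<in> op_carrier n"
  shows "(1 / 2 ^ n) \<cdot>\<^sub>m ((1\<^sub>m (2 ^ n) + (1 / complex_of_real (sqrt 2)) \<cdot>\<^sub>m D) * mat_sum n G) =
    ((1 / 2) \<cdot>\<^sub>m 1\<^sub>m (2 ^ n) + (1 / (2 * complex_of_real (sqrt 2))) \<cdot>\<^sub>m D)
            * mat_prod_list n (map (\<lambda>a. (1 / 2) \<cdot>\<^sub>m (1\<^sub>m (2 ^ n) + a)) as)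
            * mat_prod_list n (map (\<lambda>b. (1 / 2) \<cdot>\<^sub>m (1\<^sub>m (2 ^ n) + b)) bs)
            * mat_prod_list n (map (\<lambda>h. (1 / 2) \<cdot>\<^sub>m (1\<^sub>m (2 ^ n) + h)) hs)"
proof -
  let ?h = "\<lambda>g. (1 / 2) \<cdot>\<^sub>m (1\<^sub>m (2 ^ n) + g)"
  let ?C = "op_carrier n"
  let ?E = "1\<^sub>m (2 ^ n) + (1 / complex_of_real (sqrt 2)) \<cdot>\<^sub>m D"
  let ?F = "(1 / 2) \<cdot>\<^sub>m 1\<^sub>m (2 ^ n) + (1 / (2 * complex_of_real (sqrt 2))) \<cdot>\<^sub>m D"
  have "set (as @ bs @ hs) \<subseteq> G" using gs by (simp add: independent_generators_def)
  then have c: "set (as @ bs @ hs) \<subseteq> ?C" using stab_carrier[OF G] by blast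
  then have ch: "set (map ?h as) \<subseteq> ?C" "set (map ?h bs) \<subseteq> ?C" "set (map ?h hs) \<subseteq> ?C" by auto
  note cp = ch[THEN mat_prod_list_carrier]
  have F: "?F = (1 / 2) \<cdot>\<^sub>m ?E" by (rule eq_matI) (use D in auto)
  have Ec: "?E \<in> ?C" "?F \<in> ?C" using D by auto
  have "?F * mat_prod_list n (map ?h as) * mat_prod_list n (map ?h bs) * mat_prod_list n (map ?h hs)
      = ?F * (mat_prod_list n (map ?h as) * (mat_prod_list n (map ?h bs) * mat_prod_list n (map ?h hs)))"
    using Ec cp by (simp add: assoc_mult_mat[of _ "2 ^ n" "2 ^ n" _ "2 ^ n" _ "2 ^ n"])
  also have "\<dots> = ?F * mat_prod_list n (map ?h (as @ bs @ hs))"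
    unfolding map_append using ch by (subst mat_prod_list_append[symmetric], simp, simp)+ simp
  also have "\<dots> = ?F * ((1 / 2) ^ (n - 1) \<cdot>\<^sub>m mat_sum n G)"
    unfolding mat_prod_list_half[OF c] mat_prod_list_generators[OF G gs] using len by (simp add: add.assoc)
  also have "\<dots> = (1 / 2) ^ (n - 1) \<cdot>\<^sub>m ((1 / 2) \<cdot>\<^sub>m (?E * mat_sum n G))"
    unfolding mult_smult_distrib[OF Ec(2) mat_sum_carrier]
    unfolding F mult_smult_assoc_mat[OF Ec(1) mat_sum_carrier] ..
  also have "\<dots> = ((1 / 2) ^ (n - 1) * (1 / 2)) \<cdot>\<^sub>m (?E * mat_sum n G)"
    by (rule eq_matI) auto
  also have "(1 / 2) ^ (n - 1) * (1 / 2) = (1 / 2 ^ n :: complex)"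
    using n by (cases n) (simp_all add: power_one_over)
  finally show ?thesis by simp
qed

lemma pauli_op_lin:
  "i < 2 ^ n \<Longrightarrow> j < 2 ^ n \<Longrightarrow> pauli_op n (\<lambda>ps. a * e ps + b * f ps) $$ (i, j) =
    of_real a * pauli_op n e $$ (i, j) + of_real b * pauli_op n f $$ (i, j)"
  by (simp add: pauli_op_entry sum_distrib_left sum.distrib add_divide_distrib algebra_simps)

lemma perp_coset_hermitian:
  assumes G: "stab n G" and p: "p \<in> perp n (labels n G)" and s: "s \<in> {1, -1}" and g: "g \<in> G"
  shows "hermitian_pauli n (spauli s p * g)"
proof -
  obtain t qs where t: "t \<in> {1, -1}" "qs \<in> labels n G" "qs \<in> paulis n" "g = spauli t qs"
    by (rule stabE[OF G g])
  have "comm_sign p qs = 1" "p \<in> paulis n" using p t(2) by (simp_all add: perp_def)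
  then show ?thesis using hermitian_pauli_mult_iff[OF _ t(3) s t(1)] t(4) by simp
qed

lemma magic_state_eq_pauli_op:
  assumes G: "stab n G"
    and z: "z \<in> perp n (labels n G)" "s \<in> {1, -1}" "Z = spauli s z"
    and y: "y \<in> perp n (labels n G)" "t \<in> {1, -1}" "Y = spauli t y"
  shows "(1 / 2 ^ n) \<cdot>\<^sub>m ((1\<^sub>m (2 ^ n) + (1 / complex_of_real (sqrt 2)) \<cdot>\<^sub>m (Z - Y)) * mat_sum n G) =
    pauli_op n (\<lambda>ps. coeff G ps + (coeff ((*) Z ` G) ps - coeff ((*) Y ` G) ps) / sqrt 2)"
proof -
  let ?c = "1 / complex_of_real (sqrt 2)"
  let ?S = "mat_sum n G"
  have zn: "z \<in> paulis n" "y \<in> paulis n" using z y by (simp_all add: perp_def)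
  have c: "Z \<in> op_carrier n" "Y \<in> op_carrier n" "G \<subseteq> op_carrier n"
    using zn z y stab_carrier[OF G] by auto
  have coset: "spauli r p * ?S = 2 ^ n \<cdot>\<^sub>m pauli_op n (coeff (coset r p G))"
    if p: "p \<in> perp n (labels n G)" and r: "r \<in> {1, -1}" for r p
  proof -
    have pn: "p \<in> paulis n" using p by (simp add: perp_def)
    note cp = spauli_carrier[OF pn, of r]
    have "spauli r p * ?S = mat_sum n (coset r p G)"
      by (rule mult_mat_sum[OF cp c(3) involution_mult_inj[OF cp spauli_square[OF pn r] c(3)]])
    also have "\<dots> = 2 ^ n \<cdot>\<^sub>m pauli_op n (coeff (coset r p G))"
      using perp_coset_hermitian[OF G p r] by (intro mat_sum_eq_pauli_op) auto
    finally show ?thesis .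
  qed
  have S: "?S = 2 ^ n \<cdot>\<^sub>m pauli_op n (coeff G)"
    using G by (intro mat_sum_eq_pauli_op) (simp add: stab_def)
  have cZY: "Z - Y \<in> op_carrier n" "?c \<cdot>\<^sub>m (Z - Y) \<in> op_carrier n" using c by auto
  have "(1\<^sub>m (2 ^ n) + ?c \<cdot>\<^sub>m (Z - Y)) * ?S = ?S + ?c \<cdot>\<^sub>m (Z * ?S - Y * ?S)"
    unfolding add_mult_distrib_mat[OF one_carrier_mat cZY(2) mat_sum_carrier]
      mult_smult_assoc_mat[OF cZY(1) mat_sum_carrier] minus_mult_distrib_mat[OF c(1,2) mat_sum_carrier]
    by (simp add: left_mult_one_mat[OF mat_sum_carrier])
  also have "\<dots> = 2 ^ n \<cdot>\<^sub>m pauli_op n (coeff G) + ?c \<cdot>\<^sub>m (2 ^ n \<cdot>\<^sub>m pauli_op n (coeff ((*) Z ` G))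
      - 2 ^ n \<cdot>\<^sub>m pauli_op n (coeff ((*) Y ` G)))"
    unfolding z(3) y(3) coset[OF z(1,2)] coset[OF y(1,2)] unfolding S ..
  finally have eq: "(1\<^sub>m (2 ^ n) + ?c \<cdot>\<^sub>m (Z - Y)) * ?S = \<dots>" .
  have lin: "(\<lambda>ps. coeff G ps + (coeff ((*) Z ` G) ps - coeff ((*) Y ` G) ps) / sqrt 2) =
      (\<lambda>ps. 1 * coeff G ps + (1 / sqrt 2) * (1 * coeff ((*) Z ` G) ps + (- 1) * coeff ((*) Y ` G) ps))"
    by (auto simp: field_simps)
  show ?thesis unfolding eq lin
    by (rule eq_matI) (simp_all only: pauli_op_lin index_smult_mat index_add_mat index_minus_mat
        pauli_op_dim dim_row_mat dim_col_mat, simp_all add: field_simps)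
qed


section \<open>Partial trace\<close>

definition rank :: "nat set \<Rightarrow> nat \<Rightarrow> nat" where
  "rank A q = card {a \<in> A. a < q}"

lemma rank_bij:
  assumes "finite A"
  shows "bij_betw (rank A) A {..<card A}"
proof -
  have less: "rank A a < rank A b" if "a \<in> A" "a < b" for a b
    unfolding rank_def using that assms by (intro psubset_card_mono) auto
  have "inj_on (rank A) A"
  proof (rule inj_onI)
    fix a b assume "a \<in> A" "b \<in> A" "rank A a = rank A b"
    then show "a = b" using less[of a b] less[of b a] by (metis less_irrefl linorder_neqE_nat)
  qed
  moreover have "rank A ` A \<subseteq> {..<card A}"
    using assms by (auto simp: rank_def intro!: psubset_card_mono)
  ultimately show ?thesis
    using assms by (intro bij_betw_imageI card_subset_eq) (auto simp: card_image)
qed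

definition embed :: "nat \<Rightarrow> nat set \<Rightarrow> pauli list \<Rightarrow> pauli list" where
  "embed n A ps = map (\<lambda>q. if q \<in> A then ps ! rank A q else PI) [0..<n]"

lemma length_embed [simp]: "length (embed n A ps) = n" by (simp add: embed_def)
lemma embed_paulis [simp]: "embed n A ps \<in> paulis n" by (simp add: paulis_def)
lemma nth_embed [simp]: "q < n \<Longrightarrow> embed n A ps ! q = (if q \<in> A then ps ! rank A q else PI)"
  by (simp add: embed_def)

context
  fixes n :: nat and A B :: "nat set"
  assumes A: "A \<subseteq> {..<n}" and B: "B = {..<n} - A"
begin

lemma finite_AB: "finite A" "finite B" "A \<union> B = {..<n}" "A \<inter> B = {}" "card A + card B = n"
proof -
  show f: "finite A" "finite B" using finite_subset[OF A] B by auto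
  show u: "A \<union> B = {..<n}" "A \<inter> B = {}" using A B by auto
  show "card A + card B = n" using card_Un_disjoint[OF f u(2)] u(1) by simp
qed

lemma rank_less: "q \<in> A \<Longrightarrow> rank A q < card A"
  using rank_bij[OF finite_AB(1)] by (auto simp: bij_betw_def)

lemma prod_rank:
  "(\<Prod>q<n. if q \<in> A then f (rank A q) else 1) = (\<Prod>r<card A. f r :: 'a :: comm_monoid_mult)"
proof -
  have "(\<Prod>q<n. if q \<in> A then f (rank A q) else 1) = (\<Prod>q\<in>A. f (rank A q))"
    using A by (intro prod.mono_neutral_cong_right) auto
  also have "\<dots> = (\<Prod>r<card A. f r)"
    by (rule prod.reindex_bij_betw[OF rank_bij[OF finite_AB(1)]])
  finally show ?thesis .
qed

lemma embed_pmul: "ps \<in> paulis (card A) \<Longrightarrow> qs \<in> paulis (card A) \<Longrightarrow>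
    embed n A (pmul ps qs) = pmul (embed n A ps) (embed n A qs)"
  by (rule nth_equalityI) (auto simp: rank_less paulis_def)

lemma embed_pid: "embed n A (pid (card A)) = pid n"
  by (rule nth_equalityI) (auto simp: rank_less)

lemma phase_embed:
  assumes "ps \<in> paulis (card A)"
  shows "phase (embed n A ps) (embed n A qs) = phase ps qs"
proof -
  have "phase (embed n A ps) (embed n A qs) =
      (\<Prod>q<n. if q \<in> A then pauli_phase (ps ! rank A q) (qs ! rank A q) else 1)"
    unfolding phase_def by (intro prod.cong) auto
  also have "\<dots> = (\<Prod>r<card A. pauli_phase (ps ! r) (qs ! r))" by (rule prod_rank)
  finally show ?thesis using assms by (simp add: phase_def paulis_def)
qed

lemma comm_sign_embed:
  assumes "ps \<in> paulis (card A)"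
  shows "comm_sign (embed n A ps) (embed n A qs) = comm_sign ps qs"
proof -
  have "comm_sign (embed n A ps) (embed n A qs) =
      (\<Prod>q<n. if q \<in> A then pauli_sign (ps ! rank A q) (qs ! rank A q) else 1)"
    unfolding comm_sign_def by (intro prod.cong) auto
  also have "\<dots> = (\<Prod>r<card A. pauli_sign (ps ! r) (qs ! r))" by (rule prod_rank)
  finally show ?thesis using assms by (simp add: comm_sign_def paulis_def)
qed

lemma embed_bij: "bij_betw (embed n A) (paulis (card A)) {ps \<in> paulis n. pauli_support ps \<subseteq> A}"
proof (rule bij_betw_imageI)
  have surj: "\<exists>q\<in>A. rank A q = r" if "r < card A" for r
    using rank_bij[OF finite_AB(1)] that unfolding bij_betw_def by (metis imageE lessThan_iff)
  show "inj_on (embed n A) (paulis (card A))"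
  proof (rule inj_onI)
    fix ps qs assume ps: "ps \<in> paulis (card A)" "qs \<in> paulis (card A)" and eq: "embed n A ps = embed n A qs"
    have "ps ! r = qs ! r" if "r < card A" for r
    proof -
      obtain q where q: "q \<in> A" "rank A q = r" using surj[OF \<open>r < card A\<close>] by auto
      then have "q < n" using A by auto
      then show ?thesis using arg_cong[OF eq, of "\<lambda>l. l ! q"] q by simp
    qed
    then show "ps = qs" using ps by (intro nth_equalityI) (auto simp: paulis_def)
  qed
  show "embed n A ` paulis (card A) = {ps \<in> paulis n. pauli_support ps \<subseteq> A}"
  proof (intro equalityI subsetI)
    fix qs assume qs: "qs \<in> {ps \<in> paulis n. pauli_support ps \<subseteq> A}"
    define ps where "ps = map (\<lambda>r. qs ! inv_into A (rank A) r) [0..<card A]"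
    have "embed n A ps ! q = qs ! q" if "q < n" for q
    proof (cases "q \<in> A")
      case True
      then have "inv_into A (rank A) (rank A q) = q"
        using rank_bij[OF finite_AB(1)] by (intro inv_into_f_f) (auto simp: bij_betw_def)
      then show ?thesis using True that rank_less by (simp add: ps_def)
    next
      case False
      then show ?thesis using qs that by (auto simp: pauli_support_def paulis_def)
    qed
    then have "embed n A ps = qs" using qs by (intro nth_equalityI) (auto simp: paulis_def)
    moreover have "ps \<in> paulis (card A)" by (simp add: ps_def paulis_def)
    ultimately show "qs \<in> embed n A ` paulis (card A)" by blast
  qed (auto simp: pauli_support_def split: if_splits)
qed

lemma bit_sum_powers:
  "finite S \<Longrightarrow> bit (\<Sum>q\<in>S. of_bool (f q) * 2 ^ q :: nat) r \<longleftrightarrow> r \<in> S \<and> f r"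
proof (induction S arbitrary: r rule: finite_induct)
  case (insert x S)
  let ?a = "of_bool (f x) * 2 ^ x :: nat" and ?b = "\<Sum>q\<in>S. of_bool (f q) * 2 ^ q :: nat"
  have a: "bit ?a r \<longleftrightarrow> f x \<and> r = x" for r
    by (cases "f x") (auto simp: bit_exp_iff)
  \<comment> \<open>The summands share no bit, so the addition has no carries and equals the bitwise
    disjunction.\<close>
  have "and ?a ?b = 0"
  proof (rule bit_eqI)
    fix m
    have "bit (and ?a ?b) m = False"
      unfolding bit_and_iff a insert.IH using insert.hyps by auto
    moreover have "bit (0 :: nat) m = False" by simp
    ultimately show "bit (and ?a ?b) m \<longleftrightarrow> bit (0 :: nat) m" by (simp only:)
  qed
  then have "?a + ?b = or ?a ?b" by (rule disjunctive_add_eq_or)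
  then have "bit (?a + ?b) r \<longleftrightarrow> f x \<and> r = x \<or> r \<in> S \<and> f r"
    by (simp only: bit_or_iff a insert.IH)
  then show ?case unfolding sum.insert[OF insert.hyps] by auto
qed simp

lemma join_index_bit:
  "bit (join_index A B i k) r \<longleftrightarrow> (if r \<in> A then bit i (rank A r) else r \<in> B \<and> bit k (rank B r))"
proof -
  have "join_index A B i k = (\<Sum>q\<in>A \<union> B. of_bool (if q \<in> A then bit i (rank A q) else bit k (rank B q)) * 2 ^ q)"
    using finite_AB by (subst sum.union_disjoint) (auto simp: join_index_def rank_def intro!: arg_cong2[of _ _ _ _ "(+)"] sum.cong)
  then show ?thesis
    unfolding \<open>join_index A B i k = _\<close> bit_sum_powers[OF finite_UnI[OF finite_AB(1,2)]]
    using finite_AB(4) by auto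
qed

lemma join_index_less: "join_index A B i k < 2 ^ n"
proof -
  have "take_bit n (join_index A B i k) = join_index A B i k"
  proof -
    have "r < n" if "bit (join_index A B i k) r" for r
    proof -
      have "r \<in> A \<union> B" using that unfolding join_index_bit by (auto split: if_splits)
      then show ?thesis unfolding finite_AB(3) by simp
    qed
    then show ?thesis by (auto simp: bit_eq_iff bit_take_bit_iff)
  qed
  then show ?thesis by (metis take_bit_nat_less_exp)
qed

text \<open>The sum over \<open>k\<close> traces out each qubit of \<open>B\<close> separately,
  giving 2 for the identity and 0 for any other Pauli operator.\<close>

lemma reduced_pauli_entry:
  assumes ps: "ps \<in> paulis n"
  shows "(\<Sum>k<2 ^ card B. pauli_string ps $$ (join_index A B i k, join_index A B j k)) =
    (if pauli_support ps \<subseteq> A then 2 ^ card B *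
      (\<Prod>q\<in>A. pauli_mat (ps ! q) $$ (of_bool (bit i (rank A q)), of_bool (bit j (rank A q)))) else 0)"
proof -
  let ?F = "\<lambda>q. pauli_mat (ps ! q) $$ (of_bool (bit i (rank A q)), of_bool (bit j (rank A q)))"
  define g where "g = inv_into B (rank B)"
  have g: "g (rank B q) = q" if "q \<in> B" for q
    using rank_bij[OF finite_AB(2)] that unfolding g_def by (intro inv_into_f_f) (auto simp: bij_betw_def)
  let ?G = "\<lambda>r b. pauli_mat (ps ! g r) $$ (of_bool b, of_bool b)"
  have l: "length ps = n" using ps by (simp add: paulis_def)
  have "pauli_string ps $$ (join_index A B i k, join_index A B j k) =
      (\<Prod>q\<in>A. ?F q) * (\<Prod>r<card B. ?G r (bit k r))" for k
  proof -
    let ?H = "\<lambda>q. pauli_mat (ps ! q) $$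
        (of_bool (bit (join_index A B i k) q), of_bool (bit (join_index A B j k) q))"
    have "pauli_string ps $$ (join_index A B i k, join_index A B j k) = (\<Prod>q\<in>A \<union> B. ?H q)"
      unfolding finite_AB(3) by (rule pauli_string_entry[OF l join_index_less join_index_less])
    also have "\<dots> = (\<Prod>q\<in>A. ?H q) * (\<Prod>q\<in>B. ?H q)"
      using finite_AB by (intro prod.union_disjoint) auto
    also have "(\<Prod>q\<in>A. ?H q) = (\<Prod>q\<in>A. ?F q)"
      by (intro prod.cong) (auto simp: join_index_bit)
    also have "(\<Prod>q\<in>B. ?H q) = (\<Prod>q\<in>B. ?G (rank B q) (bit k (rank B q)))"
      using finite_AB(4) by (intro prod.cong) (auto simp: join_index_bit g)
    also have "\<dots> = (\<Prod>r<card B. ?G r (bit k r))"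
      by (rule prod.reindex_bij_betw[OF rank_bij[OF finite_AB(2)]])
    finally show ?thesis .
  qed
  then have "(\<Sum>k<2 ^ card B. pauli_string ps $$ (join_index A B i k, join_index A B j k)) =
      (\<Prod>q\<in>A. ?F q) * (\<Sum>k<2 ^ card B. \<Prod>r<card B. ?G r (bit (k :: nat) r))"
    by (simp add: sum_distrib_left)
  also have "(\<Sum>k<2 ^ card B. \<Prod>r<card B. ?G r (bit (k :: nat) r)) = (\<Prod>r<card B. if ps ! g r = PI then 2 else 0)"
    unfolding sum_prod_bits[where f = ?G] pauli_entry_trace ..
  also have "\<dots> = (\<Prod>q\<in>B. if ps ! g (rank B q) = PI then 2 else 0)"
    by (rule prod.reindex_bij_betw[OF rank_bij[OF finite_AB(2)], symmetric])
  also have "\<dots> = (\<Prod>q\<in>B. if ps ! q = PI then 2 else 0)"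
    by (intro prod.cong) (auto simp: g)
  also have "\<dots> = (if pauli_support ps \<subseteq> A then 2 ^ card B else 0)"
  proof (cases "pauli_support ps \<subseteq> A")
    case True
    then have "ps ! q = PI" if "q \<in> B" for q using that B l by (auto simp: pauli_support_def)
    then show ?thesis using True by simp
  next
    case False
    then obtain q where "q \<in> B" "ps ! q \<noteq> PI" using B l by (auto simp: pauli_support_def)
    then show ?thesis using False finite_AB(2) by (auto intro!: prod_zero)
  qed
  finally show ?thesis by simp
qed

text \<open>The expectation of an operator on \<open>A\<close> is that of its extension by the
  identity on \<open>B\<close>. The factor \<open>2 ^ card B\<close> from the trace adjusts the
  normalisation from \<open>n\<close> to \<open>card A\<close> qubits.\<close>

lemma reduced_pauli_op:
  "reduced_state A B (pauli_op n e) = pauli_op (card A) (\<lambda>ps. e (embed n A ps))" (is "?L = ?R")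
proof (rule eq_matI)
  fix i j assume "i < dim_row (?R)"
    "j < dim_col (?R)"
  then have ij: "i < 2 ^ card A" "j < 2 ^ card A" by simp_all
  let ?F = "\<lambda>ps. \<Prod>q\<in>A. pauli_mat (ps ! q) $$ (of_bool (bit i (rank A q)), of_bool (bit j (rank A q)))"
  let ?P = "\<lambda>ps k. pauli_string ps $$ (join_index A B i k, join_index A B j k)"
  have "?L $$ (i, j) =
      (\<Sum>k<2 ^ card B. \<Sum>ps\<in>paulis n. complex_of_real (e ps) * ?P ps k / 2 ^ n)"
    using ij by (simp add: reduced_state_def pauli_op_entry join_index_less sum_divide_distrib)
  also have "\<dots> = (\<Sum>ps\<in>paulis n. \<Sum>k<2 ^ card B. complex_of_real (e ps) * ?P ps k / 2 ^ n)"
    by (rule sum.swap)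
  also have "\<dots> = (\<Sum>ps\<in>paulis n. complex_of_real (e ps) * (\<Sum>k<2 ^ card B. ?P ps k) / 2 ^ n)"
    by (simp add: sum_distrib_left sum_divide_distrib)
  also have "\<dots> = (\<Sum>ps\<in>paulis n. if pauli_support ps \<subseteq> A then
      complex_of_real (e ps) * (2 ^ card B * ?F ps) / 2 ^ n else 0)"
    by (intro sum.cong refl) (simp add: reduced_pauli_entry)
  also have "\<dots> = (\<Sum>ps\<in>{ps \<in> paulis n. pauli_support ps \<subseteq> A}. complex_of_real (e ps) * (2 ^ card B * ?F ps) / 2 ^ n)"
    by (rule sum.inter_filter[symmetric]) simp
  also have "\<dots> = (\<Sum>ps\<in>paulis (card A). complex_of_real (e (embed n A ps)) * (2 ^ card B * ?F (embed n A ps)) / 2 ^ n)"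
    by (rule sum.reindex_bij_betw[OF embed_bij, symmetric])
  also have "\<dots> = (\<Sum>ps\<in>paulis (card A). complex_of_real (e (embed n A ps)) * pauli_string ps $$ (i, j) / 2 ^ card A)"
  proof (rule sum.cong[OF refl])
    fix ps assume ps: "ps \<in> paulis (card A)"
    have "?F (embed n A ps) = (\<Prod>q\<in>A. pauli_mat (ps ! rank A q) $$ (of_bool (bit i (rank A q)), of_bool (bit j (rank A q))))"
      using A by (intro prod.cong) (auto simp: subset_iff)
    also have "\<dots> = (\<Prod>r<card A. pauli_mat (ps ! r) $$ (of_bool (bit i r), of_bool (bit j r)))"
      by (rule prod.reindex_bij_betw[OF rank_bij[OF finite_AB(1)]])
    also have "\<dots> = pauli_string ps $$ (i, j)"
      using ps ij by (intro pauli_string_entry[symmetric]) (auto simp: paulis_def)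
    finally have F: "?F (embed n A ps) = pauli_string ps $$ (i, j)" .
    have "(2::complex) ^ n = 2 ^ card A * 2 ^ card B" using finite_AB(5) by (simp flip: power_add)
    then show "complex_of_real (e (embed n A ps)) * (2 ^ card B * ?F (embed n A ps)) / 2 ^ n =
        complex_of_real (e (embed n A ps)) * pauli_string ps $$ (i, j) / 2 ^ card A"
      unfolding F by simp
  qed
  also have "\<dots> = ?R $$ (i, j)"
    using ij by (simp add: pauli_op_entry sum_divide_distrib)
  finally show "?L $$ (i, j) = ?R $$ (i, j)" .
qed (simp_all add: reduced_state_def)

end


section \<open>Restriction of a stabilizer group to a subsystem\<close>

lemma spauli_mem_stab:
  assumes "stab n G" "spauli c ps \<in> G" "ps \<in> paulis n" "c \<noteq> 0"
  shows "c \<in> {1, -1}" "ps \<in> labels n G"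
proof -
  obtain s qs where "s \<in> {1, -1}" "qs \<in> labels n G" "qs \<in> paulis n" "spauli c ps = spauli s qs"
    by (rule stabE[OF assms(1,2)])
  then show "c \<in> {1, -1}" "ps \<in> labels n G"
    using spauli_inj[OF assms(3) _ assms(4), of qs s] by simp_all
qed

lemma coset_mem_iff:
  fixes M :: "complex mat"
  assumes M: "M \<in> carrier_mat N N" "M * M = 1\<^sub>m N" and S: "S \<subseteq> carrier_mat N N" and K: "K \<in> carrier_mat N N"
  shows "K \<in> (*) M ` S \<longleftrightarrow> M * K \<in> S"
proof -
  have MM: "M * (M * h) = h" if "h \<in> carrier_mat N N" for h
    using that M by (simp flip: assoc_mult_mat[of M N N M N h N])
  show ?thesis
  proof
    assume "K \<in> (*) M ` S"
    then obtain h where h: "h \<in> S" "K = M * h" by auto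
    then have "h \<in> carrier_mat N N" using S by auto
    then show "M * K \<in> S" using MM h by simp
  next
    assume "M * K \<in> S"
    then show "K \<in> (*) M ` S" using MM[OF K] by (metis imageI)
  qed
qed

lemma spauli_coset_mem_iff:
  assumes G: "stab n G" and p: "p \<in> paulis n" "ps \<in> paulis n" and s: "s \<in> {1, -1}"
  shows "spauli t ps \<in> coset s p G \<longleftrightarrow> spauli (s * t * phase p ps) (pmul p ps) \<in> G"
  using coset_mem_iff[OF spauli_carrier[OF p(1)] spauli_square[OF p(1) s] _ spauli_carrier[OF p(2)], of G t]
    stab_carrier[OF G] spauli_mult[OF p] by auto

text \<open>The entropy involves only even powers, so squares suffice and the signs need not be
  followed.\<close>

lemma coeff_stab_square:
  assumes G: "stab n G" and p: "ps \<in> paulis n"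
  shows "(coeff G ps)\<^sup>2 = of_bool (ps \<in> labels n G)"
  using stab_not_both[OF G, of 1 ps "-1"] p by (auto simp: coeff_def labels_def simp del: spauli_one)

lemma coeff_stab_mem:
  assumes G: "stab n G" and p: "ps \<in> paulis n" "s \<in> {1, -1}" "spauli (complex_of_real s) ps \<in> G"
  shows "coeff G ps = s"
  using stab_not_both[OF G, of 1 ps "-1"] p by (auto simp: coeff_def simp del: spauli_one)

lemma coeff_uminus_coset:
  assumes G: "stab n G" and p: "p \<in> paulis n" "ps \<in> paulis n" and s: "s \<in> {1, -1}"
  shows "coeff (coset (- s) p G) ps = - coeff (coset s p G) ps"
proof -
  have "- s \<in> {1, -1}" using s by auto
  then show ?thesis
    unfolding coeff_def using spauli_coset_mem_iff[OF G p s] spauli_coset_mem_iff[OF G p, of "- s"]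
    by (simp del: spauli_one)
qed

context
  fixes n :: nat and H :: "complex mat set" and p :: "pauli list" and s :: complex
  assumes H: "stab n H" and p: "p \<in> perp n (labels n H)" "p \<notin> labels n H" and s: "s \<in> {1, -1}"
begin

lemma coset_rep_paulis: "p \<in> paulis n"
  using p(1) by (simp add: perp_def)

lemma coset_label:
  assumes "spauli t ps \<in> coset s p H" "ps \<in> paulis n" "t \<noteq> 0"
  shows "ps \<in> pmul p ` labels n H"
proof -
  have nz: "s * t * phase p ps \<noteq> 0" using s assms(3) by (auto simp: phase_nonzero)
  have "pmul p ps \<in> labels n H"
    using assms(1) spauli_coset_mem_iff[OF H coset_rep_paulis assms(2) s] spauli_mem_stab(2)[OF H _ pmul_paulis[OF coset_rep_paulis assms(2)] nz]
    by simp
  then show ?thesis using pmul_cancel[OF coset_rep_paulis assms(2)] by (metis imageI)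
qed

lemma coset_labels_disjoint: "labels n H \<inter> pmul p ` labels n H = {}"
  using pauli_subgroup_mult_iff[OF labels_subgroup[OF H] _ coset_rep_paulis] p(2) by (auto simp: pmul_commute[of p])

lemma coset_disjoint: "H \<inter> coset s p H = {}"
proof (rule ccontr)
  assume "\<not> ?thesis"
  then obtain h where h: "h \<in> H" "h \<in> coset s p H" by auto
  obtain t ps where t: "t \<in> {1, -1}" "ps \<in> labels n H" "ps \<in> paulis n" "h = spauli t ps"
    by (rule stabE[OF H h(1)])
  then have "t \<noteq> 0" by auto
  then have "ps \<in> pmul p ` labels n H" using coset_label h(2) t by simp
  then show False using coset_labels_disjoint t(2) by auto
qed

lemma coeff_extend: "coeff (H \<union> coset s p H) ps = coeff H ps + coeff (coset s p H) ps"
  using coset_disjoint by (auto simp: coeff_def)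

text \<open>One inclusion is direct; equality follows by counting, as both sides have
  \<open>2 * card (labels n H)\<close> elements.\<close>

lemma labels_extend: "labels n (H \<union> coset s p H) = labels n H \<union> pmul p ` labels n H"
proof -
  have fin: "finite (labels n (H \<union> coset s p H))"
    by (rule pauli_subgroup_finite[OF labels_subgroup[OF stab_extend[OF H p s]]])
  have sub: "labels n (H \<union> coset s p H) \<subseteq> labels n H \<union> pmul p ` labels n H"
    using coset_label[of 1] coset_label[of "-1"] by (auto simp: labels_def simp del: spauli_one)
  have "inj_on ((*) (spauli s p)) H"
    using stab_carrier[OF H] by (intro involution_mult_inj[OF spauli_carrier[OF coset_rep_paulis] spauli_square[OF coset_rep_paulis s]]) auto
  then have "card (H \<union> coset s p H) = 2 * card H"
    using stab_finite[OF H] coset_disjoint by (simp add: card_Un_disjoint card_image)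
  then have "card (labels n (H \<union> coset s p H)) = 2 * card (labels n H)"
    using card_labels[OF H] card_labels[OF stab_extend[OF H p s]] by simp
  also have "\<dots> = card (labels n H \<union> pmul p ` labels n H)"
    using card_extend[OF labels_subgroup[OF H] coset_rep_paulis p(2)] by simp
  finally show ?thesis
    using sub pauli_subgroup_finite[OF labels_subgroup[OF H]] by (intro card_subset_eq) auto
qed

text \<open>A coset is not a group, but \<open>H\<close> together with it is, and outside the labels
  of \<open>H\<close> the coefficients of the coset are those of that larger group.\<close>

lemma coeff_coset_square:
  assumes ps: "ps \<in> paulis n"
  shows "(coeff (coset s p H) ps)\<^sup>2 = of_bool (ps \<in> pmul p ` labels n H)"
proof (cases "ps \<in> pmul p ` labels n H")
  case True
  then have "ps \<notin> labels n H" using coset_labels_disjoint by auto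
  then have "coeff H ps = 0" using coeff_stab_square[OF H ps] by simp
  moreover have "(coeff (H \<union> coset s p H) ps)\<^sup>2 = 1"
    using coeff_stab_square[OF stab_extend[OF H p s] ps] True unfolding labels_extend by simp
  ultimately show ?thesis using True by (simp add: coeff_extend)
next
  case False
  then have "spauli 1 ps \<notin> coset s p H" "spauli (-1) ps \<notin> coset s p H" using coset_label[OF _ ps] by fastforce+
  then show ?thesis using False by (simp add: coeff_def del: spauli_one)
qed

lemma card_coset_labels: "card (pmul p ` labels n H) = card (labels n H)"
proof -
  have "inj_on (pmul p) (labels n H)"
    using pmul_cancel[OF coset_rep_paulis] labels_paulis[of n H] by (intro inj_on_inverseI[of _ "pmul p"]) auto
  then show ?thesis by (rule card_image)
qed

end

text \<open>Commutation with \<open>p\<close> separates the two cosets: it is constantly 1 on the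
  coset of \<open>p\<close> and -1 on that of \<open>q\<close>.\<close>

lemma coset_labels_pair_disjoint:
  assumes H: "stab n H" and p: "p \<in> perp n (labels n H)" and q: "q \<in> perp n (labels n H)"
    and pq: "comm_sign p q = -1"
  shows "pmul p ` labels n H \<inter> pmul q ` labels n H = {}"
proof (rule ccontr)
  assume "\<not> ?thesis"
  then obtain v w where v: "v \<in> labels n H" "w \<in> labels n H" "pmul p v = pmul q w" by blast
  have n: "p \<in> paulis n" "q \<in> paulis n" "v \<in> paulis n" "w \<in> paulis n"
    using p q v labels_paulis by (auto simp: perp_def)
  have "comm_sign p (pmul p v) = 1" using comm_sign_pmul[OF n(1,1,3)] p v by (simp add: perp_def)
  moreover have "comm_sign p (pmul q w) = -1"
    using comm_sign_pmul[OF n(1,2,4)] p v pq by (simp add: perp_def)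
  ultimately show False using v(3) by simp
qed

text \<open>The elements of \<open>G\<close> supported on \<open>A\<close>, regarded as a stabilizer
  group on \<open>card A\<close> qubits of their own.\<close>

definition restrict_group :: "nat \<Rightarrow> nat set \<Rightarrow> complex mat set \<Rightarrow> complex mat set" where
  "restrict_group n A G =
    {M. \<exists>s\<in>{1, -1}. \<exists>ps\<in>paulis (card A). M = spauli s ps \<and> spauli s (embed n A ps) \<in> G}"

lemma restrict_group_mem_iff:
  assumes G: "stab n G" and ps: "ps \<in> paulis (card A)" and c: "c \<noteq> 0"
  shows "spauli c ps \<in> restrict_group n A G \<longleftrightarrow> spauli c (embed n A ps) \<in> G"
proof
  assume "spauli c ps \<in> restrict_group n A G"
  then obtain s qs where s: "qs \<in> paulis (card A)" "spauli c ps = spauli s qs" "spauli s (embed n A qs) \<in> G"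
    unfolding restrict_group_def by blast
  then have "ps = qs" "c = s" using spauli_inj[OF ps s(1) c] by simp_all
  then show "spauli c (embed n A ps) \<in> G" using s(3) by simp
next
  assume m: "spauli c (embed n A ps) \<in> G"
  then have "c \<in> {1, -1}" by (rule spauli_mem_stab(1)[OF G _ embed_paulis c])
  then show "spauli c ps \<in> restrict_group n A G" using m ps unfolding restrict_group_def by blast
qed

lemma labels_restrict:
  assumes G: "stab n G"
  shows "ps \<in> labels (card A) (restrict_group n A G) \<longleftrightarrow> ps \<in> paulis (card A) \<and> embed n A ps \<in> labels n G"
  using restrict_group_mem_iff[OF G, of ps A] by (auto simp: labels_def simp del: spauli_one)

lemma coeff_restrict:
  assumes G: "stab n G" and ps: "ps \<in> paulis (card A)"
  shows "coeff G (embed n A ps) = coeff (restrict_group n A G) ps"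
  unfolding coeff_def using restrict_group_mem_iff[OF G ps] by (simp del: spauli_one)

context
  fixes n :: nat and A B :: "nat set" and G :: "complex mat set"
  assumes A: "A \<subseteq> {..<n}" and B: "B = {..<n} - A" and G: "stab n G"
begin

lemma stab_restrict: "stab (card A) (restrict_group n A G)"
proof -
  let ?m = "card A" and ?H = "restrict_group n A G"
  have "spauli 1 (pid ?m) \<in> ?H" "spauli (-1) (pid ?m) \<notin> ?H"
    using restrict_group_mem_iff[OF G pid_paulis, of 1 A] restrict_group_mem_iff[OF G pid_paulis, of "-1" A] G
    unfolding embed_pid[OF A B] by (simp_all add: stab_def spauli_pid spauli_minus_pid del: spauli_one)
  moreover have "g * h \<in> ?H" if g: "g \<in> ?H" and h: "h \<in> ?H" for g h
  proof -
    obtain s ps where s: "s \<in> {1, -1}" "ps \<in> paulis ?m" "g = spauli s ps" "spauli s (embed n A ps) \<in> G"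
      using g unfolding restrict_group_def by blast
    obtain t qs where t: "t \<in> {1, -1}" "qs \<in> paulis ?m" "h = spauli t qs" "spauli t (embed n A qs) \<in> G"
      using h unfolding restrict_group_def by blast
    have "spauli s (embed n A ps) * spauli t (embed n A qs) \<in> G" using s t G by (simp add: stab_def)
    then have "spauli (s * t * phase ps qs) (embed n A (pmul ps qs)) \<in> G"
      unfolding spauli_mult[OF embed_paulis embed_paulis] phase_embed[OF A B s(2)] embed_pmul[OF A B s(2) t(2)] .
    moreover have "s * t * phase ps qs \<noteq> 0" using s t by (auto simp: phase_nonzero)
    ultimately show ?thesis
      using restrict_group_mem_iff[OF G pmul_paulis[OF s(2) t(2)]] unfolding s(3) t(3) spauli_mult[OF s(2) t(2)] by simp
  qed
  moreover have "hermitian_pauli ?m g" if "g \<in> ?H" for g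
    using that unfolding restrict_group_def hermitian_pauli_iff by blast
  ultimately show ?thesis by (auto simp: stab_def spauli_pid spauli_minus_pid simp del: spauli_one)
qed

lemma coeff_restrict_coset:
  assumes p: "p \<in> paulis (card A)" and ps: "ps \<in> paulis (card A)" and s: "s \<in> {1, -1}"
  shows "coeff (coset s (embed n A p) G) (embed n A ps) = coeff (coset s p (restrict_group n A G)) ps"
proof -
  have "spauli t (embed n A ps) \<in> coset s (embed n A p) G \<longleftrightarrow>
      spauli t ps \<in> coset s p (restrict_group n A G)" if "t \<noteq> 0" for t
  proof -
    have "s * t * phase p ps \<noteq> 0" using s that by (auto simp: phase_nonzero)
    then show ?thesis
      unfolding spauli_coset_mem_iff[OF G embed_paulis embed_paulis s] spauli_coset_mem_iff[OF stab_restrict p ps s]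
      by (simp add: phase_embed[OF A B p] embed_pmul[OF A B p ps, symmetric] restrict_group_mem_iff[OF G pmul_paulis[OF p ps]])
  qed
  then show ?thesis unfolding coeff_def by (simp del: spauli_one)
qed

lemma coeff_coset_not_red:
  assumes z: "z \<in> paulis n" and s: "s \<in> {1, -1}" and not_red: "\<not> red (labels n G) z A"
  shows "coeff (coset s z G) (embed n A ps) = 0"
proof -
  have "spauli t (embed n A ps) \<notin> coset s z G" if "t \<noteq> 0" for t
  proof
    assume "spauli t (embed n A ps) \<in> coset s z G"
    then have m: "spauli (s * t * phase z (embed n A ps)) (pmul z (embed n A ps)) \<in> G"
      using spauli_coset_mem_iff[OF G z embed_paulis s] by simp
    have "s * t * phase z (embed n A ps) \<noteq> 0" using s that by (auto simp: phase_nonzero)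
    then have "pmul z (embed n A ps) \<in> labels n G"
      by (rule spauli_mem_stab(2)[OF G m pmul_paulis[OF z embed_paulis]])
    moreover have "pmul (pmul z (embed n A ps)) z = embed n A ps"
      using pmul_cancel[OF z embed_paulis] by (simp add: pmul_commute)
    moreover have "pauli_support (embed n A ps) \<subseteq> A"
      by (auto simp: pauli_support_def split: if_splits)
    ultimately show False using not_red unfolding red_def by metis
  qed
  then show ?thesis by (simp add: coeff_def del: spauli_one)
qed

text \<open>The representative supported on \<open>A\<close> spans the same coset of
  \<open>G\<close>, so the coefficients can be read off on the subsystem. Its scalar
  \<open>t\<close> collects the signs and the phase of the product and is again a sign because that
  product is Hermitian.\<close>

lemma red_representative:
  assumes z: "z \<in> perp n (labels n G)" "z \<notin> labels n G" and s: "s \<in> {1, -1}" and red: "red (labels n G) z A"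
  shows "\<exists>w\<in>labels n G. \<exists>p t. embed n A p = pmul w z \<and> t \<in> {1, -1} \<and>
    p \<in> perp (card A) (labels (card A) (restrict_group n A G)) \<and> p \<notin> labels (card A) (restrict_group n A G) \<and>
    (\<forall>ps\<in>paulis (card A). coeff (coset s z G) (embed n A ps) =
      coeff (coset t p (restrict_group n A G)) ps)"
proof -
  let ?m = "card A" and ?H = "restrict_group n A G"
  have zn: "z \<in> paulis n" using z by (simp add: perp_def)
  obtain w where w: "w \<in> labels n G" "pauli_support (pmul w z) \<subseteq> A" using red by (auto simp: red_def)
  obtain u where u: "u \<in> {1, -1}" "spauli u w \<in> G" "w \<in> paulis n" by (rule labelsE[OF w(1)])
  have "pmul w z \<in> {ps \<in> paulis n. pauli_support ps \<subseteq> A}" using w(2) u(3) zn by simp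
  then obtain p where p: "p \<in> paulis ?m" "embed n A p = pmul w z"
    using embed_bij[OF A B] unfolding bij_betw_def by (metis (no_types, lifting) imageE)
  define t where "t = s * u * phase z w"
  have Z0: "spauli t (embed n A p) = spauli s z * spauli u w"
    unfolding spauli_mult[OF zn u(3)] by (simp add: p(2) t_def pmul_commute)
  have "t \<noteq> 0" using s u(1) by (auto simp: t_def phase_nonzero)
  moreover have "hermitian_pauli n (spauli t (embed n A p))"
    unfolding Z0 by (rule perp_coset_hermitian[OF G z(1) s u(2)])
  ultimately have t: "t \<in> {1, -1}"
    unfolding hermitian_pauli_iff using spauli_inj[OF embed_paulis, of _ n t] by metis
  have wz: "pmul w z \<in> perp n (labels n G)"
    using pauli_subgroup_perp[OF labels_paulis] labels_perp[OF G] w(1) z(1) unfolding pauli_subgroup_def by blast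
  have "p \<in> perp ?m (labels ?m ?H)"
  proof -
    have "comm_sign p ps = 1" if "ps \<in> labels ?m ?H" for ps
      using that wz comm_sign_embed[OF A B p(1), of ps] unfolding labels_restrict[OF G] p(2) by (simp add: perp_def)
    then show ?thesis using p(1) by (simp add: perp_def)
  qed
  moreover have "p \<notin> labels ?m ?H"
    using pauli_subgroup_mult_iff[OF labels_subgroup[OF G] w(1) zn] z(2) p unfolding labels_restrict[OF G] by simp
  moreover have "coset s z G = coset t (embed n A p) G"
  proof -
    have c: "spauli s z \<in> op_carrier n" "spauli u w \<in> op_carrier n"
      using zn u(3) by simp_all
    have step: "spauli t (embed n A p) * g = spauli s z * (spauli u w * g)" if "g \<in> G" for g
      unfolding Z0 by (rule assoc_mult_mat[OF c stab_carrier[OF G that]])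
    have closed: "spauli u w * g \<in> G" if "g \<in> G" for g using G u(2) that by (simp add: stab_def)
    have cancel: "spauli u w * (spauli u w * g) = g" if "g \<in> G" for g
      using assoc_mult_mat[OF c(2) c(2) stab_carrier[OF G that]] stab_square[OF G u(2)] stab_carrier[OF G that] by simp
    show ?thesis
    proof (intro equalityI subsetI)
      fix x assume "x \<in> coset s z G"
      then obtain g where g: "g \<in> G" "x = spauli s z * g" by auto
      then have "x = spauli t (embed n A p) * (spauli u w * g)"
        using step[OF closed[OF g(1)]] cancel by simp
      then show "x \<in> coset t (embed n A p) G" using closed[OF g(1)] by blast
    next
      fix x assume "x \<in> coset t (embed n A p) G"
      then obtain g where g: "g \<in> G" "x = spauli t (embed n A p) * g" by auto
      then show "x \<in> coset s z G" using step closed by blast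
    qed
  qed
  ultimately show ?thesis
    using w(1) p t coeff_restrict_coset[OF p(1) _ t] by metis
qed

end

text \<open>By disjointness at most one of \<open>f\<close>, \<open>g\<close>, \<open>h\<close> is
  nonzero at each string. Strings in \<open>W\<close> contribute 1 to both sums, and strings in
  \<open>V\<close> or \<open>U\<close> contribute 1/2 to the squares and 1/4 to the fourth
  powers.\<close>

lemma stabilizer_renyi_pauli_op:
  assumes disj: "W \<inter> V = {}" "W \<inter> U = {}" "V \<inter> U = {}"
    and sub: "W \<subseteq> paulis n" "V \<subseteq> paulis n" "U \<subseteq> paulis n"
    and f: "\<And>ps. ps \<in> paulis n \<Longrightarrow> (f ps)\<^sup>2 = of_bool (ps \<in> W)"
    and g: "\<And>ps. ps \<in> paulis n \<Longrightarrow> (g ps)\<^sup>2 = of_bool (ps \<in> V)"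
    and h: "\<And>ps. ps \<in> paulis n \<Longrightarrow> (h ps)\<^sup>2 = of_bool (ps \<in> U)"
  shows "stabilizer_renyi_entropy_2 n (pauli_op n (\<lambda>ps. f ps + (g ps - h ps) / sqrt 2)) =
    - log 2 ((card W + card V / 4 + card U / 4) / (card W + card V / 2 + card U / 2))"
proof -
  let ?e = "\<lambda>ps. f ps + (g ps - h ps) / sqrt 2"
  have eq: "(?e ps)\<^sup>2 = of_bool (ps \<in> W) + of_bool (ps \<in> V) / 2 + of_bool (ps \<in> U) / 2 \<and>
      (?e ps) ^ 4 = of_bool (ps \<in> W) + of_bool (ps \<in> V) / 4 + of_bool (ps \<in> U) / 4"
    if ps: "ps \<in> paulis n" for ps
  proof -
    have four: "x ^ 4 = (x\<^sup>2)\<^sup>2" for x :: real by (simp flip: power_mult)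
    have zero: "ps \<notin> W \<Longrightarrow> f ps = 0" "ps \<notin> V \<Longrightarrow> g ps = 0" "ps \<notin> U \<Longrightarrow> h ps = 0"
      using f[OF ps] g[OF ps] h[OF ps] by auto
    have sq: "(?e ps)\<^sup>2 = of_bool (ps \<in> W) + of_bool (ps \<in> V) / 2 + of_bool (ps \<in> U) / 2"
      using zero f[OF ps] g[OF ps] h[OF ps] disj
      by (cases "ps \<in> W"; cases "ps \<in> V"; cases "ps \<in> U") (auto simp: power_divide)
    show ?thesis
      unfolding four sq using disj
      by (cases "ps \<in> W"; cases "ps \<in> V"; cases "ps \<in> U") (auto simp: power_divide)
  qed
  have count: "(\<Sum>ps\<in>paulis n. of_bool (ps \<in> S)) = real (card S)" if "S \<subseteq> paulis n" for S
    using that by (simp add: Int_absorb1)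
  have "stabilizer_renyi_entropy_2 n (pauli_op n ?e) =
      - log 2 ((\<Sum>ps\<in>paulis n. (?e ps) ^ 4) / (\<Sum>ps\<in>paulis n. (?e ps)\<^sup>2))"
    unfolding stabilizer_renyi_entropy_2_def paulis_def[symmetric]
    by (simp add: mat_trace_pauli_op del: of_real_add of_real_divide of_real_diff)
  also have "(\<Sum>ps\<in>paulis n. (?e ps) ^ 4) = (\<Sum>ps\<in>paulis n. of_bool (ps \<in> W) + of_bool (ps \<in> V) / 4 + of_bool (ps \<in> U) / 4)"
    using eq by (intro sum.cong) auto
  also have "\<dots> = card W + card V / 4 + card U / 4"
    unfolding sum.distrib sum_divide_distrib[symmetric] by (simp only: count sub)
  also have "(\<Sum>ps\<in>paulis n. (?e ps)\<^sup>2) = (\<Sum>ps\<in>paulis n. of_bool (ps \<in> W) + of_bool (ps \<in> V) / 2 + of_bool (ps \<in> U) / 2)"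
    using eq by (intro sum.cong) auto
  also have "\<dots> = card W + card V / 2 + card U / 2"
    unfolding sum.distrib sum_divide_distrib[symmetric] by (simp only: count sub)
  finally show ?thesis .
qed


section \<open>Decompositions into stabilizer states\<close>

definition stabilizer_densities :: "nat \<Rightarrow> complex mat set" where
  "stabilizer_densities n = {pure_density v |v. stabilizer_state n v}"

definition stabilizer_mix :: "nat \<Rightarrow> complex mat set \<Rightarrow> (complex mat \<Rightarrow> real) \<Rightarrow> complex mat" where
  "stabilizer_mix n T x = mat (2 ^ n) (2 ^ n) (\<lambda>(i, j). \<Sum>\<sigma>\<in>T. complex_of_real (x \<sigma>) * \<sigma> $$ (i, j))"

text \<open>An upper bound rather than an equality: when decompositions are combined, weights of a
  state common to both may cancel.\<close>

definition decomposable :: "nat \<Rightarrow> real \<Rightarrow> (pauli list \<Rightarrow> real) \<Rightarrow> bool" where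
  "decomposable n r e \<longleftrightarrow> (\<exists>T x. finite T \<and> T \<subseteq> stabilizer_densities n \<and> (\<Sum>\<sigma>\<in>T. x \<sigma>) = 1 \<and>
     pauli_op n e = stabilizer_mix n T x \<and> (\<Sum>\<sigma>\<in>T. \<bar>x \<sigma>\<bar>) \<le> r)"

text \<open>The lower bound turns the bound in \<open>decomposable\<close> into an equality, so the
  minimum is attained and \<open>LEAST\<close> denotes it.\<close>

lemma robustness_eqI:
  assumes dec: "decomposable n r e"
    and lower: "\<And>T x. finite T \<Longrightarrow> T \<subseteq> stabilizer_densities n \<Longrightarrow> (\<Sum>\<sigma>\<in>T. x \<sigma>) = 1 \<Longrightarrow>
      pauli_op n e = stabilizer_mix n T x \<Longrightarrow> r \<le> (\<Sum>\<sigma>\<in>T. \<bar>x \<sigma>\<bar>)"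
  shows "robustness n (pauli_op n e) = r"
  unfolding robustness_def stabilizer_densities_def[symmetric] stabilizer_mix_def[symmetric]
proof (rule Least_equality)
  obtain T x where T: "finite T" "T \<subseteq> stabilizer_densities n" "(\<Sum>\<sigma>\<in>T. x \<sigma>) = 1"
      "pauli_op n e = stabilizer_mix n T x" "(\<Sum>\<sigma>\<in>T. \<bar>x \<sigma>\<bar>) \<le> r"
    using dec unfolding decomposable_def by blast
  moreover have "r = (\<Sum>\<sigma>\<in>T. \<bar>x \<sigma>\<bar>)" using lower[OF T(1-4)] T(5) by simp
  ultimately show "\<exists>T x. finite T \<and> T \<subseteq> stabilizer_densities n \<and> sum x T = 1 \<and>
      pauli_op n e = stabilizer_mix n T x \<and> r = (\<Sum>\<sigma>\<in>T. \<bar>x \<sigma>\<bar>)" by blast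
next
  fix r' assume "\<exists>T x. finite T \<and> T \<subseteq> stabilizer_densities n \<and> sum x T = 1 \<and>
      pauli_op n e = stabilizer_mix n T x \<and> r' = (\<Sum>\<sigma>\<in>T. \<bar>x \<sigma>\<bar>)"
  then show "r \<le> r'" using lower by blast
qed

text \<open>Negative \<open>a\<close> or \<open>b\<close> are allowed: no convex combination reaches
  a state of robustness above 1.\<close>

lemma decomposable_affine:
  assumes d: "decomposable n r e" "decomposable n r' f" and ab: "a + b = 1"
  shows "decomposable n (\<bar>a\<bar> * r + \<bar>b\<bar> * r') (\<lambda>ps. a * e ps + b * f ps)"
proof -
  obtain T x where T: "finite T" "T \<subseteq> stabilizer_densities n" "(\<Sum>\<sigma>\<in>T. x \<sigma>) = 1"
      "pauli_op n e = stabilizer_mix n T x" "(\<Sum>\<sigma>\<in>T. \<bar>x \<sigma>\<bar>) \<le> r"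
    using d(1) unfolding decomposable_def by blast
  obtain U y where U: "finite U" "U \<subseteq> stabilizer_densities n" "(\<Sum>\<sigma>\<in>U. y \<sigma>) = 1"
      "pauli_op n f = stabilizer_mix n U y" "(\<Sum>\<sigma>\<in>U. \<bar>y \<sigma>\<bar>) \<le> r'"
    using d(2) unfolding decomposable_def by blast
  \<comment> \<open>The weights are extended by zero, so that both decompositions live on
    \<open>T \<union> U\<close> even if \<open>T\<close> and \<open>U\<close> overlap.\<close>
  define x' where "x' \<sigma> = (if \<sigma> \<in> T then x \<sigma> else 0)" for \<sigma>
  define y' where "y' \<sigma> = (if \<sigma> \<in> U then y \<sigma> else 0)" for \<sigma>
  have extT: "(\<Sum>\<sigma>\<in>T \<union> U. F (x' \<sigma>) \<sigma>) = (\<Sum>\<sigma>\<in>T. F (x \<sigma>) \<sigma>)" if "\<And>\<sigma>. F 0 \<sigma> = 0"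
    for F :: "real \<Rightarrow> complex mat \<Rightarrow> 'b :: comm_monoid_add"
    using T(1) U(1) that by (intro sum.mono_neutral_cong_right) (auto simp: x'_def)
  have extU: "(\<Sum>\<sigma>\<in>T \<union> U. F (y' \<sigma>) \<sigma>) = (\<Sum>\<sigma>\<in>U. F (y \<sigma>) \<sigma>)" if "\<And>\<sigma>. F 0 \<sigma> = 0"
    for F :: "real \<Rightarrow> complex mat \<Rightarrow> 'b :: comm_monoid_add"
    using T(1) U(1) that by (intro sum.mono_neutral_cong_right) (auto simp: y'_def)
  define w where "w \<sigma> = a * x' \<sigma> + b * y' \<sigma>" for \<sigma>
  have "(\<Sum>\<sigma>\<in>T \<union> U. w \<sigma>) = a * (\<Sum>\<sigma>\<in>T \<union> U. x' \<sigma>) + b * (\<Sum>\<sigma>\<in>T \<union> U. y' \<sigma>)"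
    by (simp add: w_def sum.distrib sum_distrib_left)
  then have one: "(\<Sum>\<sigma>\<in>T \<union> U. w \<sigma>) = 1"
    using extT[of "\<lambda>c _. c"] extU[of "\<lambda>c _. c"] T(3) U(3) ab by simp
  have "(\<Sum>\<sigma>\<in>T \<union> U. \<bar>w \<sigma>\<bar>) \<le> (\<Sum>\<sigma>\<in>T \<union> U. \<bar>a\<bar> * \<bar>x' \<sigma>\<bar> + \<bar>b\<bar> * \<bar>y' \<sigma>\<bar>)"
    unfolding w_def by (intro sum_mono) (metis abs_mult abs_triangle_ineq)
  also have "\<dots> = \<bar>a\<bar> * (\<Sum>\<sigma>\<in>T. \<bar>x \<sigma>\<bar>) + \<bar>b\<bar> * (\<Sum>\<sigma>\<in>U. \<bar>y \<sigma>\<bar>)"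
    using extT[of "\<lambda>c _. \<bar>c\<bar>"] extU[of "\<lambda>c _. \<bar>c\<bar>"] by (simp add: sum.distrib flip: sum_distrib_left)
  also have "\<dots> \<le> \<bar>a\<bar> * r + \<bar>b\<bar> * r'"
    using T(5) U(5) by (intro add_mono mult_left_mono) auto
  finally have le: "(\<Sum>\<sigma>\<in>T \<union> U. \<bar>w \<sigma>\<bar>) \<le> \<bar>a\<bar> * r + \<bar>b\<bar> * r'" .
  have "pauli_op n (\<lambda>ps. a * e ps + b * f ps) = stabilizer_mix n (T \<union> U) w"
  proof (rule eq_matI)
    fix i j assume "i < dim_row (stabilizer_mix n (T \<union> U) w)" "j < dim_col (stabilizer_mix n (T \<union> U) w)"
    then have ij: "i < 2 ^ n" "j < 2 ^ n" by (simp_all add: stabilizer_mix_def)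
    have "(\<Sum>\<sigma>\<in>T \<union> U. complex_of_real (w \<sigma>) * \<sigma> $$ (i, j)) =
        (\<Sum>\<sigma>\<in>T \<union> U. of_real a * (of_real (x' \<sigma>) * \<sigma> $$ (i, j)) + of_real b * (of_real (y' \<sigma>) * \<sigma> $$ (i, j)))"
      by (intro sum.cong) (simp_all add: w_def algebra_simps)
    also have "\<dots> = of_real a * (\<Sum>\<sigma>\<in>T. of_real (x \<sigma>) * \<sigma> $$ (i, j)) + of_real b * (\<Sum>\<sigma>\<in>U. of_real (y \<sigma>) * \<sigma> $$ (i, j))"
      using extT[of "\<lambda>c \<sigma>. of_real c * \<sigma> $$ (i, j)"] extU[of "\<lambda>c \<sigma>. of_real c * \<sigma> $$ (i, j)"]
      by (simp add: sum.distrib flip: sum_distrib_left)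
    finally have mix: "stabilizer_mix n (T \<union> U) w $$ (i, j) =
        of_real a * stabilizer_mix n T x $$ (i, j) + of_real b * stabilizer_mix n U y $$ (i, j)"
      using ij by (simp add: stabilizer_mix_def)
    show "pauli_op n (\<lambda>ps. a * e ps + b * f ps) $$ (i, j) = stabilizer_mix n (T \<union> U) w $$ (i, j)"
      unfolding mix T(4)[symmetric] U(4)[symmetric] by (rule pauli_op_lin[OF ij])
  qed (simp_all add: stabilizer_mix_def)
  then show ?thesis
    unfolding decomposable_def using T(1,2) U(1,2) one le by (intro exI[of _ "T \<union> U"] exI[of _ w]) simp
qed

lemma decomposable_cong:
  "decomposable n r e \<Longrightarrow> (\<And>ps. ps \<in> paulis n \<Longrightarrow> e ps = f ps) \<Longrightarrow> decomposable n r f"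
  using pauli_op_cong[of n e f] by (simp add: decomposable_def)

section \<open>Pure stabilizer states as sums of maximal groups\<close>

lemma pauli_op_hermitian:
  assumes "i < 2 ^ n" "j < 2 ^ n"
  shows "cnj (pauli_op n e $$ (j, i)) = pauli_op n e $$ (i, j)"
  using assms by (simp add: pauli_op_entry pauli_string_hermitian[where n = n] paulis_def)

lemma mat_sum_mult_entry:
  assumes S: "S \<subseteq> op_carrier n" and K: "K \<in> op_carrier n"
    and ij: "i < 2 ^ n" "j < 2 ^ n"
  shows "(mat_sum n S * K) $$ (i, j) = (\<Sum>s\<in>S. (s * K) $$ (i, j))"
proof -
  have "(mat_sum n S * K) $$ (i, j) = (\<Sum>k<2 ^ n. (\<Sum>s\<in>S. s $$ (i, k)) * K $$ (k, j))"
    using ij K by (simp add: scalar_prod_def lessThan_atLeast0 mat_sum_def)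
  also have "\<dots> = (\<Sum>k<2 ^ n. \<Sum>s\<in>S. s $$ (i, k) * K $$ (k, j))"
    by (simp add: sum_distrib_right)
  also have "\<dots> = (\<Sum>s\<in>S. \<Sum>k<2 ^ n. s $$ (i, k) * K $$ (k, j))"
    by (rule sum.swap)
  also have "\<dots> = (\<Sum>s\<in>S. (s * K) $$ (i, j))"
  proof (rule sum.cong[OF refl])
    fix s assume "s \<in> S"
    then have "s \<in> op_carrier n" using S by auto
    then show "(\<Sum>k<2 ^ n. s $$ (i, k) * K $$ (k, j)) = (s * K) $$ (i, j)"
      using ij K by (simp add: scalar_prod_def lessThan_atLeast0)
  qed
  finally show ?thesis .
qed

text \<open>\<open>M\<close> is the projection onto the vectors fixed by \<open>H\<close>, scaled to
  trace 1. As each element of \<open>H\<close> fixes \<open>M\<close>, the product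
  \<open>M * M\<close> is \<open>card H / 2 ^ n\<close> times \<open>M\<close>, which is
  \<open>M\<close> for maximal \<open>H\<close>.\<close>

lemma stab_projector:
  assumes H: "stab n H"
  defines "M \<equiv> pauli_op n (coeff H)"
  shows "mat_sum n H = 2 ^ n \<cdot>\<^sub>m M"
    and "g \<in> H \<Longrightarrow> g * M = M"
    and "card H = 2 ^ n \<Longrightarrow> M * M = M"
    and "mat_trace M = 1"
proof -
  have c: "H \<subseteq> op_carrier n" using stab_carrier[OF H] by auto
  have Mc: "M \<in> op_carrier n" by (simp add: M_def)
  show S: "mat_sum n H = 2 ^ n \<cdot>\<^sub>m M"
    unfolding M_def using H by (intro mat_sum_eq_pauli_op) (simp add: stab_def)
  show gM: "g * M = M" if g: "g \<in> H" for g
  proof -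
    note gc = stab_carrier[OF H g]
    have closed: "g * h \<in> H" if "h \<in> H" for h using H g that by (simp add: stab_def)
    have "(*) g ` H = H"
    proof (intro equalityI subsetI)
      fix h assume h: "h \<in> H"
      have "g * (g * h) = h"
        using assoc_mult_mat[OF gc gc stab_carrier[OF H h]] stab_square[OF H g]
          left_mult_one_mat[OF stab_carrier[OF H h]] by simp
      then show "h \<in> (*) g ` H" using closed[OF h] by (metis imageI)
    qed (auto simp: closed)
    then have "g * mat_sum n H = mat_sum n H"
      using mult_mat_sum[OF gc c involution_mult_inj[OF gc stab_square[OF H g] c]] by simp
    then have eq: "2 ^ n \<cdot>\<^sub>m (g * M) = 2 ^ n \<cdot>\<^sub>m M"
      unfolding S mult_smult_distrib[OF gc Mc] .
    show ?thesis
    proof (rule eq_matI)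
      fix i j assume ij: "i < dim_row M" "j < dim_col M"
      then have "(2 ^ n \<cdot>\<^sub>m (g * M)) $$ (i, j) = 2 ^ n * (g * M) $$ (i, j)" using gc Mc by simp
      moreover have "(2 ^ n \<cdot>\<^sub>m M) $$ (i, j) = 2 ^ n * M $$ (i, j)" using ij by simp
      ultimately show "(g * M) $$ (i, j) = M $$ (i, j)" using eq by simp
    qed (use gc Mc in auto)
  qed
  show "M * M = M" if card: "card H = 2 ^ n"
  proof (rule eq_matI)
    fix i j assume "i < dim_row M" "j < dim_col M"
    then have ij: "i < 2 ^ n" "j < 2 ^ n" using Mc by auto
    have "(mat_sum n H * M) $$ (i, j) = (\<Sum>s\<in>H. M $$ (i, j))"
      unfolding mat_sum_mult_entry[OF c Mc ij] using gM by simp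
    then have "2 ^ n * (M * M) $$ (i, j) = 2 ^ n * M $$ (i, j)"
      unfolding S mult_smult_assoc_mat[OF Mc Mc] using card ij Mc by simp
    then show "(M * M) $$ (i, j) = M $$ (i, j)" by simp
  qed (use Mc in auto)
  have "coeff H (pid n) = 1"
    using H coeff_stab_mem[OF H pid_paulis, of 1] by (simp add: stab_def pauli_string_pid)
  then show "mat_trace M = 1"
    using mat_trace_pauli_op[OF pid_paulis, of n "coeff H"] left_mult_one_mat[OF Mc]
    by (simp add: pauli_string_pid M_def)
qed

text \<open>No spectral theorem is involved: a normalised nonzero column \<open>v\<close> lies in
  the range of \<open>M\<close>, and trace 1 leaves no room beside it. As \<open>v\<close> is a
  multiple of a column, \<open>g * M = M\<close> makes \<open>g\<close> fix it.\<close>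

lemma hermitian_projector_rank_one:
  assumes M: "M \<in> carrier_mat N N" and herm: "\<And>i j. i < N \<Longrightarrow> j < N \<Longrightarrow> cnj (M $$ (j, i)) = M $$ (i, j)"
    and proj: "M * M = M" and tr: "mat_trace M = 1"
  shows "\<exists>v\<in>carrier_vec N. v \<bullet>c v = 1 \<and> M = pure_density v \<and> (\<forall>g\<in>carrier_mat N N. g * M = M \<longrightarrow> g *\<^sub>v v = v)"
proof -
  have entry: "(\<Sum>k<N. M $$ (i, k) * M $$ (k, j)) = M $$ (i, j)" if "i < N" "j < N" for i j
    using arg_cong[OF proj, of "\<lambda>K. K $$ (i, j)"] that M by (simp add: scalar_prod_def lessThan_atLeast0)
  have tr': "(\<Sum>i<N. M $$ (i, i)) = 1" using tr M by (simp add: mat_trace_eq)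
  then obtain j where j: "j < N" "M $$ (j, j) \<noteq> 0"
    by (metis (no_types, lifting) lessThan_iff sum.neutral zero_neq_one)
  \<comment> \<open>By \<open>M * M = M\<close> and Hermiticity, the squared norm \<open>d\<close>
    of column \<open>j\<close> equals its diagonal entry, which was chosen nonzero.\<close>
  define d where "d = (\<Sum>k<N. (cmod (M $$ (k, j)))\<^sup>2)"
  have "M $$ (j, j) = (\<Sum>k<N. of_real ((cmod (M $$ (k, j)))\<^sup>2))"
  proof -
    have "M $$ (j, k) * M $$ (k, j) = of_real ((cmod (M $$ (k, j)))\<^sup>2)" if "k < N" for k
      using herm[OF j(1) that] by (metis complex_norm_square mult.commute)
    then show ?thesis using entry[OF j(1) j(1)] by (metis (no_types, lifting) lessThan_iff sum.cong)
  qed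
  then have d: "M $$ (j, j) = of_real d" by (simp add: d_def)
  have "d \<ge> 0" by (simp add: d_def sum_nonneg)
  then have d0: "d > 0" using d j(2) by (cases "d = 0") auto
  define v where "v = (1 / complex_of_real (sqrt d)) \<cdot>\<^sub>v col M j"
  have vc: "v \<in> carrier_vec N" using M by (simp add: v_def carrier_vecI)
  have vk: "v $ k = M $$ (k, j) / of_real (sqrt d)" if "k < N" for k
    using that M j(1) by (simp add: v_def)
  have fixed: "g *\<^sub>v v = v" if g: "g \<in> carrier_mat N N" "g * M = M" for g
  proof -
    have "g *\<^sub>v col M j = col M j"
      using col_mult2[OF g(1) M j(1)] g(2) by simp
    then show ?thesis
      unfolding v_def using g(1) M by (subst mult_mat_vec[of g N N]) (auto intro: carrier_vecI)
  qed
  have norm: "(\<Sum>k<N. v $ k * cnj (v $ k)) = 1"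
  proof -
    have "(\<Sum>k<N. v $ k * cnj (v $ k)) = (\<Sum>k<N. of_real ((cmod (M $$ (k, j)))\<^sup>2 / d))"
    proof (rule sum.cong[OF refl])
      fix k assume "k \<in> {..<N}"
      then have "cmod (v $ k) = cmod (M $$ (k, j)) / sqrt d" using vk d0 by (simp add: norm_divide)
      then show "v $ k * cnj (v $ k) = of_real ((cmod (M $$ (k, j)))\<^sup>2 / d)"
        unfolding complex_norm_square[symmetric] using d0 by (simp add: power_divide)
    qed
    also have "\<dots> = of_real (d / d)" unfolding d_def of_real_sum[symmetric] sum_divide_distrib ..
    finally show ?thesis using d0 by simp
  qed
  have vv: "v \<bullet>c v = 1"
    using norm vc by (simp add: scalar_prod_def lessThan_atLeast0)
  have Mv: "(\<Sum>k<N. M $$ (i, k) * v $ k) = v $ i" if "i < N" for i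
    using arg_cong[OF fixed[OF M proj], of "\<lambda>u. u $ i"] that M vc
    by (simp add: scalar_prod_def lessThan_atLeast0)
  define D where "D i k = M $$ (i, k) - v $ i * cnj (v $ k)" for i k
  \<comment> \<open>\<open>D\<close> is Hermitian, so the squared Frobenius norm of \<open>D\<close> is the trace of its square, which vanishes.\<close>
  have "(\<Sum>i<N. \<Sum>k<N. of_real ((cmod (D i k))\<^sup>2)) = (\<Sum>i<N. \<Sum>k<N. D i k * D k i)"
  proof (intro sum.cong refl)
    fix i k assume "i \<in> {..<N}" "k \<in> {..<N}"
    then have "cnj (D i k) = D k i" using herm[of k i] by (simp add: D_def)
    then show "complex_of_real ((cmod (D i k))\<^sup>2) = D i k * D k i" by (metis complex_norm_square)
  qed
  also have "\<dots> = (\<Sum>i<N. 0)"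
  proof -
    have "(\<Sum>k<N. D i k * D k i) = M $$ (i, i) - v $ i * cnj (v $ i)" if i: "i < N" for i
    proof -
      have "(\<Sum>k<N. D i k * D k i) = (\<Sum>k<N. M $$ (i, k) * M $$ (k, i) - cnj (v $ i) * (M $$ (i, k) * v $ k)
          - v $ i * cnj (M $$ (i, k) * v $ k) + v $ i * cnj (v $ i) * (v $ k * cnj (v $ k)))"
      proof (intro sum.cong refl)
        fix k assume "k \<in> {..<N}"
        then have "M $$ (k, i) = cnj (M $$ (i, k))" using herm[of k i] i by simp
        then show "D i k * D k i = M $$ (i, k) * M $$ (k, i) - cnj (v $ i) * (M $$ (i, k) * v $ k)
          - v $ i * cnj (M $$ (i, k) * v $ k) + v $ i * cnj (v $ i) * (v $ k * cnj (v $ k))"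
          by (simp add: D_def algebra_simps)
      qed
      also have "\<dots> = (\<Sum>k<N. M $$ (i, k) * M $$ (k, i)) - cnj (v $ i) * (\<Sum>k<N. M $$ (i, k) * v $ k)
          - v $ i * cnj (\<Sum>k<N. M $$ (i, k) * v $ k) + v $ i * cnj (v $ i) * (\<Sum>k<N. v $ k * cnj (v $ k))"
        by (simp only: sum.distrib sum_subtractf sum_distrib_left cnj_sum)
      also have "\<dots> = M $$ (i, i) - v $ i * cnj (v $ i)"
        unfolding entry[OF i i] Mv[OF i] norm by simp
      finally show ?thesis .
    qed
    then have "(\<Sum>i<N. \<Sum>k<N. D i k * D k i) = (\<Sum>i<N. M $$ (i, i)) - (\<Sum>i<N. v $ i * cnj (v $ i))"
      by (simp add: sum_subtractf)
    then show ?thesis unfolding tr' norm by simp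
  qed
  finally have "complex_of_real (\<Sum>i<N. \<Sum>k<N. (cmod (D i k))\<^sup>2) = 0" by simp
  then have zero: "(\<Sum>i<N. \<Sum>k<N. (cmod (D i k))\<^sup>2) = 0" using of_real_eq_0_iff by blast
  have D0: "D i k = 0" if ik: "i < N" "k < N" for i k
  proof -
    have "(\<Sum>k<N. (cmod (D i k))\<^sup>2) = 0"
      using zero ik by (subst (asm) sum_nonneg_eq_0_iff) (auto simp: sum_nonneg)
    then have "(cmod (D i k))\<^sup>2 = 0"
      using ik by (subst (asm) sum_nonneg_eq_0_iff) auto
    then show ?thesis by simp
  qed
  have "M = pure_density v"
    by (rule eq_matI) (use D0 M vc in \<open>auto simp: D_def pure_density_def\<close>)
  then show ?thesis using vc vv fixed by blast
qed

text \<open>The labels form an isotropic subspace, and its size times that of its complement is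
  \<open>4 ^ n\<close>. Hence it has at most \<open>2 ^ n\<close> elements, with equality exactly
  when it is its own complement.\<close>

lemma card_stab_le: 
  assumes H: "stab n H"
  shows "card H \<le> 2 ^ n" and "card H = 2 ^ n \<Longrightarrow> perp n (labels n H) = labels n H"
    and "card H \<noteq> 2 ^ n \<Longrightarrow> \<exists>p. p \<in> perp n (labels n H) \<and> p \<notin> labels n H"
proof -
  let ?W = "labels n H"
  have fin: "finite (perp n ?W)" by (simp add: perp_def)
  have le: "card ?W \<le> card (perp n ?W)" using labels_perp[OF H] fin by (rule card_mono[rotated])
  have prod: "card ?W * card (perp n ?W) = 2 ^ n * 2 ^ n"
    using card_perp[OF labels_subgroup[OF H]] by (simp flip: power_mult_distrib)
  show "card H \<le> 2 ^ n"
  proof (rule ccontr)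
    assume "\<not> card H \<le> 2 ^ n"
    then have "2 ^ n * 2 ^ n < card ?W * card (perp n ?W)"
      using le card_labels[OF H] by (intro mult_strict_mono) auto
    then show False using prod by simp
  qed
  show "perp n ?W = ?W" if "card H = 2 ^ n"
    using prod that card_labels[OF H] labels_perp[OF H] fin by (intro card_subset_eq[symmetric]) auto
  show "\<exists>p. p \<in> perp n ?W \<and> p \<notin> ?W" if "card H \<noteq> 2 ^ n"
  proof (rule ccontr)
    assume "\<not> ?thesis"
    then have "perp n ?W = ?W" using labels_perp[OF H] by auto
    then have "(card H)\<^sup>2 = (2 ^ n)\<^sup>2" using prod card_labels[OF H] by (simp add: power2_eq_square)
    then have "card H = 2 ^ n" by (simp add: power2_eq_iff_nonneg)
    then show False using that by simp
  qed
qed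

lemma decomposable_pure:
  assumes H: "stab n H" and card: "card H = 2 ^ n"
  shows "decomposable n 1 (coeff H)"
proof -
  let ?M = "pauli_op n (coeff H)"
  obtain v where v: "v \<in> carrier_vec (2 ^ n)" "v \<bullet>c v = 1" "?M = pure_density v"
      "\<And>g. g \<in> op_carrier n \<Longrightarrow> g * ?M = ?M \<Longrightarrow> g *\<^sub>v v = v"
    using hermitian_projector_rank_one[OF pauli_op_carrier pauli_op_hermitian stab_projector(3)[OF H card] stab_projector(4)[OF H]]
    by blast
  obtain gs where gs: "independent_generators n H gs" using independent_generators_exist[OF H] by blast
  have "(2::nat) ^ length gs = 2 ^ n" using card_stab[OF H gs] card by simp
  then have "length gs = n" by simp
  moreover have "\<forall>g\<in>H. g *\<^sub>v v = v" using v(4) stab_carrier[OF H] stab_projector(2)[OF H] by blast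
  ultimately have "stabilizer_state n v"
    unfolding stabilizer_state_def using v(1,2) gs stabilizer_group_iff[of n H] H by blast
  then have "?M \<in> stabilizer_densities n" using v(3) by (auto simp: stabilizer_densities_def)
  moreover have "?M = stabilizer_mix n {?M} (\<lambda>_. 1)"
    by (rule eq_matI) (simp_all add: stabilizer_mix_def)
  ultimately show ?thesis
    unfolding decomposable_def by (intro exI[of _ "{?M}"] exI[of _ "\<lambda>_. 1"]) simp
qed

text \<open>The two extensions agree on \<open>H\<close> and have opposite signs on the coset, which
  yields the weights \<open>a + b\<close> and \<open>a - b\<close>. Equal halves remove the coset
  and leave the sum of \<open>H\<close>.\<close>

lemma decomposable_extend:
  assumes H: "stab n H" and p: "p \<in> perp n (labels n H)" "p \<notin> labels n H" and s: "s \<in> {1, -1}"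
    and d: "\<And>t. t \<in> {1, -1} \<Longrightarrow> decomposable n 1 (coeff (H \<union> coset t p H))"
    and ab: "a + b = 1"
  shows "decomposable n (\<bar>a\<bar> + \<bar>b\<bar>) (\<lambda>ps. coeff H ps + (a - b) * coeff (coset s p H) ps)"
proof -
  have pn: "p \<in> paulis n" using p(1) by (simp add: perp_def)
  have s': "- s \<in> {1, -1}" using s by auto
  have "decomposable n (\<bar>a\<bar> * 1 + \<bar>b\<bar> * 1)
      (\<lambda>ps. a * coeff (H \<union> coset s p H) ps + b * coeff (H \<union> coset (- s) p H) ps)"
    by (rule decomposable_affine[OF d[OF s] d[OF s'] ab])
  then have "decomposable n (\<bar>a\<bar> * 1 + \<bar>b\<bar> * 1) (\<lambda>ps. coeff H ps + (a - b) * coeff (coset s p H) ps)"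
  proof (rule decomposable_cong)
    fix ps assume ps: "ps \<in> paulis n"
    have "b = 1 - a" using ab by simp
    then show "a * coeff (H \<union> coset s p H) ps + b * coeff (H \<union> coset (- s) p H) ps
        = coeff H ps + (a - b) * coeff (coset s p H) ps"
      unfolding coeff_extend[OF H p s] coeff_extend[OF H p s'] coeff_uminus_coset[OF H pn ps s] \<open>b = 1 - a\<close>
      by (simp add: algebra_simps)
  qed
  then show ?thesis by simp
qed

lemma decomposable_stab: "stab n H \<Longrightarrow> decomposable n 1 (coeff H)"
proof (induction "2 ^ n - card H" arbitrary: H rule: less_induct)
  case less
  note H = \<open>stab n H\<close>
  show ?case
  proof (cases "card H = 2 ^ n")
    case True
    then show ?thesis by (rule decomposable_pure[OF H])
  next
    case False
    then obtain p where p: "p \<in> perp n (labels n H)" "p \<notin> labels n H" using card_stab_le(3)[OF H] by blast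
    have pos: "card H > 0" using stab_finite[OF H] H by (auto simp: stab_def card_gt_0_iff)
    have d: "decomposable n 1 (coeff (H \<union> coset t p H))" if t: "t \<in> {1, -1}" for t
    proof -
      let ?K = "H \<union> coset t p H"
      have K: "stab n ?K" by (rule stab_extend[OF H p t])
      have pn: "p \<in> paulis n" using p(1) by (simp add: perp_def)
      have "card ?K = card (labels n H \<union> pmul p ` labels n H)"
        using card_labels[OF K] labels_extend[OF H p t] by simp
      also have "\<dots> = 2 * card H"
        using card_extend[OF labels_subgroup[OF H] pn p(2)] card_labels[OF H] by simp
      finally have "card ?K = 2 * card H" .
      \<comment> \<open>Truncation is harmless: \<open>card ?K \<le> 2 ^ n\<close>, so the measure
        drops by \<open>card H\<close>, which is positive.\<close>
      then have "2 ^ n - card ?K < 2 ^ n - card H"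
        using card_stab_le(1)[OF K] pos by linarith
      then show ?thesis by (rule less.hyps[OF _ K])
    qed
    have "decomposable n (\<bar>1 / 2\<bar> + \<bar>1 / 2\<bar>) (\<lambda>ps. coeff H ps + (1 / 2 - 1 / 2) * coeff (coset 1 p H) ps)"
      by (rule decomposable_extend[OF H p]) (use d in auto)
    then show ?thesis by simp
  qed
qed

section \<open>Lower bounds for the robustness\<close>

lemma robustness_one_le:
  assumes "finite T" "(\<Sum>\<sigma>\<in>T. x \<sigma>) = 1"
  shows "1 \<le> (\<Sum>\<sigma>\<in>T. \<bar>x \<sigma> :: real\<bar>)"
  using assms(2) sum_abs[of x T] by simp

lemma mat_trace_pauli_mix:
  assumes p: "ps \<in> paulis n" and T: "T \<subseteq> op_carrier n"
  shows "mat_trace (pauli_string ps * stabilizer_mix n T x) =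
    (\<Sum>\<sigma>\<in>T. of_real (x \<sigma>) * mat_trace (pauli_string ps * \<sigma>))"
  unfolding stabilizer_mix_def using p T by (intro mat_trace_mult_sum) auto

lemma mat_trace_pure_density:
  assumes M: "M \<in> carrier_mat N N" and v: "v \<in> carrier_vec N"
  shows "mat_trace (M * pure_density v) = (\<Sum>i<N. \<Sum>k<N. M $$ (i, k) * v $ k * cnj (v $ i))"
proof -
  have "pure_density v \<in> carrier_mat N N" using v by (simp add: pure_density_def)
  then have "mat_trace (M * pure_density v) = (\<Sum>i<N. \<Sum>k<N. M $$ (i, k) * pure_density v $$ (k, i))"
    by (rule mat_trace_mult[OF M])
  then show ?thesis using v by (auto simp: pure_density_def mult_ac intro!: sum.cong)
qed

lemma mult_mat_vec_entry:
  "M \<in> carrier_mat N N \<Longrightarrow> v \<in> carrier_vec N \<Longrightarrow> i < N \<Longrightarrow> (M *\<^sub>v v) $ i = (\<Sum>k<N. M $$ (i, k) * v $ k)"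
  by (simp add: scalar_prod_def lessThan_atLeast0)

text \<open>A string outside a maximal group anticommutes with some \<open>g\<close> in it, since
  the labels are their own complement. As \<open>g\<close> fixes \<open>v\<close>, moving it through
  the string shows that the expectation equals its own negative.\<close>

lemma stabilizer_expectation:
  assumes S: "stab n S" "card S = 2 ^ n" and v: "v \<in> carrier_vec (2 ^ n)" "v \<bullet>c v = 1"
    and fixed: "\<forall>g\<in>S. g *\<^sub>v v = v" and p: "ps \<in> paulis n"
  shows "ps \<in> labels n S \<Longrightarrow> \<bar>Re (mat_trace (pauli_string ps * pure_density v))\<bar> = 1"
    and "ps \<notin> labels n S \<Longrightarrow> mat_trace (pauli_string ps * pure_density v) = 0"
proof -
  let ?N = "2 ^ n :: nat"
  let ?E = "\<lambda>M. mat_trace (M * pure_density v)"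
  have E: "?E M = (\<Sum>i<?N. (M *\<^sub>v v) $ i * cnj (v $ i))" if "M \<in> carrier_mat ?N ?N" for M
    unfolding mat_trace_pure_density[OF that v(1)] using that v(1)
    by (intro sum.cong refl) (simp add: mult_mat_vec_entry sum_distrib_right del: index_mult_mat_vec)
  have norm: "(\<Sum>i<?N. v $ i * cnj (v $ i)) = 1"
    using v by (simp add: scalar_prod_def lessThan_atLeast0)
  have Pc: "pauli_string ps \<in> carrier_mat ?N ?N" using p by simp
  have sE: "?E (spauli c ps) = c * ?E (pauli_string ps)" for c
    using p v(1) by (simp add: mat_trace_pure_density[where N = ?N] spauli_def sum_distrib_left mult_ac paulis_def)
  show "\<bar>Re (?E (pauli_string ps))\<bar> = 1" if l: "ps \<in> labels n S"
  proof -
    obtain s where s: "s \<in> {1, -1}" "spauli s ps \<in> S" by (rule labelsE[OF l])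
    have "?E (spauli s ps) = 1" using E[OF spauli_carrier[OF p]] fixed s(2) norm by simp
    then have "Re (s * ?E (pauli_string ps)) = 1" unfolding sE by simp
    then show ?thesis using s(1) by auto
  qed
  show "?E (pauli_string ps) = 0" if "ps \<notin> labels n S"
  proof -
    have "ps \<notin> perp n (labels n S)" using that card_stab_le(2)[OF S] by simp
    then obtain w where w: "w \<in> labels n S" "comm_sign ps w \<noteq> 1"
      using p by (auto simp: perp_def)
    have ps_w: "comm_sign ps w = -1" using w(2) comm_sign_cases[of ps w] by simp
    obtain u where u: "u \<in> {1, -1}" "spauli u w \<in> S" "w \<in> paulis n" by (rule labelsE[OF w(1)])
    let ?g = "spauli u w" and ?P = "spauli 1 ps"
    have gc: "?g \<in> carrier_mat ?N ?N" and Pc: "?P \<in> carrier_mat ?N ?N" using u(3) p by simp_all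
    have gv: "?g *\<^sub>v v = v" using fixed u(2) by blast
    have herm: "cnj (?g $$ (i, k)) = ?g $$ (k, i)" if "i < ?N" "k < ?N" for i k
      using that u(1,3) pauli_string_hermitian[of w n k i] by (auto simp: spauli_def paulis_def)
    have anti: "?P * ?g = - (?g * ?P)"
      unfolding spauli_mult[OF p u(3)] spauli_mult[OF u(3) p] uminus_spauli
      using phase_swap[of ps w] ps_w p u(3) by (simp add: pmul_commute[of ps w] paulis_def)
    define q where "q = ?P *\<^sub>v v"
    have qc: "q \<in> carrier_vec ?N" unfolding q_def using Pc v(1) by (rule mult_mat_vec_carrier)
    have "?P *\<^sub>v v = (?P * ?g) *\<^sub>v v"
      unfolding assoc_mult_mat_vec[OF Pc gc v(1)] gv ..
    also have "\<dots> = - ((?g * ?P) *\<^sub>v v)"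
      unfolding anti
      by (rule uminus_mult_mat_vec)
        (simp only: carrier_vecD[OF v(1)] carrier_matD(2)[OF mult_carrier_mat[OF gc Pc]])
    also have "\<dots> = - (?g *\<^sub>v q)" unfolding q_def assoc_mult_mat_vec[OF gc Pc v(1)] ..
    finally have "?P *\<^sub>v v = - (?g *\<^sub>v q)" .
    then have q: "q = - (?g *\<^sub>v q)" unfolding q_def[symmetric] .
    have "?E ?P = (\<Sum>i<?N. q $ i * cnj (v $ i))" unfolding E[OF Pc] q_def ..
    also have "\<dots> = (\<Sum>i<?N. - ((?g *\<^sub>v q) $ i * cnj (v $ i)))"
    proof (intro sum.cong refl)
      fix i assume "i \<in> {..<?N}"
      then have "(- (?g *\<^sub>v q)) $ i = - (?g *\<^sub>v q) $ i"
        using gc by (intro index_uminus_vec) simp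
      then have "q $ i = - (?g *\<^sub>v q) $ i" using arg_cong[OF q, of "\<lambda>x. x $ i"] by (rule trans[rotated])
      then show "q $ i * cnj (v $ i) = - ((?g *\<^sub>v q) $ i * cnj (v $ i))" by (simp del: index_mult_mat_vec)
    qed
    also have "\<dots> = - (\<Sum>i<?N. \<Sum>k<?N. ?g $$ (i, k) * q $ k * cnj (v $ i))"
      unfolding sum_negf using gc qc
      by (intro arg_cong[of _ _ uminus] sum.cong refl) (simp add: mult_mat_vec_entry sum_distrib_right del: index_mult_mat_vec)
    also have "\<dots> = - (\<Sum>k<?N. \<Sum>i<?N. ?g $$ (i, k) * q $ k * cnj (v $ i))"
      by (intro arg_cong[of _ _ uminus] sum.swap)
    \<comment> \<open>Hermiticity moves \<open>?g\<close> to the other side of the inner product,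
      where it fixes \<open>v\<close>.\<close>
    also have "\<dots> = - (\<Sum>k<?N. q $ k * cnj ((?g *\<^sub>v v) $ k))"
    proof (intro arg_cong[of _ _ uminus] sum.cong refl)
      fix k assume "k \<in> {..<?N}"
      then have k: "k < ?N" by simp
      have "q $ k * cnj ((?g *\<^sub>v v) $ k) = (\<Sum>i<?N. q $ k * (cnj (?g $$ (k, i)) * cnj (v $ i)))"
        unfolding mult_mat_vec_entry[OF gc v(1) k] by (simp add: sum_distrib_left)
      also have "\<dots> = (\<Sum>i<?N. ?g $$ (i, k) * q $ k * cnj (v $ i))"
        using herm[OF k] by (intro sum.cong) (simp_all add: mult_ac)
      finally show "(\<Sum>i<?N. ?g $$ (i, k) * q $ k * cnj (v $ i)) = q $ k * cnj ((?g *\<^sub>v v) $ k)" ..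
    qed
    also have "\<dots> = - (\<Sum>k<?N. q $ k * cnj (v $ k))" unfolding gv ..
    also have "\<dots> = - ?E ?P" unfolding E[OF Pc] q_def ..
    finally have "?E ?P = - ?E ?P" .
    then show ?thesis by simp
  qed
qed

lemma anticommuting_witness:
  assumes \<sigma>: "\<sigma> \<in> stabilizer_densities n" and p: "ps \<in> paulis n" "qs \<in> paulis n" "comm_sign ps qs = -1"
    and s: "s \<in> {1, -1}" "t \<in> {1, -1 :: real}"
  shows "\<bar>s * Re (mat_trace (pauli_string ps * \<sigma>)) - t * Re (mat_trace (pauli_string qs * \<sigma>))\<bar> \<le> 1"
proof -
  obtain v S gs where v: "\<sigma> = pure_density v" "v \<in> carrier_vec (2 ^ n)" "v \<bullet>c v = 1"
    "stabilizer_group n S" "independent_generators n S gs" "length gs = n" "\<forall>g\<in>S. g *\<^sub>v v = v"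
    using \<sigma> unfolding stabilizer_densities_def stabilizer_state_def by blast
  have S: "stab n S" using v(4) stabilizer_group_iff by simp
  have card: "card S = 2 ^ n" using card_stab[OF S v(5)] v(6) by simp
  note exp = stabilizer_expectation[OF S card v(2,3,7)]
  have "\<not> (ps \<in> labels n S \<and> qs \<in> labels n S)" using stab_comm_sign[OF S, of ps qs] p(3) by auto
  then have "ps \<notin> labels n S \<or> qs \<notin> labels n S" by blast
  then show ?thesis
    unfolding v(1) using exp(1)[OF p(1)] exp(1)[OF p(2)] exp(2)[OF p(1)] exp(2)[OF p(2)] s
    by (cases "ps \<in> labels n S"; cases "qs \<in> labels n S") auto
qed

text \<open>Weak linear programming duality: an observable with values in the interval from -1 to 1
  on all stabilizer states bounds the total absolute weight of every decomposition from
  below.\<close>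

lemma robustness_lower_bound:
  assumes T: "finite T" "T \<subseteq> stabilizer_densities n" and eq: "pauli_op n e = stabilizer_mix n T x"
    and p: "ps \<in> paulis n" "qs \<in> paulis n" "comm_sign ps qs = -1"
    and s: "s \<in> {1, -1}" "t \<in> {1, -1 :: real}"
  shows "s * e ps - t * e qs \<le> (\<Sum>\<sigma>\<in>T. \<bar>x \<sigma>\<bar>)"
proof -
  have Tc: "T \<subseteq> op_carrier n"
    using T(2) by (auto simp: stabilizer_densities_def stabilizer_state_def pure_density_def)
  have e: "e r = (\<Sum>\<sigma>\<in>T. x \<sigma> * Re (mat_trace (pauli_string r * \<sigma>)))" if r: "r \<in> paulis n" for r
    using arg_cong[OF mat_trace_pauli_op[OF r, of e], of Re] unfolding eq mat_trace_pauli_mix[OF r Tc]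
    by simp
  have "s * e ps - t * e qs = (\<Sum>\<sigma>\<in>T. x \<sigma> * (s * Re (mat_trace (pauli_string ps * \<sigma>)) - t * Re (mat_trace (pauli_string qs * \<sigma>))))"
    unfolding e[OF p(1)] e[OF p(2)] by (simp add: sum_distrib_left sum_subtractf algebra_simps)
  also have "\<dots> \<le> (\<Sum>\<sigma>\<in>T. \<bar>x \<sigma>\<bar> * 1)"
  proof (intro sum_mono)
    fix \<sigma> assume "\<sigma> \<in> T"
    let ?d = "s * Re (mat_trace (pauli_string ps * \<sigma>)) - t * Re (mat_trace (pauli_string qs * \<sigma>))"
    have "\<bar>?d\<bar> \<le> 1"
      using anticommuting_witness[OF _ p s] T(2) \<open>\<sigma> \<in> T\<close> by blast
    then have "\<bar>x \<sigma>\<bar> * \<bar>?d\<bar> \<le> \<bar>x \<sigma>\<bar> * 1"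
      by (rule mult_left_mono) simp
    then show "x \<sigma> * ?d \<le> \<bar>x \<sigma>\<bar> * 1"
      unfolding abs_mult[symmetric] by (rule order_trans[OF abs_ge_self])
  qed
  finally show ?thesis by simp
qed


section \<open>The reduced state of the code state\<close>

lemma stab_card_pos: "stab n H \<Longrightarrow> card (labels n H) > 0"
  using card_labels[of n H] stab_finite[of n H] by (auto simp: stab_def card_gt_0_iff)

lemma stabilizer_measures_both:
  assumes H: "stab n H" and p: "p \<in> perp n (labels n H)" "p \<notin> labels n H" and s: "s \<in> {1, -1}"
    and q: "q \<in> perp n (labels n H)" "q \<notin> labels n H" and t: "t \<in> {1, -1}" and pq: "comm_sign p q = -1"
  defines "e \<equiv> \<lambda>ps. coeff H ps + (coeff (coset s p H) ps - coeff (coset t q H) ps) / sqrt 2"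
  shows "stabilizer_renyi_entropy_2 n (pauli_op n e) = log 2 (4 / 3)"
    and "robustness n (pauli_op n e) = sqrt 2"
proof -
  let ?W = "labels n H"
  let ?P = "coset s p H" and ?Q = "coset t q H"
  let ?N = "real (card ?W)"
  have n: "p \<in> paulis n" "q \<in> paulis n" using p q by (simp_all add: perp_def)
  have qp: "comm_sign q p = -1" using pq comm_sign_commute[of p q] n by (simp add: paulis_def)
  have sub: "pmul r ` ?W \<subseteq> paulis n" if "r \<in> paulis n" for r
    using that labels_paulis[of n H] by auto
  have N: "?N > 0" using stab_card_pos[OF H] by simp
  have "stabilizer_renyi_entropy_2 n (pauli_op n e) =
      - log 2 ((?N + real (card (pmul p ` ?W)) / 4 + real (card (pmul q ` ?W)) / 4) /
        (?N + real (card (pmul p ` ?W)) / 2 + real (card (pmul q ` ?W)) / 2))"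
    unfolding e_def
    by (rule stabilizer_renyi_pauli_op[OF coset_labels_disjoint[OF H p s] coset_labels_disjoint[OF H q t]
          coset_labels_pair_disjoint[OF H p(1) q(1) pq] labels_paulis sub[OF n(1)] sub[OF n(2)]
          coeff_stab_square[OF H] coeff_coset_square[OF H p s] coeff_coset_square[OF H q t]])
  \<comment> \<open>The three label sets have equal size, so the quotient is
    \<open>(1 + 1/4 + 1/4) / (1 + 1/2 + 1/2)\<close>.\<close>
  also have "\<dots> = - log 2 (3 / 4)"
    unfolding card_coset_labels[OF H p s] card_coset_labels[OF H q t]
    using N by (intro arg_cong[of _ _ "\<lambda>x. - log 2 x"]) (simp add: field_simps)
  also have "\<dots> = log 2 (4 / 3)" by (simp add: log_divide)
  finally show "stabilizer_renyi_entropy_2 n (pauli_op n e) = log 2 (4 / 3)" .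

  \<comment> \<open>The optimal weights are \<open>1 / 2\<close>, \<open>1 / 2 - c\<close> and \<open>c\<close>; \<open>a\<close> and \<open>b\<close> are the first two, rescaled to sum to 1.\<close>
  define c where "c = 1 / sqrt 2"
  have c: "c > 1 / 2" "c < 1" "sqrt 2 = 2 * c"
    by (auto simp: c_def field_simps real_less_lsqrt)
  \<comment> \<open>The coset of \<open>q\<close> enters \<open>e\<close> with a minus sign, hence
    the extension by \<open>- t\<close>.\<close>
  have t': "- t \<in> {1, -1}" using t by auto
  have dq: "decomposable n 1 (coeff (H \<union> coset (- t) q H))"
    by (rule decomposable_stab[OF stab_extend[OF H q t']])
  define a where "a = (1 / 2) / (1 - c)"
  define b where "b = (1 / 2 - c) / (1 - c)"
  have ab: "a + b = 1" "a - b = c / (1 - c)" "\<bar>a\<bar> + \<bar>b\<bar> = c / (1 - c)"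
    using c by (simp_all add: a_def b_def field_simps abs_if)
  have dp: "decomposable n (\<bar>a\<bar> + \<bar>b\<bar>) (\<lambda>ps. coeff H ps + (a - b) * coeff ?P ps)"
    by (rule decomposable_extend[OF H p s decomposable_stab[OF stab_extend[OF H p]] ab(1)])
  have "decomposable n (\<bar>1 - c\<bar> * (\<bar>a\<bar> + \<bar>b\<bar>) + \<bar>c\<bar> * 1)
      (\<lambda>ps. (1 - c) * (coeff H ps + (a - b) * coeff ?P ps) + c * coeff (H \<union> coset (- t) q H) ps)"
    by (rule decomposable_affine[OF dp dq]) simp
  moreover have "\<bar>1 - c\<bar> * (\<bar>a\<bar> + \<bar>b\<bar>) + \<bar>c\<bar> * 1 = sqrt 2"
    using c unfolding ab by simp
  ultimately have "decomposable n (sqrt 2)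
      (\<lambda>ps. (1 - c) * (coeff H ps + (a - b) * coeff ?P ps) + c * coeff (H \<union> coset (- t) q H) ps)"
    by (simp only:)
  then have dec: "decomposable n (sqrt 2) e"
  proof (rule decomposable_cong)
    fix ps assume ps: "ps \<in> paulis n"
    have "(1 - c) * (a - b) = c" using c unfolding ab by simp
    then have "(1 - c) * (coeff H ps + (a - b) * coeff ?P ps) = (1 - c) * coeff H ps + c * coeff ?P ps"
      by (simp only: distrib_left mult.assoc[symmetric])
    moreover have "(coeff ?P ps - coeff ?Q ps) / sqrt 2 = c * coeff ?P ps - c * coeff ?Q ps"
      by (simp add: c_def diff_divide_distrib)
    ultimately show "(1 - c) * (coeff H ps + (a - b) * coeff ?P ps) + c * coeff (H \<union> coset (- t) q H) ps = e ps"
      unfolding coeff_extend[OF H q t'] coeff_uminus_coset[OF H n(2) ps t] e_def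
      by (simp add: algebra_simps)
  qed
  \<comment> \<open>The witness is evaluated at \<open>p\<close> and \<open>q\<close> themselves,
    where only the coset of the respective string contributes to \<open>e\<close>.\<close>
  have at_rep: "coeff H r = 0 \<and> coeff (coset (complex_of_real u) r H) r = u \<and> coeff (coset v r' H) r = 0"
    if r: "r \<in> perp n ?W" "r \<notin> ?W" "u \<in> {1, -1}" and r': "r' \<in> perp n ?W" "r' \<notin> ?W" "v \<in> {1, -1}"
      and rr: "comm_sign r r' = -1" for r r' u v
  proof -
    have rn: "r \<in> paulis n" using r(1) by (simp add: perp_def)
    have u: "complex_of_real u \<in> {1, -1}" using r(3) by auto
    have zero: "coeff H r = 0" using coeff_stab_square[OF H rn] r(2) by simp
    have "1\<^sub>m (2 ^ n) \<in> H" using H by (simp add: stab_def)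
    moreover have "spauli (complex_of_real u) r = spauli (complex_of_real u) r * 1\<^sub>m (2 ^ n)"
      using right_mult_one_mat[OF spauli_carrier[OF rn]] by simp
    ultimately have "spauli (complex_of_real u) r \<in> H \<union> coset (complex_of_real u) r H" by blast
    then have "coeff (H \<union> coset (complex_of_real u) r H) r = u"
      by (rule coeff_stab_mem[OF stab_extend[OF H r(1,2) u] rn r(3)])
    then have one: "coeff (coset (complex_of_real u) r H) r = u"
      unfolding coeff_extend[OF H r(1,2) u] using zero by simp
    have "pid n \<in> ?W" using labels_subgroup[OF H] by (simp add: pauli_subgroup_def)
    then have "r \<in> pmul r ` ?W" using pmul_pid(1)[OF rn] by (metis imageI)
    then have "r \<notin> pmul r' ` ?W" using coset_labels_pair_disjoint[OF H r(1) r'(1) rr] by blast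
    then show ?thesis using zero one coeff_coset_square[OF H r' rn] by simp
  qed
  \<comment> \<open>\<open>s'\<close> and \<open>u\<close> are \<open>s\<close> and \<open>t\<close>
    as real numbers. Taken as the signs of the witness they make both of its terms equal to
    \<open>c\<close>, which gives \<open>2 * c = sqrt 2\<close>.\<close>
  obtain s' where s': "s = complex_of_real s'" "s' \<in> {1, -1}" using s that[of 1] that[of "-1"] by auto
  obtain u where u: "t = complex_of_real u" "u \<in> {1, -1}" using t that[of 1] that[of "-1"] by auto
  have "e p = s' * c" "e q = - (u * c)"
    using at_rep[OF p s'(2) q t pq] at_rep[OF q u(2) p s qp] unfolding e_def s'(1) u(1) by (simp_all add: c_def)
  moreover have "s' * s' = 1" "u * u = 1" using s' u by auto
  ultimately have "s' * e p - u * e q = sqrt 2" using c(3) s'(2) u(2) by auto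
  then have lower: "sqrt 2 \<le> (\<Sum>\<sigma>\<in>T. \<bar>x \<sigma>\<bar>)"
    if "finite T" "T \<subseteq> stabilizer_densities n" "pauli_op n e = stabilizer_mix n T x" for T x
    using robustness_lower_bound[OF that n pq s'(2) u(2)] by simp
  show "robustness n (pauli_op n e) = sqrt 2"
    by (rule robustness_eqI[OF dec lower])
qed

lemma stabilizer_measures_one:
  assumes H: "stab n H" and p: "p \<in> perp n (labels n H)" "p \<notin> labels n H" and s: "s \<in> {1, -1}"
  defines "e \<equiv> \<lambda>ps. coeff H ps + coeff (coset s p H) ps / sqrt 2"
  shows "stabilizer_renyi_entropy_2 n (pauli_op n e) = log 2 (6 / 5)"
    and "robustness n (pauli_op n e) = 1"
proof -
  let ?W = "labels n H"
  let ?N = "real (card ?W)"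
  have pn: "p \<in> paulis n" using p by (simp add: perp_def)
  have sub: "pmul p ` ?W \<subseteq> paulis n" using pn labels_paulis[of n H] by auto
  have N: "?N > 0" using stab_card_pos[OF H] by simp
  have "stabilizer_renyi_entropy_2 n (pauli_op n (\<lambda>ps. coeff H ps + (coeff (coset s p H) ps - 0) / sqrt 2)) =
      - log 2 ((?N + real (card (pmul p ` ?W)) / 4 + real (card ({} :: pauli list set)) / 4) /
        (?N + real (card (pmul p ` ?W)) / 2 + real (card ({} :: pauli list set)) / 2))"
    by (rule stabilizer_renyi_pauli_op[OF coset_labels_disjoint[OF H p s] _ _ labels_paulis sub _
          coeff_stab_square[OF H] coeff_coset_square[OF H p s]]) simp_all
  \<comment> \<open>Two label sets of equal size give the quotient
    \<open>(1 + 1/4) / (1 + 1/2)\<close>.\<close>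
  also have "\<dots> = - log 2 (5 / 6)"
    unfolding card_coset_labels[OF H p s]
    using N by (intro arg_cong[of _ _ "\<lambda>x. - log 2 x"]) (simp add: field_simps)
  also have "\<dots> = log 2 (6 / 5)" by (simp add: log_divide)
  finally show "stabilizer_renyi_entropy_2 n (pauli_op n e) = log 2 (6 / 5)" by (simp add: e_def)

  define c where "c = 1 / sqrt 2"
  have c: "c \<ge> 0" "c \<le> 1" by (auto simp: c_def)
  \<comment> \<open>The weights sum to 1 and differ by \<open>c\<close>. They are nonnegative since
    \<open>c \<le> 1\<close>, so a single coset costs no robustness.\<close>
  have "decomposable n (\<bar>(1 + c) / 2\<bar> + \<bar>(1 - c) / 2\<bar>)
      (\<lambda>ps. coeff H ps + ((1 + c) / 2 - (1 - c) / 2) * coeff (coset s p H) ps)"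
    by (rule decomposable_extend[OF H p s decomposable_stab[OF stab_extend[OF H p]]]) (simp_all add: field_simps)
  moreover have "\<bar>(1 + c) / 2\<bar> + \<bar>(1 - c) / 2\<bar> = 1" "(1 + c) / 2 - (1 - c) / 2 = c"
    using c by (simp_all add: field_simps)
  ultimately have "decomposable n 1 e" by (simp add: e_def c_def)
  then show "robustness n (pauli_op n e) = 1"
    using robustness_one_le by (rule robustness_eqI)
qed

lemma stabilizer_measures_none:
  assumes H: "stab n H"
  shows "stabilizer_renyi_entropy_2 n (pauli_op n (coeff H)) = 0"
    and "robustness n (pauli_op n (coeff H)) = 1"
proof -
  let ?W = "labels n H"
  have N: "real (card ?W) > 0" using stab_card_pos[OF H] by simp
  have "stabilizer_renyi_entropy_2 n (pauli_op n (\<lambda>ps. coeff H ps + (0 - 0) / sqrt 2)) =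
      - log 2 ((real (card ?W) + real (card ({} :: pauli list set)) / 4 + real (card ({} :: pauli list set)) / 4) /
        (real (card ?W) + real (card ({} :: pauli list set)) / 2 + real (card ({} :: pauli list set)) / 2))"
    by (rule stabilizer_renyi_pauli_op[OF _ _ _ labels_paulis _ _ coeff_stab_square[OF H]]) simp_all
  then show "stabilizer_renyi_entropy_2 n (pauli_op n (coeff H)) = 0" using N by simp
  show "robustness n (pauli_op n (coeff H)) = 1"
    using decomposable_stab[OF H] robustness_one_le by (rule robustness_eqI)
qed

section \<open>Logical operators as signed strings\<close>

lemma logical_operatorE:
  assumes G: "stab n G" and M: "logical_operator n G M"
  obtains s p where "s \<in> {1, -1}" "p \<in> perp n (labels n G)" "p \<notin> labels n G" "p \<in> paulis n" "M = spauli s p"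
proof -
  obtain s p where sp: "s \<in> {1, -1}" "p \<in> paulis n" "M = spauli s p"
    using M unfolding logical_operator_def hermitian_pauli_iff by blast
  have "comm_sign p w = 1" if w: "w \<in> labels n G" for w
  proof -
    obtain u where u: "u \<in> {1, -1}" "spauli u w \<in> G" "w \<in> paulis n" by (rule labelsE[OF w])
    have "s \<noteq> 0" "u \<noteq> 0" using sp u by auto
    moreover have "M * spauli u w = spauli u w * M" using M u(2) by (simp add: logical_operator_def)
    ultimately show ?thesis using spauli_commute_iff[OF sp(2) u(3)] unfolding sp(3) by blast
  qed
  then have perp: "p \<in> perp n (labels n G)" using sp(2) by (simp add: perp_def)
  have "p \<notin> labels n G"
  proof
    assume l: "p \<in> labels n G"
    obtain u where u: "u \<in> {1, -1}" "spauli u p \<in> G" by (rule labelsE[OF l])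
    then have "u = s \<or> u = - s" using sp(1) by auto
    then show False using u(2) M unfolding logical_operator_def sp(3) uminus_spauli by auto
  qed
  then show ?thesis using that sp perp by blast
qed

lemma spauli_anticommute:
  assumes p: "ps \<in> paulis n" "qs \<in> paulis n" and c: "c \<noteq> 0" "d \<noteq> 0"
    and eq: "spauli c ps * spauli d qs = - (spauli d qs * spauli c ps)"
  shows "comm_sign ps qs = -1"
proof -
  define u where "u = d * c * phase qs ps"
  have "u \<noteq> 0" using c by (simp add: u_def phase_nonzero)
  have "comm_sign ps qs \<noteq> 1"
  proof
    assume "comm_sign ps qs = 1"
    then have "spauli c ps * spauli d qs = spauli d qs * spauli c ps"
      using spauli_commute_iff[OF p c] by simp
    then have "spauli u (pmul qs ps) = spauli (- u) (pmul qs ps)"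
      using eq unfolding spauli_mult[OF p(2,1)] uminus_spauli u_def by simp
    then have "u = - u"
      using spauli_inj[OF pmul_paulis[OF p(2,1)] pmul_paulis[OF p(2,1)] \<open>u \<noteq> 0\<close>] by blast
    then show False using \<open>u \<noteq> 0\<close> by simp
  qed
  then show ?thesis using comm_sign_cases by blast
qed

lemma in_magic_case_unique: "in_magic_case n G Z Y A B c \<Longrightarrow> in_magic_case n G Z Y A B c' \<Longrightarrow> c = c'"
  by (cases c; cases c') auto

theorem theorem1:
  fixes L :: nat and \<psi> :: "complex vec" and \<rho> X Y Z :: "complex mat"
    and G :: "complex mat set" and gs :: "complex mat list" and A B :: "nat set"
  assumes "L \<ge> 1"
    and "stabilizer_group L G"
    and "independent_generators L G gs"
    and "length gs = L - 1"
    and "logical_xyz L G X Y Z"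
    and "\<psi> \<in> carrier_vec (2 ^ L)"
    and "\<psi> \<bullet>c \<psi> = 1"
    and "\<rho> = pure_density \<psi>"
    and "\<rho> = (1 / 2 ^ L) \<cdot>\<^sub>m
           ((1\<^sub>m (2 ^ L) + (1 / complex_of_real (sqrt 2)) \<cdot>\<^sub>m (Z - Y))
            * mat_prod_list L (map (\<lambda>g. 1\<^sub>m (2 ^ L) + g) gs))"
    and "A \<subseteq> {..<L}"
    and "B = {..<L} - A"
  shows
    "(\<exists>Z' Y' as bs hs.
        Z' \<in> Z <#\<^bsub>GL L\<^esub> G \<and> Y' \<in> Y <#\<^bsub>GL L\<^esub> G \<and>
        logical_operator L G Z' \<and> logical_operator L G Y' \<and>
        independent_generators L G (as @ bs @ hs) \<and>
        length as + length bs + length hs = L - 1 \<and>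
        \<rho> = ((1 / 2) \<cdot>\<^sub>m 1\<^sub>m (2 ^ L) + (1 / (2 * complex_of_real (sqrt 2))) \<cdot>\<^sub>m (Z' - Y'))
            * mat_prod_list L (map (\<lambda>a. (1 / 2) \<cdot>\<^sub>m (1\<^sub>m (2 ^ L) + a)) as)
            * mat_prod_list L (map (\<lambda>b. (1 / 2) \<cdot>\<^sub>m (1\<^sub>m (2 ^ L) + b)) bs)
            * mat_prod_list L (map (\<lambda>h. (1 / 2) \<cdot>\<^sub>m (1\<^sub>m (2 ^ L) + h)) hs) \<and>
        (\<forall>a\<in>set as. generator_reducible L (as @ bs @ hs) a A \<and>
                     \<not> generator_reducible L (as @ bs @ hs) a B) \<and>
        (\<forall>b\<in>set bs. generator_reducible L (as @ bs @ hs) b B \<and>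
                     \<not> generator_reducible L (as @ bs @ hs) b A) \<and>
        (\<forall>h\<in>set hs. \<not> generator_reducible L (as @ bs @ hs) h A \<and>
                     \<not> generator_reducible L (as @ bs @ hs) h B)) \<and>
     (\<exists>!c. in_magic_case L G Z Y A B c) \<and>
     (in_magic_case L G Z Y A B Case_i \<longrightarrow>
        stabilizer_renyi_entropy_2 (card A) (reduced_state A B \<rho>) = log 2 (4 / 3) \<and>
        robustness (card A) (reduced_state A B \<rho>) = sqrt 2) \<and>
     (in_magic_case L G Z Y A B Case_ii \<longrightarrow>
        stabilizer_renyi_entropy_2 (card A) (reduced_state A B \<rho>) = 0 \<and>
        robustness (card A) (reduced_state A B \<rho>) = 1) \<and>
     (in_magic_case L G Z Y A B Case_iii \<longrightarrow>
        stabilizer_renyi_entropy_2 (card A) (reduced_state A B \<rho>) = 0 \<and>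
        robustness (card A) (reduced_state A B \<rho>) = 1) \<and>
     (in_magic_case L G Z Y A B Case_iv \<longrightarrow>
        stabilizer_renyi_entropy_2 (card A) (reduced_state A B \<rho>) = log 2 (6 / 5) \<and>
        robustness (card A) (reduced_state A B \<rho>) = 1) \<and>
     (in_magic_case L G Z Y A B Case_v \<longrightarrow>
        stabilizer_renyi_entropy_2 (card A) (reduced_state A B \<rho>) = log 2 (6 / 5) \<and>
        robustness (card A) (reduced_state A B \<rho>) = 1)"
proof -

  \<comment> \<open>Labels of the logical operators\<close>
  let ?W = "labels L G" and ?m = "card A" and ?H = "restrict_group L A G"
  have G: "stab L G" using assms(2) by (simp add: stabilizer_group_iff)
  have lx: "logical_operator L G X" and ly: "logical_operator L G Y" and lz: "logical_operator L G Z"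
    and zx: "Z * X = - (X * Z)" and yz': "Y * Z = - (Z * Y)" and Yeq: "Y = \<i> \<cdot>\<^sub>m (X * Z)"
    using assms(5) unfolding logical_xyz_def by blast+
  obtain sx x where x: "sx \<in> {1, -1}" "x \<in> perp L ?W" "x \<notin> ?W" "x \<in> paulis L" "X = spauli sx x"
    by (rule logical_operatorE[OF G lx])
  obtain sy y where y: "sy \<in> {1, -1}" "y \<in> perp L ?W" "y \<notin> ?W" "y \<in> paulis L" "Y = spauli sy y"
    by (rule logical_operatorE[OF G ly])
  obtain sz z where z: "sz \<in> {1, -1}" "z \<in> perp L ?W" "z \<notin> ?W" "z \<in> paulis L" "Z = spauli sz z"
    by (rule logical_operatorE[OF G lz])
  have nz: "sx \<noteq> 0" "sy \<noteq> 0" "sz \<noteq> 0" using x(1) y(1) z(1) by auto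
  have yz: "comm_sign y z = -1"
    using spauli_anticommute[OF y(4) z(4) nz(2,3)] yz' unfolding y(5) z(5) by simp
  have zy: "comm_sign z y = -1"
    using yz comm_sign_commute[of y z] y(4) z(4) by (simp add: paulis_def)
  have xz: "comm_sign x z = -1"
    using spauli_anticommute[OF z(4) x(4) nz(3,1)] zx comm_sign_commute[of x z] x(4) z(4)
    unfolding x(5) z(5) by (simp add: paulis_def)
  have "spauli sy y = spauli (\<i> * (sx * sz * phase x z)) (pmul x z)"
    using Yeq unfolding x(5) y(5) z(5) spauli_mult[OF x(4) z(4)] smult_spauli .
  then have y_eq: "y = pmul x z"
    using spauli_inj[OF y(4) pmul_paulis[OF x(4) z(4)] nz(2)] by blast
  have card: "card ?W = 2 ^ (L - 1)"
    using card_labels[OF G] card_stab[OF G assms(3)] assms(4) by simp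
  note red_iff = reducible_iff[OF G z(2,1), folded z(5)] reducible_iff[OF G y(2,1), folded y(5)]

  have \<rho>: "\<rho> = (1 / 2 ^ L) \<cdot>\<^sub>m
      ((1\<^sub>m (2 ^ L) + (1 / complex_of_real (sqrt 2)) \<cdot>\<^sub>m (Z - Y)) * mat_sum L G)"
    using assms(9) unfolding mat_prod_list_generators[OF G assms(3)] .

  \<comment> \<open>The magic gauge\<close>
  have "A \<inter> B = {}" using assms(11) by auto
  then obtain as bs hs where gens: "independent_generators L G (as @ bs @ hs)"
    "\<forall>a\<in>set as. generator_reducible L (as @ bs @ hs) a A \<and> \<not> generator_reducible L (as @ bs @ hs) a B"
    "\<forall>b\<in>set bs. generator_reducible L (as @ bs @ hs) b B \<and> \<not> generator_reducible L (as @ bs @ hs) b A"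
    "\<forall>h\<in>set hs. \<not> generator_reducible L (as @ bs @ hs) h A \<and> \<not> generator_reducible L (as @ bs @ hs) h B"
    using bipartite_generators[OF G] by metis
  have "(2::nat) ^ length (as @ bs @ hs) = 2 ^ (L - 1)"
    using card_stab[OF G gens(1)] card card_labels[OF G] by simp
  then have len: "length as + length bs + length hs = L - 1" by (simp add: add.assoc)
  have ZYc: "Z - Y \<in> op_carrier L"
    unfolding z(5) y(5) by (intro minus_carrier_mat spauli_carrier y(4))
  \<comment> \<open>\<open>Z\<close> and \<open>Y\<close> themselves serve as representatives; the
    choice in the gauge is that of the generators.\<close>
  have self_coset: "M \<in> M <#\<^bsub>GL L\<^esub> G" if "M \<in> op_carrier L" for M
  proof -
    have "1\<^sub>m (2 ^ L) \<in> G" using G by (simp add: stab_def)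
    moreover have "M = M * 1\<^sub>m (2 ^ L)" using right_mult_one_mat[OF that] by simp
    ultimately show ?thesis unfolding l_coset_def by auto
  qed
  have "Z \<in> Z <#\<^bsub>GL L\<^esub> G" "Y \<in> Y <#\<^bsub>GL L\<^esub> G"
    using self_coset spauli_carrier[OF z(4)] spauli_carrier[OF y(4)] unfolding z(5) y(5) by blast+
  note part1 = this lz ly gens(1) len bipartite_product[OF G assms(1) gens(1) len ZYc, folded \<rho>] gens(2-4)

  \<comment> \<open>Exhaustion of the five cases\<close>
  have "\<exists>c. in_magic_case L G Z Y A B c"
    using red_cases[OF labels_subgroup[OF G] labels_perp[OF G] card assms(1) x(2) z(2) xz y_eq assms(10,11)]
    unfolding red_iff[symmetric] by (metis in_magic_case.simps)
  then have unique: "\<exists>!c. in_magic_case L G Z Y A B c" using in_magic_case_unique by blast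

  \<comment> \<open>The reduced state and its measures\<close>
  let ?fz = "\<lambda>ps. coeff ((*) Z ` G) (embed L A ps)" and ?fy = "\<lambda>ps. coeff ((*) Y ` G) (embed L A ps)"
  have H: "stab ?m ?H" by (rule stab_restrict[OF assms(10,11) G])
  have reduced: "reduced_state A B \<rho> = pauli_op ?m (\<lambda>ps. coeff ?H ps + (?fz ps - ?fy ps) / sqrt 2)"
    unfolding \<rho> magic_state_eq_pauli_op[OF G z(2,1,5) y(2,1,5)] reduced_pauli_op[OF assms(10,11)]
    by (rule pauli_op_cong) (simp add: coeff_restrict[OF G])
  have fz0: "?fz ps = 0" if "\<not> reducible L G Z A" for ps
    using coeff_coset_not_red[OF assms(10,11) G z(4,1)] that red_iff(1) unfolding z(5) by blast
  have fy0: "?fy ps = 0" if "\<not> reducible L G Y A" for ps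
    using coeff_coset_not_red[OF assms(10,11) G y(4,1)] that red_iff(2) unfolding y(5) by blast

  let ?measures = "\<lambda>M R. stabilizer_renyi_entropy_2 ?m (reduced_state A B \<rho>) = M \<and>
    robustness ?m (reduced_state A B \<rho>) = R"
  \<comment> \<open>The reduced state depends only on reducibility to \<open>A\<close>, so cases
    (ii) and (iii) share this computation.\<close>
  have none: "?measures 0 1"
    if "\<not> reducible L G Z A" "\<not> reducible L G Y A"
  proof -
    have "reduced_state A B \<rho> = pauli_op ?m (coeff ?H)"
      unfolding reduced using fz0[OF that(1)] fy0[OF that(2)] by simp
    then show ?thesis using stabilizer_measures_none[OF H] by simp
  qed
  have only_z: "?measures (log 2 (6 / 5)) 1"
    if "reducible L G Z A" "\<not> reducible L G Y A"
  proof -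
    have "red ?W z A" using that(1) red_iff(1) by blast
    then obtain w p t where p: "t \<in> {1, -1}" "p \<in> perp ?m (labels ?m ?H)" "p \<notin> labels ?m ?H"
        "\<forall>ps\<in>paulis ?m. ?fz ps = coeff (coset t p ?H) ps"
      using red_representative[OF assms(10,11) G z(2,3,1), folded z(5)] by blast
    have "reduced_state A B \<rho> = pauli_op ?m (\<lambda>ps. coeff ?H ps + coeff (coset t p ?H) ps / sqrt 2)"
      unfolding reduced by (rule pauli_op_cong) (simp add: fy0[OF that(2)] p(4))
    then show ?thesis using stabilizer_measures_one[OF H p(2,3,1)] by simp
  qed
  have only_y: "?measures (log 2 (6 / 5)) 1"
    if "\<not> reducible L G Z A" "reducible L G Y A"
  proof -
    have "red ?W y A" using that(2) red_iff(2) by blast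
    then obtain w p t where p: "t \<in> {1, -1}" "p \<in> perp ?m (labels ?m ?H)" "p \<notin> labels ?m ?H"
        "\<forall>ps\<in>paulis ?m. ?fy ps = coeff (coset t p ?H) ps"
      using red_representative[OF assms(10,11) G y(2,3,1), folded y(5)] by blast
    have pn: "p \<in> paulis ?m" using p(2) by (simp add: perp_def)
    \<comment> \<open>The minus sign of \<open>Y\<close> in the state is absorbed into the sign of
      the representative.\<close>
    have t: "- t \<in> {1, -1}" using p(1) by auto
    have "reduced_state A B \<rho> = pauli_op ?m (\<lambda>ps. coeff ?H ps + coeff (coset (- t) p ?H) ps / sqrt 2)"
      unfolding reduced
      by (rule pauli_op_cong) (simp add: fz0[OF that(1)] p(4) coeff_uminus_coset[OF H pn _ p(1)])
    then show ?thesis using stabilizer_measures_one[OF H p(2,3) t] by simp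
  qed
  have both: "?measures (log 2 (4 / 3)) (sqrt 2)"
    if "reducible L G Z A" "reducible L G Y A"
  proof -
    have "red ?W z A" "red ?W y A" using that red_iff by blast+
    obtain v p s where p: "v \<in> ?W" "embed L A p = pmul v z" "s \<in> {1, -1}"
        "p \<in> perp ?m (labels ?m ?H)" "p \<notin> labels ?m ?H"
        "\<forall>ps\<in>paulis ?m. ?fz ps = coeff (coset s p ?H) ps"
      using red_representative[OF assms(10,11) G z(2,3,1) \<open>red ?W z A\<close>, folded z(5)] by blast
    obtain w q t where q: "w \<in> ?W" "embed L A q = pmul w y" "t \<in> {1, -1}"
        "q \<in> perp ?m (labels ?m ?H)" "q \<notin> labels ?m ?H"
        "\<forall>ps\<in>paulis ?m. ?fy ps = coeff (coset t q ?H) ps"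
      using red_representative[OF assms(10,11) G y(2,3,1) \<open>red ?W y A\<close>, folded y(5)] by blast
    have n: "v \<in> paulis L" "w \<in> paulis L" "p \<in> paulis ?m"
      using p(1,4) q(1) labels_paulis by (auto simp: perp_def)
    have one: "comm_sign v w = 1" "comm_sign z w = 1" "comm_sign y v = 1"
      using stab_comm_sign[OF G p(1) q(1)] z(2) y(2) p(1) q(1) by (simp_all add: perp_def)
    have "comm_sign v y = comm_sign y v"
      using n y(4) by (intro comm_sign_commute) (simp add: paulis_def)
    \<comment> \<open>Factors from \<open>G\<close> do not affect the commutation of logical
      operators, and \<open>embed\<close> preserves commutation signs, so the representatives on
      \<open>A\<close> anticommute like \<open>z\<close> and \<open>y\<close>.\<close>
    then have "comm_sign (pmul v z) (pmul w y) = -1"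
      using one zy n y(4) z(4) by (simp add: comm_sign_pmul[where n = L] comm_sign_pmul_left[where n = L])
    then have pq: "comm_sign p q = -1"
      using comm_sign_embed[OF assms(10,11) n(3), of q] unfolding p(2) q(2) by simp
    have "reduced_state A B \<rho> = pauli_op ?m
        (\<lambda>ps. coeff ?H ps + (coeff (coset s p ?H) ps - coeff (coset t q ?H) ps) / sqrt 2)"
      unfolding reduced by (rule pauli_op_cong) (simp add: p(6) q(6))
    then show ?thesis using stabilizer_measures_both[OF H p(4,5,3) q(4,5,3) pq] by simp
  qed
  show ?thesis
    by (intro conjI exI[of _ Z] exI[of _ Y] exI[of _ as] exI[of _ bs] exI[of _ hs] part1 unique impI)
      (use none only_z only_y both in auto)
qed

end
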